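(* Let $p$ be a rational prime, let $f$ be an irreducible polynomial in $R_{d,p}=\mathbb{F}_p[u_1^{\pm1},\ldots,u_d^{\pm1}]$, and let $\alpha=\alpha_{R_{d,p}/\langle f\rangle}$ be the algebraic $\mathbb{Z}^d$-action associated to the module $R_{d,p}/\langle f\rangle$ over $R_d=\mathbb{Z}[u_1^{\pm1},\ldots,u_d^{\pm1}]$. Let $S(f)$ be the support of $f$, let $N(f)$ be the convex hull of $S(f)$, and let $v$ be the number of vertices of $N(f)$. Then (1) any non-mixing sequence for $\alpha$ along some subsequence contains, with uniform error, a parallel redrawing of $N(f)$; (2) hence $v-1\leqslant\mathcal{M}(\alpha)\leqslant\mathcal{S}(\alpha)\leqslant|S(f)|-1$.
   Context: For $\mathbf{n}=(n_1,\ldots,n_d)\in\mathbb{Z}^d$ write $\mathbf{u}^{\mathbf{n}}=u_1^{n_1}\cdots u_d^{n_d}$. Writing $f=\sum_{\mathbf{n}\in\mathbb{Z}^d}c_{f,\mathbf{n}}\mathbf{u}^{\mathbf{n}}$ (a finite sum, $c_{f,\mathbf{n}}\in\mathbb{F}_p$), the support of $f$ is the finite set $S(f)=\{\mathbf{n}\in\mathbb{Z}^d : c_{f,\mathbf{n}}\neq0\}$. Algebraic action: for the module $M=R_{d,p}/\langle f\rangle$, let $X$ be the compact abelian group dual to the discrete additive group $M$, let $\mu$ be Haar (probability) measure on $X$, and for $\mathbf{n}\in\mathbb{Z}^d$ let $\alpha^{\mathbf{n}}$ be the automorphism of $X$ dual to multiplication by $\mathbf{u}^{\mathbf{n}}$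 on $M$. This defines the measure-preserving $\mathbb{Z}^d$-action $\alpha=\alpha_M$. Parallel redrawing: if $P$ is a convex polyhedron in $\mathbb{R}^d$, a parallel redrawing of $P$ is another polyhedron $Q$ with the property that every edge of $Q$ is parallel to an edge of $P$. Mixing sequences: a sequence $(\mathbf{n}_1^{(j)},\ldots,\mathbf{n}_r^{(j)})_{j\geqslant1}$ in $(\mathbb{Z}^d)^r$ is moving apart if $\mathbf{n}_s^{(j)}-\mathbf{n}_t^{(j)}\to\infty$ as $j\to\infty$ for any $s\neq t$. A sequence that is moving apart is mixing for $\alpha$ if for any measurable sets $A_1,\ldots,A_r$, $$\mu\bigl(\alpha^{-\mathbf{n}_1^{(j)}}(A_1)\cap\cdots\cap\alpha^{-\mathbf{n}_r^{(j)}}(A_r)\bigr)\to\mu(A_1)\cdots\mu(A_r)\quad\text{as }j\to\infty;$$ a non-mixing sequence is one that is moving apart and is not mixing. "Contains, with uniform error, a parallel redrawing along some subsequence" means that there are a constant $K$, independent of $j$, and an infinite set of indices $j$ such that, for each such $j$, after the points $\mathbf{n}_1^{(j)},\ldots,\mathbf{n}_r^{(j)}$ are moved by distances at most $K$, the moved points contain the vertices of a parallel redrawing of $N(f)$. Order of mixing: $\alpha$ is $r$-mixing if every sequence of $r$-tuples that is moving apart is mixing for $\alpha$; $\mathcal{M}(\alpha)$ is the maximum $r$ for which $\alpha$ is $r$-mixing ($\infty$ if there is no maximum). Shape order of mixing: a finite set $\{\mathbf{n}_1,\ldots,\mathbf{n}_r\}$ of integer vectors is a mixing shape for $\alpha$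 if for any measurable sets $A_1,\ldots,A_r$, $\mu(\alpha^{-k\mathbf{n}_1}(A_1)\cap\cdots\cap\alpha^{-k\mathbf{n}_r}(A_r))\to\mu(A_1)\cdots\mu(A_r)$ as $k\to\infty$; $\mathcal{S}(\alpha)$ is the maximum $r$ for which all shapes of cardinality $r$ are mixing shapes ($\infty$ if there is no maximum). *)

theory Defs
  imports
    "HOL-Probability.Probability"
    "HOL-Algebra.QuotRing"
    "HOL-Library.Poly_Mapping"
    "HOL-Library.Extended_Nat"
    "Berlekamp_Zassenhaus.Finite_Field"
begin

section \<open>Laurent polynomials over a prime field\<close>

text \<open>The ring \<open>R\<^bsub>d,p\<^esub>\<close>, with \<open>d = CARD('d)\<close> and \<open>p = CARD('p)\<close>, is the group ring of the
  lattice \<open>int ^ 'd\<close>: finitely supported functions with the convolution product. The monomial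
  with exponent vector \<open>n\<close> is \<open>Poly_Mapping.single n 1\<close>.\<close>

type_synonym ('d, 'p) laurent = "(int ^ 'd) \<Rightarrow>\<^sub>0 'p mod_ring"

definition laurent_ring :: "('d::finite, 'p::prime_card) laurent ring" where
  "laurent_ring = \<lparr>carrier = UNIV, mult = (*), one = 1, zero = 0, add = (+)\<rparr>"

definition quotient_ring :: "('d::finite, 'p::prime_card) laurent \<Rightarrow> ('d, 'p) laurent set ring" where
  "quotient_ring f = laurent_ring Quot (PIdl\<^bsub>laurent_ring\<^esub> f)"

definition monomial_class ::
    "('d::finite, 'p::prime_card) laurent \<Rightarrow> int ^ 'd \<Rightarrow> ('d, 'p) laurent set" where
  "monomial_class f n = PIdl\<^bsub>laurent_ring\<^esub> f +>\<^bsub>laurent_ring\<^esub> Poly_Mapping.single n 1"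

section \<open>The dual group, Haar measure and the algebraic action\<close>

definition circle_group :: "complex monoid" where
  "circle_group = \<lparr>carrier = sphere 0 1, mult = (*), one = 1\<rparr>"

text \<open>Characters are made extensional so that each is represented by exactly one HOL function.
  The topology is that of pointwise convergence, which is the compact-open topology because the
  module is discrete; it is the subspace topology of the product topology on functions.\<close>

definition dual_group :: "('m, 'c) ring_scheme \<Rightarrow> ('m \<Rightarrow> complex) set" where
  "dual_group M = hom (add_monoid M) circle_group \<inter> extensional (carrier M)"

definition char_mult ::
    "('m, 'c) ring_scheme \<Rightarrow> ('m \<Rightarrow> complex) \<Rightarrow> ('m \<Rightarrow> complex) \<Rightarrow> ('m \<Rightarrow> complex)" where
  "char_mult M \<phi> \<psi> = (\<lambda>m\<in>carrier M. \<phi> m * \<psi> m)"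

text \<open>Translation-invariant Borel probability measure on the dual group. Regularity need not be
  demanded: for a countable module the dual is compact and metrizable.\<close>

definition haar_probability :: "('m, 'c) ring_scheme \<Rightarrow> ('m \<Rightarrow> complex) measure \<Rightarrow> bool" where
  "haar_probability M \<mu> \<longleftrightarrow>
     prob_space \<mu> \<and>
     sets \<mu> = sets (restrict_space borel (dual_group M)) \<and>
     (\<forall>\<phi>\<in>dual_group M. \<forall>A\<in>sets \<mu>. emeasure \<mu> (char_mult M \<phi> ` A) = emeasure \<mu> A)"

definition alg_action ::
    "('d::finite, 'p::prime_card) laurent \<Rightarrow> int ^ 'd \<Rightarrow>
      (('d, 'p) laurent set \<Rightarrow> complex) \<Rightarrow> (('d, 'p) laurent set \<Rightarrow> complex)" where
  "alg_action f n \<phi> =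
     (\<lambda>m\<in>carrier (quotient_ring f). \<phi> (monomial_class f n \<otimes>\<^bsub>quotient_ring f\<^esub> m))"

section \<open>Mixing\<close>

definition real_point :: "int ^ 'd \<Rightarrow> real ^ 'd::finite" where
  "real_point n = (\<chi> i. real_of_int (n $ i))"

text \<open>A sequence of \<open>r\<close>-tuples is a function \<open>n\<close>, where \<open>n j s\<close> with \<open>s < r\<close> is the entry
  number \<open>s\<close> of the tuple number \<open>j\<close>.\<close>

definition moving_apart :: "nat \<Rightarrow> (nat \<Rightarrow> nat \<Rightarrow> int ^ 'd::finite) \<Rightarrow> bool" where
  "moving_apart r n \<longleftrightarrow>
     (\<forall>s<r. \<forall>t<r. s \<noteq> t \<longrightarrow>
        filterlim (\<lambda>j. real_point (n j s - n j t)) at_infinity sequentially)"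

definition mixing_sequence ::
    "'x measure \<Rightarrow> (int ^ 'd \<Rightarrow> 'x \<Rightarrow> 'x) \<Rightarrow> nat \<Rightarrow> (nat \<Rightarrow> nat \<Rightarrow> int ^ 'd::finite) \<Rightarrow> bool" where
  "mixing_sequence \<mu> T r n \<longleftrightarrow>
     (\<forall>A. (\<forall>s<r. A s \<in> sets \<mu>) \<longrightarrow>
        (\<lambda>j. measure \<mu> {x \<in> space \<mu>. \<forall>s<r. T (n j s) x \<in> A s})
          \<longlonglongrightarrow> (\<Prod>s<r. measure \<mu> (A s)))"

definition non_mixing_sequence ::
    "'x measure \<Rightarrow> (int ^ 'd \<Rightarrow> 'x \<Rightarrow> 'x) \<Rightarrow> nat \<Rightarrow> (nat \<Rightarrow> nat \<Rightarrow> int ^ 'd::finite) \<Rightarrow> bool" where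
  "non_mixing_sequence \<mu> T r n \<longleftrightarrow> moving_apart r n \<and> \<not> mixing_sequence \<mu> T r n"

definition r_mixing :: "'x measure \<Rightarrow> (int ^ 'd::finite \<Rightarrow> 'x \<Rightarrow> 'x) \<Rightarrow> nat \<Rightarrow> bool" where
  "r_mixing \<mu> T r \<longleftrightarrow> (\<forall>n. moving_apart r n \<longrightarrow> mixing_sequence \<mu> T r n)"

text \<open>The supremum of a nonempty set of natural numbers in \<open>enat\<close> is its maximum if there is
  one and \<open>\<infinity>\<close> otherwise; \<open>r = 1\<close> always qualifies here for a measure-preserving action.\<close>

definition mixing_order :: "'x measure \<Rightarrow> (int ^ 'd::finite \<Rightarrow> 'x \<Rightarrow> 'x) \<Rightarrow> enat" where
  "mixing_order \<mu> T = Sup {enat r |r. r_mixing \<mu> T r}"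

definition mixing_shape ::
    "'x measure \<Rightarrow> (int ^ 'd \<Rightarrow> 'x \<Rightarrow> 'x) \<Rightarrow> (int ^ 'd::finite) set \<Rightarrow> bool" where
  "mixing_shape \<mu> T F \<longleftrightarrow>
     (\<forall>A. (\<forall>m\<in>F. A m \<in> sets \<mu>) \<longrightarrow>
        (\<lambda>k. measure \<mu> {x \<in> space \<mu>. \<forall>m\<in>F. T (int k *s m) x \<in> A m})
          \<longlonglongrightarrow> (\<Prod>m\<in>F. measure \<mu> (A m)))"

definition shape_mixing_order :: "'x measure \<Rightarrow> (int ^ 'd::finite \<Rightarrow> 'x \<Rightarrow> 'x) \<Rightarrow> enat" where
  "shape_mixing_order \<mu> T =
     Sup {enat r |r. \<forall>F. finite F \<and> card F = r \<longrightarrow> mixing_shape \<mu> T F}"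

section \<open>Newton polyhedra and parallel redrawings\<close>

definition newton_polyhedron :: "('d::finite, 'p::prime_card) laurent \<Rightarrow> (real ^ 'd) set" where
  "newton_polyhedron f = convex hull (real_point ` Poly_Mapping.keys f)"

definition vertices :: "'a::euclidean_space set \<Rightarrow> 'a set" where
  "vertices P = {x. x extreme_point_of P}"

text \<open>The requirement that \<open>Q\<close> has an edge excludes single points (and the empty set), which
  would satisfy the condition on edges vacuously.\<close>

definition parallel_redrawing :: "'a::euclidean_space set \<Rightarrow> 'a set \<Rightarrow> bool" where
  "parallel_redrawing P Q \<longleftrightarrow>
     polytope Q \<and>
     (\<exists>e. e edge_of Q) \<and>
     (\<forall>e. e edge_of Q \<longrightarrow>
        (\<exists>e'. e' edge_of P \<and> affine_parallel (affine hull e) (affine hull e')))"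

definition contains_parallel_redrawing ::
    "nat \<Rightarrow> (nat \<Rightarrow> nat \<Rightarrow> int ^ 'd::finite) \<Rightarrow> (real ^ 'd) set \<Rightarrow> bool" where
  "contains_parallel_redrawing r n P \<longleftrightarrow>
     (\<exists>K::real. \<exists>J::nat set. infinite J \<and>
        (\<forall>j\<in>J. \<exists>m :: nat \<Rightarrow> real ^ 'd.
           (\<forall>s<r. dist (m s) (real_point (n j s)) \<le> K) \<and>
           (\<exists>Q. parallel_redrawing P Q \<and> vertices Q \<subseteq> m ` {..<r})))"

end

(*
  A sequence fails to mix only if, for fixed representatives m_s not all divisible by f, the sum of
  u^(n_s) m_s is divisible by f for infinitely many j: expand the indicators of cylinder sets of the
  dual group into characters and integrate. Let w be a weight whose maximum on S(f) is attained at
  least twice. Then the initial form of f is not a monomial, and comparing initial forms of multiples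
  of f shows that the maximum of w on the points n_s is attained at least twice up to an error
  independent of j; this needs an element of the ideal (f, m_s) that is free of one of the variables.
  Taking w in the normal cone of an edge of N(f) gives two of the points whose difference is, up to a
  bounded error, parallel to that edge. If w and w' are generic weights in the normal cones of two
  vertices of N(f), their segment crosses a weight with a tie, so the maxima of w and w' on the n_s
  are attained at different points; hence there are at least v points. In the other direction,
  f^(p^k), the sum of c_n u^(p^k n), shows that S(f) is not a mixing shape.
*)

theory Submission
  imports Defs
begin

section \<open>Weights and initial forms of Laurent polynomials\<close>

text \<open>Two obstacles shape the proof. First, the initial form of \<open>m s\<close> may itself
  be divisible by that of \<open>f\<close>, so comparing initial forms of \<open>m s + E\<close> and
  \<open>f\<close> proves nothing. Hence \<open>m s\<close> is replaced by an element of the ideal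
  generated by \<open>f\<close> and \<open>m s\<close> that is free of a variable occurring in the
  initial form of \<open>f\<close>. Its existence rests on Gauss's lemma, so primes are built up by
  adjoining one variable at a time.

  Second, uniformity. A tie weight yields a pair of points whose difference is bounded in that one
  direction, but the pair depends on the weight and on \<open>j\<close>. On a thinned index set
  every direction is, for each pair, either bounded or divergent. The question then concerns
  finitely many subspaces, which cannot cover an open set unless one of them is the whole space.

  A segment already counts as a parallel redrawing, so the bound v - 1 is not read off from (1): the
  vertices are counted separately, from the same tie property.\<close>

abbreviation (input) "coef \<equiv> Poly_Mapping.lookup"
abbreviation (input) "keys \<equiv> Poly_Mapping.keys"
abbreviation (input) "mterm \<equiv> Poly_Mapping.single"

lemma lookup_times_group:
  fixes x y :: "'k::ab_group_add \<Rightarrow>\<^sub>0 'a::comm_ring_1"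
  shows "coef (x * y) k = (\<Sum>a\<in>keys x. coef x a * coef y (k - a))"
proof -
  have "coef (x * y) k = (\<Sum>l. coef x l * (\<Sum>q. coef y q when k = l + q))"
    by (rule lookup_mult)
  also have "\<dots> = (\<Sum>l. coef x l * coef y (k - l))"
  proof (rule Sum_any.cong)
    fix l
    have "(\<Sum>q. coef y q when k = l + q) = (\<Sum>q. coef y q when q = k - l)"
      by (rule Sum_any.cong, rule when_cong) (auto simp: algebra_simps)
    then show "coef x l * (\<Sum>q. coef y q when k = l + q) = coef x l * coef y (k - l)"
      by simp
  qed
  also have "\<dots> = (\<Sum>a\<in>keys x. coef x a * coef y (k - a))"
    by (rule Sum_any.expand_superset) (auto simp: in_keys_iff)
  finally show ?thesis .
qed

lemma poly_mapping_sum_singles: "x = (\<Sum>k\<in>keys x. mterm k (coef x k))"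
  by (rule poly_mapping_eqI)
    (auto simp: lookup_sum lookup_single when_def in_keys_iff)

lemma single_dvd_one:
  fixes c :: "'a::field"
  assumes "c \<noteq> 0"
  shows "mterm (n :: 'k::ab_group_add) c dvd 1"
proof
  show "1 = mterm n c * mterm (- n) (inverse c)"
    using assms by (simp add: mult_single)
qed

lift_definition part :: "('k \<Rightarrow> bool) \<Rightarrow> ('k \<Rightarrow>\<^sub>0 'a::zero) \<Rightarrow> ('k \<Rightarrow>\<^sub>0 'a)"
  is "\<lambda>P x k. if P k then x k else 0"
  by (rule finite_subset) auto

lemma lookup_part: "coef (part P x) k = (if P k then coef x k else 0)"
  by transfer simp

lemma keys_part: "keys (part P x) = {k \<in> keys x. P k}"
  by (auto simp: in_keys_iff lookup_part split: if_splits)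

lemma part_add: "part P (x + y) = part P x + part P (y :: _ \<Rightarrow>\<^sub>0 'a::comm_monoid_add)"
  by (rule poly_mapping_eqI) (simp add: lookup_part lookup_add)

lemma part_id: "(\<And>k. k \<in> keys x \<Longrightarrow> P k) \<Longrightarrow> part P x = x"
  by (rule poly_mapping_eqI) (auto simp: lookup_part in_keys_iff)

lemma part_eq_0: "(\<And>k. k \<in> keys x \<Longrightarrow> \<not> P k) \<Longrightarrow> part P x = 0"
  by (rule poly_mapping_eqI) (auto simp: lookup_part in_keys_iff)

lemma part_split: "x = part P x + part (\<lambda>k. \<not> P k) (x :: _ \<Rightarrow>\<^sub>0 'a::comm_monoid_add)"
  by (rule poly_mapping_eqI) (simp add: lookup_part lookup_add)

definition wt :: "real ^ 'd \<Rightarrow> int ^ 'd::finite \<Rightarrow> real" where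
  "wt w k = w \<bullet> real_point k"

lemma real_point_add: "real_point (a + b) = real_point a + real_point b"
  by (simp add: real_point_def vec_eq_iff)

lemma real_point_diff: "real_point (a - b) = real_point a - real_point b"
  by (simp add: real_point_def vec_eq_iff)

lemma real_point_0 [simp]: "real_point 0 = 0"
  by (simp add: real_point_def vec_eq_iff)

lemma real_point_eq_iff [simp]: "real_point a = real_point b \<longleftrightarrow> a = b"
  by (simp add: real_point_def vec_eq_iff)

lemma wt_add [simp]: "wt w (a + b) = wt w a + wt w b"
  by (simp add: wt_def real_point_add inner_add_right)

lemma wt_diff [simp]: "wt w (a - b) = wt w a - wt w b"
  by (simp add: wt_def real_point_diff inner_diff_right)

lemma wt_minus_left [simp]: "wt (- w) a = - wt w a"
  by (simp add: wt_def)

lemma wt_0 [simp]: "wt w 0 = 0"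
  by (simp add: wt_def)

lemma wt_axis [simp]: "wt (axis i 1) k = of_int (k $ i)"
  by (simp add: wt_def real_point_def inner_axis' )

text \<open>The weights with a tie between two lattice points fill countably many hyperplanes, a
  null set. So every nonempty open set contains a weight that totally orders all monomials.\<close>

lemma exists_generic_weight:
  fixes U :: "(real ^ 'd::finite) set"
  assumes "open U" "U \<noteq> {}"
  obtains w where "w \<in> U" "inj (wt w)"
proof -
  let ?B = "\<Union>n\<in>{n :: int ^ 'd. n \<noteq> 0}. {w. real_point n \<bullet> w = 0}"
  have "negligible ?B"
  proof -
    have "(\<Union>n\<in>{n :: int ^ 'd. n \<noteq> 0}. {w. real_point n \<bullet> w = 0}) =
      (\<Union>k::nat. if from_nat k = (0 :: int ^ 'd) then {} else {w. real_point (from_nat k :: int ^ 'd) \<bullet> w = 0})"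
      by (auto split: if_splits) (metis from_nat_to_nat)
    moreover have "negligible \<dots>"
      by (rule negligible_Union_nat)
        (use real_point_eq_iff[of _ 0] in \<open>auto intro!: negligible_hyperplane\<close>)
    ultimately show ?thesis by simp
  qed
  then have "\<not> U \<subseteq> ?B"
    using open_not_negligible[OF assms] negligible_subset by blast
  then obtain w where w: "w \<in> U" "w \<notin> ?B" by blast
  have "inj (wt w)"
  proof (rule injI)
    fix a b assume "wt w a = wt w b"
    then have "real_point (a - b) \<bullet> w = 0"
      by (simp add: wt_def real_point_diff inner_diff_right inner_commute)
    then show "a = b" using w(2) by (cases "a - b = 0") (simp, blast)
  qed
  then show ?thesis using that w by blast
qed

lemma keys_timesE:
  assumes "k \<in> keys (x * y)"
  obtains a b where "a \<in> keys x" "b \<in> keys y" "k = a + b"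
  using keys_mult[of x y] assms by blast

lemma lookup_times_unique:
  fixes x y :: "'k::ab_group_add \<Rightarrow>\<^sub>0 'a::comm_ring_1"
  assumes "a \<in> keys x"
    and "\<And>a' b'. a' \<in> keys x \<Longrightarrow> b' \<in> keys y \<Longrightarrow> a' + b' = a + b \<Longrightarrow> a' = a"
  shows "coef (x * y) (a + b) = coef x a * coef y b"
proof -
  have "coef (x * y) (a + b) = (\<Sum>a'\<in>keys x. coef x a' * coef y (a + b - a'))"
    by (rule lookup_times_group)
  also have "\<dots> = (\<Sum>a'\<in>{a}. coef x a' * coef y (a + b - a'))"
  proof (rule sum.mono_neutral_right)
    show "\<forall>a'\<in>keys x - {a}. coef x a' * coef y (a + b - a') = 0"
    proof
      fix a' assume a': "a' \<in> keys x - {a}"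
      then have "a + b - a' \<notin> keys y"
        using assms(2)[of a' "a + b - a'"] by auto
      then show "coef x a' * coef y (a + b - a') = 0" by (simp add: in_keys_iff)
    qed
  qed (use assms in auto)
  finally show ?thesis by simp
qed

lemma keys_ne: "x \<noteq> 0 \<Longrightarrow> keys x \<noteq> {}"
  by (metis empty_iff poly_mapping_eqI in_keys_iff lookup_zero)

lemma Max_image_attained:
  assumes "finite A" "A \<noteq> {}"
  obtains a where "a \<in> A" "f a = Max (f ` A)"
proof -
  have "Max (f ` A) \<in> f ` A" using assms by (intro Max_in) auto
  then obtain a where "a \<in> A" "f a = Max (f ` A)" unfolding image_iff by metis
  then show ?thesis by (rule that)
qed

text \<open>For a weight injective on the lattice each factor has a single leading term, and nothing
  cancels the product of the two.\<close>

lemma laurent_no_zero_divisors: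
  fixes x y :: "int ^ 'd::finite \<Rightarrow>\<^sub>0 'a::idom"
  assumes "x \<noteq> 0" "y \<noteq> 0"
  shows "x * y \<noteq> 0"
proof -
  obtain w :: "real ^ 'd" where w: "inj (wt w)"
    using exists_generic_weight[of UNIV] by auto
  obtain a where a: "a \<in> keys x" "wt w a = Max (wt w ` keys x)"
    using Max_image_attained[OF finite_keys keys_ne[OF assms(1)]] by blast
  obtain b where b: "b \<in> keys y" "wt w b = Max (wt w ` keys y)"
    using Max_image_attained[OF finite_keys keys_ne[OF assms(2)]] by blast
  have "coef (x * y) (a + b) = coef x a * coef y b"
  proof (rule lookup_times_unique[OF a(1)])
    fix a' b' assume *: "a' \<in> keys x" "b' \<in> keys y" "a' + b' = a + b"
    have "wt w a' \<le> wt w a" "wt w b' \<le> wt w b"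
      using * by (auto simp: a b)
    moreover have "wt w a' + wt w b' = wt w a + wt w b"
      using arg_cong[OF *(3), of "wt w"] by simp
    ultimately have "wt w a' = wt w a" by linarith
    then show "a' = a" using w by (simp add: inj_eq)
  qed
  also have "\<dots> \<noteq> 0" using a b by (simp add: in_keys_iff)
  finally show ?thesis by (metis lookup_zero)
qed

lemma laurent_mult_cancel:
  fixes x y z :: "int ^ 'd::finite \<Rightarrow>\<^sub>0 'a::idom"
  assumes "x \<noteq> 0" "x * y = x * z"
  shows "y = z"
proof -
  have "x * (y - z) = 0" using assms(2) by (simp add: algebra_simps)
  then show ?thesis using laurent_no_zero_divisors[OF assms(1), of "y - z"] by auto
qed

text \<open>The support function of the Newton polytope of \<open>x\<close>. It is meaningful for
  nonzero \<open>x\<close>, since the maximum of the empty set is unspecified.\<close>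

definition top_wt :: "real ^ 'd \<Rightarrow> (int ^ 'd::finite \<Rightarrow>\<^sub>0 'a::zero) \<Rightarrow> real" where
  "top_wt w x = Max (wt w ` keys x)"

definition init_form :: "real ^ 'd \<Rightarrow> (int ^ 'd::finite \<Rightarrow>\<^sub>0 'a::zero) \<Rightarrow> (int ^ 'd \<Rightarrow>\<^sub>0 'a)" where
  "init_form w x = part (\<lambda>k. wt w k = top_wt w x) x"

lemma wt_le_top: "k \<in> keys x \<Longrightarrow> wt w k \<le> top_wt w x"
  by (simp add: top_wt_def)

lemma top_wt_attained:
  assumes "x \<noteq> 0"
  obtains k where "k \<in> keys x" "wt w k = top_wt w x"
  using Max_image_attained[OF finite_keys keys_ne[OF assms]] unfolding top_wt_def by blast

lemma top_wt_eqI: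
  assumes "\<And>k. k \<in> keys x \<Longrightarrow> wt w k \<le> c" "k \<in> keys x" "wt w k = c"
  shows "top_wt w x = c"
  unfolding top_wt_def using assms by (intro Max_eqI) auto

lemma keys_init_form: "keys (init_form w x) = {k \<in> keys x. wt w k = top_wt w x}"
  by (simp add: init_form_def keys_part)

lemma init_form_nonzero: "x \<noteq> 0 \<Longrightarrow> init_form w x \<noteq> 0"
  by (metis (mono_tags, lifting) empty_iff keys_init_form keys_zero mem_Collect_eq top_wt_attained)

text \<open>Any other pair of terms has smaller total weight, and the product of the initial forms
  is nonzero in a domain, so exactly this product survives at the top. Geometrically, Newton
  polytopes add under multiplication.\<close>

lemma
  fixes x y :: "int ^ 'd::finite \<Rightarrow>\<^sub>0 'a::idom"
  assumes "x \<noteq> 0" "y \<noteq> 0"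
  shows top_wt_mult: "top_wt w (x * y) = top_wt w x + top_wt w y" (is ?A)
    and init_form_mult: "init_form w (x * y) = init_form w x * init_form w y" (is ?B)
proof -
  let ?c = "top_wt w x + top_wt w y"
  let ?P = "\<lambda>k. wt w k = ?c"
  let ?x = "part (\<lambda>k. wt w k \<noteq> top_wt w x) x" and ?y = "part (\<lambda>k. wt w k \<noteq> top_wt w y) y"
  have x: "x = init_form w x + ?x" and y: "y = init_form w y + ?y"
    unfolding init_form_def by (rule part_split)+
  have "x * y = init_form w x * init_form w y + (init_form w x * ?y + ?x * y)"
  proof -
    have "x * y = init_form w x * y + ?x * y"
      by (subst x, subst distrib_right) (rule refl)
    moreover have "init_form w x * y = init_form w x * init_form w y + init_form w x * ?y"
      by (subst y, subst distrib_left) (rule refl)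
    ultimately show ?thesis by (simp add: add.assoc)
  qed
  then have "part ?P (x * y) = part ?P (init_form w x * init_form w y) +
     (part ?P (init_form w x * ?y) + part ?P (?x * y))"
    by (simp add: part_add)
  also have "part ?P (init_form w x * init_form w y) = init_form w x * init_form w y"
    by (rule part_id) (auto elim!: keys_timesE simp: keys_init_form)
  also have "part ?P (init_form w x * ?y) = 0"
  proof (rule part_eq_0)
    fix k assume "k \<in> keys (init_form w x * ?y)"
    then obtain a b where "a \<in> keys (init_form w x)" "b \<in> keys ?y" "k = a + b" by (rule keys_timesE)
    then show "\<not> ?P k" by (auto simp: keys_init_form keys_part)
  qed
  also have "part ?P (?x * y) = 0"
  proof (rule part_eq_0)
    fix k assume "k \<in> keys (?x * y)"
    then obtain a b where ab: "a \<in> keys ?x" "b \<in> keys y" "k = a + b" by (rule keys_timesE)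
    then have "wt w a < top_wt w x" "wt w b \<le> top_wt w y"
      using wt_le_top[of a x w] by (auto simp: keys_part wt_le_top order_less_le)
    then show "\<not> ?P k" using ab by simp
  qed
  finally have *: "part ?P (x * y) = init_form w x * init_form w y" by simp
  have "init_form w x * init_form w y \<noteq> 0"
    using assms by (intro laurent_no_zero_divisors init_form_nonzero)
  then obtain k where k: "k \<in> keys (x * y)" "?P k"
    using * keys_ne by (metis (mono_tags, lifting) part_eq_0)
  show ?A
  proof (rule top_wt_eqI[OF _ k])
    fix k assume "k \<in> keys (x * y)"
    then obtain a b where ab: "a \<in> keys x" "b \<in> keys y" "k = a + b" by (rule keys_timesE)
    then show "wt w k \<le> ?c" using wt_le_top[of a x w] wt_le_top[of b y w] by simp
  qed
  with * show ?B by (simp add: init_form_def)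
qed

text \<open>The highest minus the lowest exponent of \<open>u_i\<close>: a degree that does not
  change under multiplication by monomials. It takes values in \<open>nat\<close> so that inductions
  can run on it.\<close>

definition width :: "'d \<Rightarrow> (int ^ 'd::finite \<Rightarrow>\<^sub>0 'a::zero) \<Rightarrow> nat" where
  "width i x = nat \<lfloor>top_wt (axis i 1) x + top_wt (- axis i 1) x\<rfloor>"

lemma width_real:
  assumes "x \<noteq> 0"
  shows "real (width i x) = top_wt (axis i 1) x + top_wt (- axis i 1) x"
proof -
  obtain a where a: "a \<in> keys x" "wt (axis i 1) a = top_wt (axis i 1) x" by (rule top_wt_attained[OF assms])
  obtain b where b: "b \<in> keys x" "wt (- axis i 1) b = top_wt (- axis i 1) x" by (rule top_wt_attained[OF assms])
  have "wt (axis i 1) b \<le> top_wt (axis i 1) x" using b by (intro wt_le_top)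
  then have "a $ i - b $ i \<ge> 0" using a(2) by simp
  moreover have "top_wt (axis i 1) x + top_wt (- axis i 1) x = of_int (a $ i - b $ i)"
    using a(2) b(2) by simp
  ultimately show ?thesis unfolding width_def by simp
qed

lemma width_mult:
  fixes x y :: "int ^ 'd::finite \<Rightarrow>\<^sub>0 'a::idom"
  assumes "x \<noteq> 0" "y \<noteq> 0"
  shows "width i (x * y) = width i x + width i y"
proof -
  have "real (width i (x * y)) = real (width i x + width i y)"
    by (simp add: width_real assms laurent_no_zero_divisors top_wt_mult)
  then show ?thesis by (simp only: of_nat_eq_iff)
qed

lemma diff_le_width:
  assumes "a \<in> keys x" "b \<in> keys x"
  shows "a $ i - b $ i \<le> int (width i x)"
proof -
  have "wt (axis i 1) a \<le> top_wt (axis i 1) x" "wt (- axis i 1) b \<le> top_wt (- axis i 1) x"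
    using assms by (intro wt_le_top; simp)+
  moreover have "x \<noteq> 0" using assms by auto
  ultimately have "real_of_int (a $ i - b $ i) \<le> real_of_int (int (width i x))"
    by (simp add: width_real)
  then show ?thesis by (simp only: of_int_le_iff)
qed

lemma width_attained:
  assumes "x \<noteq> 0"
  obtains a b where "a \<in> keys x" "b \<in> keys x" "int (width i x) = a $ i - b $ i"
proof -
  obtain a where a: "a \<in> keys x" "wt (axis i 1) a = top_wt (axis i 1) x" by (rule top_wt_attained[OF assms])
  obtain b where b: "b \<in> keys x" "wt (- axis i 1) b = top_wt (- axis i 1) x" by (rule top_wt_attained[OF assms])
  have "real_of_int (int (width i x)) = real_of_int (a $ i - b $ i)"
    using a b width_real[OF assms, of i] by simp
  then show ?thesis using that a b by (simp only: of_int_eq_iff)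
qed

lemma width_eq_0_iff:
  assumes "x \<noteq> 0"
  shows "width i x = 0 \<longleftrightarrow> (\<forall>a\<in>keys x. \<forall>b\<in>keys x. a $ i = b $ i)"
proof
  assume 0: "width i x = 0"
  show "\<forall>a\<in>keys x. \<forall>b\<in>keys x. a $ i = b $ i"
  proof (intro ballI)
    fix a b assume "a \<in> keys x" "b \<in> keys x"
    then show "a $ i = b $ i" using diff_le_width[of a x b i] diff_le_width[of b x a i] 0 by simp
  qed
next
  assume "\<forall>a\<in>keys x. \<forall>b\<in>keys x. a $ i = b $ i"
  then show "width i x = 0" using width_attained[OF assms, of i] by (metis diff_self of_nat_eq_0_iff)
qed

text \<open>Widths are additive, so a unit has width zero in every variable. Conversely, width zero
  throughout leaves a single term, and its coefficient is invertible in the field.\<close>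

lemma dvd_one_iff_width:
  fixes x :: "int ^ 'd::finite \<Rightarrow>\<^sub>0 'a::field"
  assumes "x \<noteq> 0"
  shows "x dvd 1 \<longleftrightarrow> (\<forall>i. width i x = 0)"
proof
  assume "x dvd 1"
  then obtain y where y: "1 = x * y" by (rule dvdE)
  have "y \<noteq> 0" using y by auto
  then have "width i x + width i y = width i (1 :: int ^ 'd \<Rightarrow>\<^sub>0 'a)" for i
    using assms by (simp add: y width_mult)
  moreover have "width i (1 :: int ^ 'd \<Rightarrow>\<^sub>0 'a) = 0" for i
    by (simp add: width_eq_0_iff)
  ultimately show "\<forall>i. width i x = 0" by simp
next
  assume 0: "\<forall>i. width i x = 0"
  obtain a where a: "a \<in> keys x" using keys_ne[OF assms] by blast
  have "b = a" if "b \<in> keys x" for b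
    using 0 a that width_eq_0_iff[OF assms] unfolding vec_eq_iff by metis
  with a have "keys x = {a}" by blast
  then have "x = mterm a (coef x a)" using poly_mapping_sum_singles[of x] by simp
  then show "x dvd 1" using a single_dvd_one[of "coef x a" a] by (simp add: in_keys_iff)
qed

section \<open>Unique factorization and elimination of a variable\<close>

text \<open>The Laurent polynomials in the variables indexed by \<open>S\<close>, realised inside
  one type so that induction on the number of variables need not change the type.\<close>

definition lring :: "'d set \<Rightarrow> (int ^ 'd::finite \<Rightarrow>\<^sub>0 'a::zero) set" where
  "lring S = {x. \<forall>k\<in>keys x. \<forall>i. i \<notin> S \<longrightarrow> k $ i = 0}"

lemma lring_mult: "x \<in> lring S \<Longrightarrow> y \<in> lring S \<Longrightarrow> x * y \<in> lring S"
  unfolding lring_def by (force elim!: keys_timesE)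

lemma lring_add: "x \<in> lring S \<Longrightarrow> y \<in> lring S \<Longrightarrow> x + y \<in> lring S"
  unfolding lring_def using keys_add[of x y] by blast

lemma lring_diff:
  "x \<in> lring S \<Longrightarrow> y \<in> lring S \<Longrightarrow> x - y \<in> lring S" for x :: "_ \<Rightarrow>\<^sub>0 'a::ab_group_add"
  unfolding lring_def using keys_diff[of x y] by blast

lemma lring_0 [simp]: "0 \<in> lring S"
  by (simp add: lring_def)

lemma lring_1 [simp]: "1 \<in> lring S"
  by (simp add: lring_def)

lemma lring_part: "x \<in> lring S \<Longrightarrow> part P x \<in> lring S"
  by (simp add: lring_def keys_part)

lemma lring_mono: "x \<in> lring S \<Longrightarrow> S \<subseteq> T \<Longrightarrow> x \<in> lring T"
  by (auto simp: lring_def)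

lemma lring_UNIV [simp]: "x \<in> lring UNIV"
  by (simp add: lring_def)

lemma part_times:
  fixes x y :: "'k::ab_group_add \<Rightarrow>\<^sub>0 'a::comm_ring_1"
  assumes "\<And>a b. a \<in> keys x \<Longrightarrow> P (a + b) \<longleftrightarrow> Q b"
  shows "part P (x * y) = x * part Q y"
proof -
  have "x * y = x * part Q y + x * part (\<lambda>k. \<not> Q k) y"
    by (subst part_split[of y Q], subst distrib_left) (rule refl)
  moreover have "part P (x * part Q y) = x * part Q y"
    by (rule part_id) (auto elim!: keys_timesE simp: keys_part assms)
  moreover have "part P (x * part (\<lambda>k. \<not> Q k) y) = 0"
    by (rule part_eq_0) (auto elim!: keys_timesE simp: keys_part assms)
  ultimately show ?thesis by (simp add: part_add)
qed

text \<open>Multiplication by \<open>x\<close> preserves the exponents outside \<open>S\<close>, so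
  the part of \<open>y\<close> in \<open>lring S\<close> already produces the whole product. Thus
  divisibility in the full ring agrees with divisibility in the subring.\<close>

lemma lring_quotient:
  fixes x y :: "int ^ 'd::finite \<Rightarrow>\<^sub>0 'a::idom"
  assumes "x \<in> lring S" "x * y \<in> lring S" "x \<noteq> 0"
  shows "y \<in> lring S"
proof -
  let ?P = "\<lambda>k. \<forall>i. i \<notin> S \<longrightarrow> k $ i = 0"
  have "x * y = part ?P (x * y)"
    using assms(2) by (intro part_id[symmetric]) (auto simp: lring_def)
  also have "\<dots> = x * part ?P y"
    using assms(1) by (intro part_times) (auto simp: lring_def)
  finally have "y = part ?P y" by (rule laurent_mult_cancel[OF assms(3)])
  moreover have "part ?P y \<in> lring S" by (auto simp: lring_def keys_part)
  ultimately show ?thesis by simp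
qed

lemma single_inverse: "mterm (- n) 1 * (mterm n 1 * x) = (x :: 'k::ab_group_add \<Rightarrow>\<^sub>0 'a::comm_ring_1)"
  by (simp add: mult.assoc[symmetric] mult_single)

lemma dvd_single_times_iff: "p dvd mterm n 1 * x \<longleftrightarrow> p dvd x"
  for x :: "'k::ab_group_add \<Rightarrow>\<^sub>0 'a::comm_ring_1"
proof
  assume "p dvd mterm n 1 * x"
  then have "p dvd mterm (- n) 1 * (mterm n 1 * x)" by (rule dvd_mult)
  then show "p dvd x" by (simp only: single_inverse)
qed (rule dvd_mult)

lemma single_nonzero: "c \<noteq> 0 \<Longrightarrow> mterm n c \<noteq> 0"
  by (metis insert_not_empty keys_single keys_zero)

lemma width_single [simp]: "c \<noteq> 0 \<Longrightarrow> width i (mterm n c) = 0"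
  by (subst width_eq_0_iff) (auto simp: single_nonzero)

lemma width_single_times:
  fixes x :: "int ^ 'd::finite \<Rightarrow>\<^sub>0 'a::idom"
  assumes "x \<noteq> 0"
  shows "width i (mterm n 1 * x) = width i x"
  using assms by (simp add: width_mult single_nonzero)

text \<open>All exponents of \<open>u_i\<close> in \<open>x\<close> agree, so a power of
  \<open>u_i\<close> removes this variable.\<close>

lemma shift_into_lring:
  fixes x :: "int ^ 'd::finite \<Rightarrow>\<^sub>0 'a::idom"
  assumes "x \<in> lring (insert i S)" "x \<noteq> 0" "width i x = 0" "i \<notin> S"
  obtains n where "mterm n 1 * x \<in> lring S" "mterm n (1::'a) \<in> lring (insert i S)"
    "mterm (- n) (1::'a) \<in> lring (insert i S)"
proof -
  obtain a where a: "a \<in> keys x" using keys_ne[OF assms(2)] by blast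
  define n :: "int ^ 'd" where "n = axis i (- (a $ i))"
  have n: "n $ j = (if j = i then - (a $ i) else 0)" for j
    by (simp add: n_def axis_def)
  have "mterm n 1 * x \<in> lring S"
    unfolding lring_def
  proof safe
    fix k j assume k: "k \<in> keys (mterm n 1 * x)" and j: "j \<notin> S"
    from k obtain b where b: "b \<in> keys x" "k = n + b"
      by (auto elim!: keys_timesE split: if_splits)
    then have "b $ i = a $ i" using assms(3)[unfolded width_eq_0_iff[OF assms(2)]] a by blast
    then show "k $ j = 0" using b j assms(1) by (auto simp: lring_def n)
  qed
  moreover have "mterm n (1::'a) \<in> lring (insert i S)" "mterm (- n) (1::'a) \<in> lring (insert i S)"
    by (auto simp: lring_def n)
  ultimately show ?thesis by (rule that)
qed

lemma width_init_form:
  assumes "x \<noteq> 0"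
  shows "width i (init_form (axis i 1) x) = 0"
proof (subst width_eq_0_iff[OF init_form_nonzero[OF assms]], intro ballI)
  fix a b assume "a \<in> keys (init_form (axis i 1) x)" "b \<in> keys (init_form (axis i 1) x)"
  then have "wt (axis i 1) a = wt (axis i 1) b" unfolding keys_init_form by simp
  then show "a $ i = b $ i" by simp
qed

lemma width_lring: "x \<in> lring S \<Longrightarrow> x \<noteq> 0 \<Longrightarrow> i \<notin> S \<Longrightarrow> width i x = 0"
  by (auto simp: width_eq_0_iff lring_def)

text \<open>Units and divisibility are those of the full ring; by \<open>lring_quotient\<close> this
  is the same as primality in the subring.\<close>

definition prime_in :: "'d set \<Rightarrow> (int ^ 'd::finite \<Rightarrow>\<^sub>0 'a::field) \<Rightarrow> bool" where
  "prime_in S p \<longleftrightarrow> p \<in> lring S \<and> p \<noteq> 0 \<and> \<not> p dvd 1 \<and>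
     (\<forall>x\<in>lring S. \<forall>y\<in>lring S. p dvd x * y \<longrightarrow> p dvd x \<or> p dvd y)"

definition irreducible_in :: "'d set \<Rightarrow> (int ^ 'd::finite \<Rightarrow>\<^sub>0 'a::field) \<Rightarrow> bool" where
  "irreducible_in S f \<longleftrightarrow> f \<in> lring S \<and> f \<noteq> 0 \<and> \<not> f dvd 1 \<and>
     (\<forall>a\<in>lring S. \<forall>b\<in>lring S. f = a * b \<longrightarrow> a dvd 1 \<or> b dvd 1)"

text \<open>The form of unique factorization that passes from \<open>S\<close> to
  \<open>insert i S\<close>. The coefficient field occurs only in a bound variable, hence the
  \<open>itself\<close> argument.\<close>

definition has_prime_divisors :: "'d::finite set \<Rightarrow> 'a::field itself \<Rightarrow> bool" where
  "has_prime_divisors S (_ :: 'a itself) \<longleftrightarrow>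
     (\<forall>x :: int ^ 'd \<Rightarrow>\<^sub>0 'a. x \<in> lring S \<longrightarrow> x \<noteq> 0 \<longrightarrow> \<not> x dvd 1 \<longrightarrow> (\<exists>p. prime_in S p \<and> p dvd x))"

text \<open>Additive on products and positive exactly on nonzero nonunits, so splitting off a
  nonunit lowers it.\<close>

definition total_width :: "(int ^ 'd::finite \<Rightarrow>\<^sub>0 'a::zero) \<Rightarrow> nat" where
  "total_width x = (\<Sum>i\<in>UNIV. width i x)"

lemma total_width_mult:
  "x \<noteq> 0 \<Longrightarrow> y \<noteq> 0 \<Longrightarrow> total_width (x * y) = total_width x + total_width (y :: int ^ 'd::finite \<Rightarrow>\<^sub>0 'a::idom)"
  by (simp add: total_width_def width_mult sum.distrib)

lemma total_width_pos_iff: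
  "x \<noteq> 0 \<Longrightarrow> total_width x > 0 \<longleftrightarrow> \<not> x dvd (1 :: int ^ 'd::finite \<Rightarrow>\<^sub>0 'a::field)"
  unfolding dvd_one_iff_width total_width_def
  by (metis finite sum_eq_0_iff UNIV_I neq0_conv)

text \<open>Induction on the number of terms: if \<open>p\<close> divides \<open>x * y\<close>, it divides the product of the
  leading coefficients with respect to the new variable, hence one of them, which can then be split off.\<close>

lemma prime_in_insert:
  fixes p :: "int ^ 'd::finite \<Rightarrow>\<^sub>0 'a::field"
  assumes p: "prime_in S p" and i: "i \<notin> S"
  shows "prime_in (insert i S) p"
proof -
  let ?S = "insert i S" and ?w = "axis i (1::real) :: real ^ 'd"
  have pS: "p \<in> lring S" using p by (simp add: prime_in_def)
  have main: "p dvd x \<or> p dvd y"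
    if "x \<in> lring ?S" "y \<in> lring ?S" "p dvd x * y" for x y
    using that
  proof (induction "card (keys x) + card (keys y)" arbitrary: x y rule: less_induct)
    case less
    show ?case
    proof (cases "x = 0 \<or> y = 0")
      case False
      then have nz: "x \<noteq> 0" "y \<noteq> 0" by auto
      let ?x = "init_form ?w x" and ?y = "init_form ?w y"
      have lx: "?x \<in> lring ?S" and ly: "?y \<in> lring ?S"
        using less.prems by (auto simp: init_form_def intro: lring_part)
      have cx: "card (keys (x - init_form ?w x)) < card (keys x)" if nx: "x \<noteq> 0" for x :: "int ^ 'd \<Rightarrow>\<^sub>0 'a"
      proof (rule psubset_card_mono)
        obtain k where k: "k \<in> keys x" "wt ?w k = top_wt ?w x" by (rule top_wt_attained[OF nx])
        then have "coef (x - init_form ?w x) k = 0" by (simp add: lookup_minus init_form_def lookup_part)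
        then have "k \<notin> keys (x - init_form ?w x)" by (simp add: in_keys_iff)
        moreover have "keys (x - init_form ?w x) \<subseteq> keys x"
          using keys_diff[of x "init_form ?w x"] by (auto simp: keys_init_form)
        ultimately show "keys (x - init_form ?w x) \<subset> keys x" using k by blast
      qed simp
      obtain c where c: "x * y = p * c" using less.prems(3) by (rule dvdE)
      have cnz: "c \<noteq> 0" using c laurent_no_zero_divisors[OF nz] by auto
      have pnz: "p \<noteq> 0" using p by (simp add: prime_in_def)
      have ip: "init_form ?w p = p"
      proof -
        have *: "wt ?w k = 0" if "k \<in> keys p" for k using pS i that by (auto simp: lring_def)
        obtain k where "k \<in> keys p" "wt ?w k = top_wt ?w p" by (rule top_wt_attained[OF pnz])
        then have "top_wt ?w p = 0" using *[of k] by linarith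
        then show ?thesis using * unfolding init_form_def by (intro part_id) simp
      qed
      have "p dvd ?x * ?y"
        using init_form_mult[OF nz, of ?w] init_form_mult[OF pnz cnz, of ?w] c ip by (metis dvd_triv_left)
      moreover obtain m where m: "mterm m 1 * ?x \<in> lring S"
        by (rule shift_into_lring[OF lx init_form_nonzero[OF nz(1)] width_init_form[OF nz(1)] i])
      moreover obtain n where n: "mterm n 1 * ?y \<in> lring S"
        by (rule shift_into_lring[OF ly init_form_nonzero[OF nz(2)] width_init_form[OF nz(2)] i])
      moreover have "(mterm m 1 * ?x) * (mterm n 1 * ?y) = mterm m 1 * (mterm n 1 * (?x * ?y))"
        by (simp add: ac_simps)
      ultimately have "p dvd mterm m 1 * ?x \<or> p dvd mterm n 1 * ?y"
        using p unfolding prime_in_def by (metis dvd_single_times_iff)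
      then consider "p dvd ?x" | "p dvd ?y" by (auto simp: dvd_single_times_iff)
      then show ?thesis
      proof cases
        case 1
        have "p dvd (x - ?x) * y"
          unfolding left_diff_distrib by (intro dvd_diff less.prems) (use 1 in simp)
        then have "p dvd x - ?x \<or> p dvd y"
          using less.hyps[of "x - ?x" y] cx[OF nz(1)] less.prems lx lring_diff by auto
        then show ?thesis using 1 dvd_add[of p "x - ?x" ?x] by auto
      next
        case 2
        have "p dvd x * (y - ?y)"
          unfolding right_diff_distrib by (intro dvd_diff less.prems) (use 2 in simp)
        then have "p dvd x \<or> p dvd y - ?y"
          using less.hyps[of x "y - ?y"] cx[OF nz(2)] less.prems ly lring_diff by auto
        then show ?thesis using 2 dvd_add[of p "y - ?y" ?y] by auto
      qed
    qed auto
  qed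
  have "p \<in> lring ?S" using pS by (rule lring_mono) auto
  with main p show ?thesis by (simp add: prime_in_def)
qed

text \<open>A form of Gauss's lemma. A prime factor of \<open>c\<close> remains prime after
  \<open>u_i\<close> is adjoined, hence divides \<open>q\<close> or \<open>g\<close> and can be
  cancelled; a unit \<open>c\<close> is absorbed by \<open>q\<close>.\<close>

lemma cancel_common_factor:
  fixes c q g f :: "int ^ 'd::finite \<Rightarrow>\<^sub>0 'a::field"
  assumes "has_prime_divisors S TYPE('a)" "i \<notin> S" "c \<in> lring S" "c \<noteq> 0"
    "q \<in> lring (insert i S)" "g \<in> lring (insert i S)" "c * f = q * g"
  shows "\<exists>c1\<in>lring S. \<exists>c2\<in>lring S. \<exists>q1\<in>lring (insert i S). \<exists>g1\<in>lring (insert i S).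
    q = c1 * q1 \<and> g = c2 * g1 \<and> f = q1 * g1"
  using assms(3-7)
proof (induction "total_width c" arbitrary: c q g rule: less_induct)
  case less
  let ?S = "insert i S"
  show ?case
  proof (cases "c dvd 1")
    case True
    then obtain v where v: "1 = c * v" by (rule dvdE)
    have "v \<in> lring S" using lring_quotient[of c S v] less.prems v by auto
    then have "v \<in> lring ?S" by (rule lring_mono) auto
    then have "v * q \<in> lring ?S" using less.prems by (intro lring_mult)
    moreover have "q = c * (v * q)" using v by (metis mult.assoc mult_1)
    moreover have "f = (v * q) * g" using v less.prems(5) by (metis mult.assoc mult.commute mult_1)
    ultimately show ?thesis using less.prems by (intro bexI[of _ c] bexI[of _ 1] bexI[of _ "v * q"] bexI[of _ g]) auto
  next
    case False
    then obtain p where p: "prime_in S p" "p dvd c"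
      using assms(1) less.prems unfolding has_prime_divisors_def by blast
    obtain c' where c': "c = p * c'" using p(2) by (rule dvdE)
    have pS: "p \<in> lring S" "p \<noteq> 0" "\<not> p dvd 1" using p(1) by (auto simp: prime_in_def)
    have pS': "p \<in> lring ?S" using pS(1) by (rule lring_mono) auto
    have c'S: "c' \<in> lring S" "c' \<noteq> 0"
      using lring_quotient[of p S c'] less.prems c' pS by auto
    have tw: "total_width c' < total_width c"
      using total_width_mult[of p c'] total_width_pos_iff[of p] pS c'S c' by simp
    have "p dvd q * g" using less.prems(5) c' by (metis dvd_triv_left mult.assoc)
    then consider "p dvd q" | "p dvd g"
      using prime_in_insert[OF p(1) assms(2)] less.prems unfolding prime_in_def by blast
    then show ?thesis
    proof cases
      case 1
      then obtain q' where q': "q = p * q'" by (rule dvdE)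
      have "q' \<in> lring ?S" using lring_quotient[of p ?S q'] less.prems pS pS' q' by auto
      moreover have "p * (c' * f) = p * (q' * g)"
        using less.prems(5) by (simp add: c' q' mult.assoc)
      then have "c' * f = q' * g" by (rule laurent_mult_cancel[OF pS(2)])
      ultimately obtain c1 c2 q1 g1 where "c1 \<in> lring S" "c2 \<in> lring S" "q1 \<in> lring ?S" "g1 \<in> lring ?S"
        "q' = c1 * q1" "g = c2 * g1" "f = q1 * g1"
        using less.hyps[OF tw c'S(1) c'S(2), of q' g] less.prems by auto
      then show ?thesis using pS(1) q'
        by (intro bexI[of _ "p * c1"] bexI[of _ c2] bexI[of _ q1] bexI[of _ g1])
          (auto intro: lring_mult simp: mult.assoc)
    next
      case 2
      then obtain g' where g': "g = p * g'" by (rule dvdE)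
      have "g' \<in> lring ?S" using lring_quotient[of p ?S g'] less.prems pS pS' g' by auto
      moreover have "p * (c' * f) = p * (q * g')"
        using less.prems(5) by (simp add: c' g' ac_simps)
      then have "c' * f = q * g'" by (rule laurent_mult_cancel[OF pS(2)])
      ultimately obtain c1 c2 q1 g1 where "c1 \<in> lring S" "c2 \<in> lring S" "q1 \<in> lring ?S" "g1 \<in> lring ?S"
        "q = c1 * q1" "g' = c2 * g1" "f = q1 * g1"
        using less.hyps[OF tw c'S(1) c'S(2), of q g'] less.prems by auto
      then show ?thesis using pS(1) g'
        by (intro bexI[of _ c1] bexI[of _ "p * c2"] bexI[of _ q1] bexI[of _ g1])
          (auto intro: lring_mult simp: mult.assoc)
    qed
  qed
qed

text \<open>Division with remainder in \<open>u_i\<close>, with \<open>width\<close> as the degree.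
  Leading coefficients need not be invertible, so \<open>x\<close> is first multiplied by some
  \<open>c\<close> free of \<open>u_i\<close>.\<close>

lemma pseudo_division:
  fixes G x :: "int ^ 'd::finite \<Rightarrow>\<^sub>0 'a::field"
  assumes G: "G \<in> lring (insert i S)" "G \<noteq> 0" and i: "i \<notin> S" and "x \<in> lring (insert i S)"
  shows "\<exists>c\<in>lring S. \<exists>q\<in>lring (insert i S). \<exists>r\<in>lring (insert i S).
    c \<noteq> 0 \<and> c * x = q * G + r \<and> (r = 0 \<or> width i r < width i G)"
  using assms(4)
proof (induction "width i x" arbitrary: x rule: less_induct)
  case less
  let ?S = "insert i S" and ?w = "axis i (1::real) :: real ^ 'd"
  show ?case
  proof (cases "x = 0 \<or> width i x < width i G")
    case True
    then show ?thesis using less.prems by (intro bexI[of _ 1] bexI[of _ 0] bexI[of _ x]) auto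
  next
    case False
    then have x: "x \<noteq> 0" "width i G \<le> width i x" by auto
    let ?G = "init_form ?w G" and ?x = "init_form ?w x"
    have lG: "?G \<in> lring ?S" and lx: "?x \<in> lring ?S"
      using less.prems G by (auto simp: init_form_def intro: lring_part)
    have nz: "?G \<noteq> 0" "?x \<noteq> 0" by (intro init_form_nonzero G x)+
    obtain n where n: "mterm n 1 * ?G \<in> lring S" "mterm n (1::'a) \<in> lring ?S"
      by (rule shift_into_lring[OF lG nz(1) width_init_form[OF G(2)] i])
    \<comment> \<open>Cross-multiplication makes the top layers cancel. The shift by
      \<open>n\<close> makes the multiplier of \<open>x\<close> free of \<open>u_i\<close>, as
      \<open>c\<close> has to be.\<close>
    define z where "z = ?G * x - ?x * G"
    define y where "y = mterm n 1 * z"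
    have yS: "y \<in> lring ?S"
      unfolding y_def z_def using lG lx n less.prems G by (intro lring_mult lring_diff) auto
    have wz: "width i z < width i x" if nz0: "z \<noteq> 0"
    proof -
      let ?t = "top_wt ?w G + top_wt ?w x"
      have ti: "top_wt ?w (init_form ?w v) = top_wt ?w v" if nv: "v \<noteq> 0" for v :: "int ^ 'd \<Rightarrow>\<^sub>0 'a"
      proof -
        obtain k where "k \<in> keys v" "wt ?w k = top_wt ?w v" by (rule top_wt_attained[OF nv])
        then show ?thesis by (intro top_wt_eqI[of _ _ _ k]) (auto simp: keys_init_form)
      qed
      have ii: "init_form ?w (init_form ?w v) = init_form ?w v" if "v \<noteq> 0" for v :: "int ^ 'd \<Rightarrow>\<^sub>0 'a"
        by (subst init_form_def, rule part_id) (use ti[OF that] in \<open>auto simp: keys_init_form\<close>)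
      have top: "top_wt ?w (?G * x) = ?t" "top_wt ?w (?x * G) = ?t"
        using G x nz by (auto simp: top_wt_mult ti)
      have "part (\<lambda>k. wt ?w k = ?t) (?G * x) = part (\<lambda>k. wt ?w k = ?t) (?x * G)"
        using init_form_mult[OF nz(1) x(1), of ?w] init_form_mult[OF nz(2) G(2), of ?w] top
        by (simp add: ii G x mult.commute init_form_def[of _ "_ * _"])
      then have eq: "coef (?G * x) k = coef (?x * G) k" if "wt ?w k = ?t" for k
        using that by (metis (mono_tags, lifting) lookup_part)
      have below: "wt ?w k < ?t" if k: "k \<in> keys z" for k
      proof -
        have "wt ?w k \<le> ?t"
          using k keys_diff[of "?G * x" "?x * G"] top wt_le_top[of k "?G * x" ?w] wt_le_top[of k "?x * G" ?w]
          unfolding z_def by auto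
        moreover have "wt ?w k \<noteq> ?t"
          using eq[of k] k by (auto simp: z_def in_keys_iff lookup_minus)
        ultimately show ?thesis by simp
      qed
      \<comment> \<open>The lower end does not drop: \<open>?x * G\<close> reaches at most
        \<open>width i G\<close> below \<open>?t\<close>, and this is at most
        \<open>width i x\<close>. Together with the strict bound \<open>below\<close> the width
        shrinks.\<close>
      have above: "?t - real (width i x) \<le> wt ?w k" if k: "k \<in> keys z" for k
      proof -
        have low: "top_wt ?w v - real (width i v) \<le> wt ?w k" if "k \<in> keys v" for v :: "int ^ 'd \<Rightarrow>\<^sub>0 'a" and k
        proof -
          have "v \<noteq> 0" using that by auto
          then show ?thesis using wt_le_top[OF that, of "- ?w"] width_real[of v i] by simp
        qed
        have "k \<in> keys (?G * x) \<or> k \<in> keys (?x * G)"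
          using k keys_diff[of "?G * x" "?x * G"] unfolding z_def by auto
        then show ?thesis
        proof
          assume "k \<in> keys (?G * x)"
          then obtain a b where ab: "a \<in> keys ?G" "b \<in> keys x" "k = a + b" by (rule keys_timesE)
          then have "wt ?w a = top_wt ?w G" by (simp add: keys_init_form)
          then show ?thesis using ab low[OF ab(2)] by (simp only: wt_add)
        next
          assume "k \<in> keys (?x * G)"
          then obtain a b where ab: "a \<in> keys ?x" "b \<in> keys G" "k = a + b" by (rule keys_timesE)
          then have "wt ?w a = top_wt ?w x" by (simp add: keys_init_form)
          then show ?thesis using ab low[OF ab(2)] x(2) by (simp only: wt_add)
        qed
      qed
      obtain a b where ab: "a \<in> keys z" "b \<in> keys z" "int (width i z) = a $ i - b $ i"
        by (rule width_attained[OF nz0])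
      have "real_of_int (int (width i z)) < real_of_int (int (width i x))"
        unfolding ab(3) using below[OF ab(1)] above[OF ab(2)] by simp
      then show ?thesis by simp
    qed
    have "\<exists>c\<in>lring S. \<exists>q\<in>lring ?S. \<exists>r\<in>lring ?S.
      c \<noteq> 0 \<and> c * y = q * G + r \<and> (r = 0 \<or> width i r < width i G)"
    proof (cases "z = 0")
      case True
      then show ?thesis by (intro bexI[of _ 1] bexI[of _ 0] bexI[of _ 0]) (auto simp: y_def)
    next
      case False
      then show ?thesis using less.hyps[OF _ yS] wz by (simp add: y_def width_single_times)
    qed
    then obtain c q r where c: "c \<in> lring S" "q \<in> lring ?S" "r \<in> lring ?S" "c \<noteq> 0"
      "c * y = q * G + r" "r = 0 \<or> width i r < width i G" by blast
    have "c * (mterm n 1 * ?G) * x = c * y + c * mterm n 1 * ?x * G"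
      by (simp add: y_def z_def algebra_simps)
    also have "\<dots> = (q + c * mterm n 1 * ?x) * G + r"
      by (simp add: c algebra_simps)
    finally have "c * (mterm n 1 * ?G) * x = (q + c * mterm n 1 * ?x) * G + r" .
    moreover have "c * (mterm n 1 * ?G) \<noteq> 0"
      using c nz by (intro laurent_no_zero_divisors single_nonzero) auto
    moreover have "q + c * mterm n 1 * ?x \<in> lring ?S"
      using c n lx lring_mono[OF c(1), of ?S] by (intro lring_add lring_mult) auto
    ultimately show ?thesis using c n
      by (intro bexI[of _ "c * (mterm n 1 * ?G)"] bexI[of _ "q + c * mterm n 1 * ?x"] bexI[of _ r])
        (auto intro: lring_mult)
  qed
qed

lemma irreducible_divisor_exists:
  fixes x :: "int ^ 'd::finite \<Rightarrow>\<^sub>0 'a::field"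
  assumes "x \<in> lring S" "x \<noteq> 0" "\<not> x dvd 1"
  shows "\<exists>f. irreducible_in S f \<and> f dvd x"
  using assms
proof (induction "total_width x" arbitrary: x rule: less_induct)
  case less
  show ?case
  proof (cases "irreducible_in S x")
    case False
    then obtain a b where ab: "a \<in> lring S" "b \<in> lring S" "x = a * b" "\<not> a dvd 1" "\<not> b dvd 1"
      using less.prems unfolding irreducible_in_def by blast
    then have nz: "a \<noteq> 0" "b \<noteq> 0" using less.prems by auto
    then have "total_width a < total_width x"
      using total_width_mult[OF nz] total_width_pos_iff[OF nz(2)] ab by simp
    then obtain f where "irreducible_in S f" "f dvd a" using less.hyps ab nz by blast
    then show ?thesis using ab by (meson dvd_mult2)
  qed auto
qed

text \<open>The element of least width in the ideal generated by \<open>f\<close> and \<open>g\<close> divides both up to factors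
  from \<open>lring S\<close>, and these can be cancelled.\<close>

lemma elimination_in:
  fixes f g :: "int ^ 'd::finite \<Rightarrow>\<^sub>0 'a::field"
  assumes pd: "has_prime_divisors S TYPE('a)" and i: "i \<notin> S"
    and f: "irreducible_in (insert i S) f" "width i f > 0"
    and g: "g \<in> lring (insert i S)" "\<not> f dvd g"
  shows "\<exists>A\<in>lring (insert i S). \<exists>B\<in>lring (insert i S). A * f + B * g \<in> lring S \<and> A * f + B * g \<noteq> 0"
proof -
  let ?S = "insert i S"
  define I where "I = {A * f + B * g | A B. A \<in> lring ?S \<and> B \<in> lring ?S}"
  have fS: "f \<in> lring ?S" "f \<noteq> 0" using f by (auto simp: irreducible_in_def)
  have II: "A * f + B * g \<in> I" if "A \<in> lring ?S" "B \<in> lring ?S" for A B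
    using that by (auto simp: I_def)
  have fI: "f \<in> I" using II[of 1 0] by simp
  have gI: "g \<in> I" using II[of 0 1] by simp
  have IS: "x \<in> lring ?S" if "x \<in> I" for x
    using that fS g by (auto simp: I_def intro!: lring_add lring_mult)
  have Imult: "c * x \<in> I" if "x \<in> I" "c \<in> lring ?S" for c x
  proof -
    obtain A B where "x = A * f + B * g" "A \<in> lring ?S" "B \<in> lring ?S" using \<open>x \<in> I\<close> by (auto simp: I_def)
    then show ?thesis using II[of "c * A" "c * B"] that by (simp add: lring_mult algebra_simps)
  qed
  have Idiff: "x - y \<in> I" if "x \<in> I" "y \<in> I" for x y
  proof -
    obtain A B where "x = A * f + B * g" "A \<in> lring ?S" "B \<in> lring ?S" using \<open>x \<in> I\<close> by (auto simp: I_def)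
    moreover obtain A' B' where "y = A' * f + B' * g" "A' \<in> lring ?S" "B' \<in> lring ?S" using \<open>y \<in> I\<close> by (auto simp: I_def)
    ultimately show ?thesis using II[of "A - A'" "B - B'"] by (simp add: lring_diff algebra_simps)
  qed
  obtain G where G: "G \<in> I" "G \<noteq> 0" and min: "\<And>x. x \<in> I \<Longrightarrow> x \<noteq> 0 \<Longrightarrow> width i G \<le> width i x"
    using ex_has_least_nat[of "\<lambda>x. x \<in> I \<and> x \<noteq> 0" f "width i"] fI fS by auto
  have GS: "G \<in> lring ?S" using G IS by simp
  have div: "\<exists>c\<in>lring S. c \<noteq> 0 \<and> (\<exists>q\<in>lring ?S. c * x = q * G)" if xI: "x \<in> I" for x
  proof -
    obtain c q r where *: "c \<in> lring S" "q \<in> lring ?S" "r \<in> lring ?S" "c \<noteq> 0"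
      "c * x = q * G + r" "r = 0 \<or> width i r < width i G"
      using pseudo_division[OF GS G(2) i IS[OF xI]] by blast
    have "c \<in> lring ?S" by (rule lring_mono[OF *(1)]) auto
    then have "c * x - q * G \<in> I" using * xI G by (intro Idiff Imult) auto
    moreover have "c * x - q * G = r" using *(5) by simp
    ultimately have "r = 0" using *(6) min[of r] by fastforce
    then show ?thesis using * by auto
  qed
  obtain c q where c: "c \<in> lring S" "c \<noteq> 0" "q \<in> lring ?S" "c * f = q * G" using div[OF fI] by blast
  obtain c1 c2 q1 G1 where 1: "c2 \<in> lring S" "q1 \<in> lring ?S" "G1 \<in> lring ?S"
    "G = c2 * G1" "f = q1 * G1"
    using cancel_common_factor[OF pd i c(1,2,3) GS c(4)] by blast
  \<comment> \<open>Otherwise \<open>G1\<close> is \<open>f\<close> up to a unit, so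
    \<open>f\<close> divides some \<open>c' * g\<close> with \<open>c'\<close> free of
    \<open>u_i\<close>. Cancelling \<open>c'\<close> splits \<open>f\<close> as
    \<open>d * f1\<close> with \<open>f1\<close> dividing \<open>g\<close>; here \<open>d\<close>
    must be the unit, because \<open>f\<close> has positive width and \<open>d\<close> has
    none.\<close>
  have "G1 dvd 1"
  proof (rule ccontr)
    assume "\<not> G1 dvd 1"
    then have "q1 dvd 1" using f 1 unfolding irreducible_in_def by blast
    then obtain u where u: "1 = q1 * u" by (rule dvdE)
    have "f * u = (q1 * u) * G1" by (simp add: 1(5) ac_simps)
    then have fG: "G1 = f * u" using u by simp
    obtain c' q' where c': "c' \<in> lring S" "c' \<noteq> 0" "q' \<in> lring ?S" "c' * g = q' * G" using div[OF gI] by blast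
    have "q1 \<noteq> 0" using u by auto
    then have "u \<in> lring ?S" using lring_quotient[of q1 ?S u] 1(2) u[symmetric] by simp
    then have t: "q' * c2 * u \<in> lring ?S"
      using c'(3) lring_mono[OF 1(1), of ?S] by (intro lring_mult) auto
    have "c' * g = f * (q' * c2 * u)" using c'(4) 1(4) fG by (simp add: ac_simps)
    then obtain f1 d t1 where 2: "d \<in> lring S" "f1 \<in> lring ?S" "f = d * f1" "g = f1 * t1"
      using cancel_common_factor[OF pd i c'(1,2) fS(1) t] by blast
    have nz: "d \<noteq> 0" "f1 \<noteq> 0" using 2 fS by auto
    have "d \<in> lring ?S" by (rule lring_mono[OF 2(1)]) auto
    then have "d dvd 1 \<or> f1 dvd 1" using f 2 unfolding irreducible_in_def by blast
    then show False
    proof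
      assume "d dvd 1"
      then obtain v where v: "1 = d * v" by (rule dvdE)
      have "g = f * (v * t1)"
      proof -
        have "f * (v * t1) = (d * v) * (f1 * t1)" by (simp add: 2(3) ac_simps)
        then show ?thesis using v 2(4) by simp
      qed
      then show False using g(2) by auto
    next
      assume "f1 dvd 1"
      then have "width i f1 = 0" using dvd_one_iff_width[OF nz(2)] by blast
      moreover have "width i d = 0" by (rule width_lring[OF 2(1) nz(1) i])
      ultimately show False using f(2) width_mult[OF nz, of i] 2(3) by simp
    qed
  qed
  have nz: "c2 \<noteq> 0" "G1 \<noteq> 0" using 1 G by auto
  have "width i G = 0"
    using width_mult[OF nz, of i] 1(4) width_lring[OF 1(1) nz(1) i] dvd_one_iff_width[OF nz(2)] \<open>G1 dvd 1\<close> by simp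
  then obtain n where n: "mterm n 1 * G \<in> lring S" "mterm n (1::'a) \<in> lring ?S"
    using shift_into_lring[OF GS G(2) _ i] by blast
  have "mterm n 1 * G \<in> I" by (rule Imult[OF G(1) n(2)])
  moreover have "mterm n 1 * G \<noteq> 0" using G by (intro laurent_no_zero_divisors single_nonzero) auto
  ultimately show ?thesis using n(1) unfolding I_def by fastforce
qed

text \<open>If \<open>f\<close> has width zero, it is an element of \<open>lring S\<close> up to a
  monomial, and a prime divisor there is associated to it. Otherwise, if \<open>f\<close> does not
  divide \<open>x\<close>, elimination yields an element \<open>G\<close> of the ideal of
  \<open>f\<close> and \<open>x\<close> that is free of \<open>u_i\<close>; then \<open>f\<close>
  divides \<open>G * y\<close>, and \<open>G\<close> can be cancelled.\<close>

lemma irreducible_in_imp_prime_in: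
  fixes f :: "int ^ 'd::finite \<Rightarrow>\<^sub>0 'a::field"
  assumes pd: "has_prime_divisors S TYPE('a)" and i: "i \<notin> S" and f: "irreducible_in (insert i S) f"
  shows "prime_in (insert i S) f"
proof -
  let ?S = "insert i S"
  have fS: "f \<in> lring ?S" "f \<noteq> 0" "\<not> f dvd 1" using f by (auto simp: irreducible_in_def)
  show ?thesis
  proof (cases "width i f = 0")
    case True
    obtain n where n: "mterm n 1 * f \<in> lring S" "mterm (- n) (1::'a) \<in> lring ?S"
      using shift_into_lring[OF fS(1,2) True i] by blast
    let ?f = "mterm n 1 * f"
    have feq: "f = mterm (- n) 1 * ?f" by (simp only: single_inverse)
    have "f dvd ?f" by simp
    moreover have "?f dvd f" by (subst (2) feq) (rule dvd_triv_right)
    ultimately have dvd_iff: "?f dvd x \<longleftrightarrow> f dvd x" for x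
      using dvd_trans by blast
    have "?f \<noteq> 0" using fS by (intro laurent_no_zero_divisors single_nonzero) auto
    moreover have "\<not> ?f dvd 1" using fS(3) dvd_iff by simp
    ultimately obtain p where p: "prime_in S p" "p dvd ?f"
      using pd n unfolding has_prime_divisors_def by blast
    then obtain c where c: "?f = p * c" by (auto elim: dvdE)
    have pS: "p \<in> lring S" "p \<noteq> 0" "\<not> p dvd 1" using p by (auto simp: prime_in_def)
    have cS: "c \<in> lring S" using lring_quotient[of p S c] n c pS by auto
    have p2: "prime_in ?S p" by (rule prime_in_insert[OF p(1) i])
    have "f = (mterm (- n) 1 * p) * c" using feq c by (simp add: mult.assoc)
    moreover have "mterm (- n) 1 * p \<in> lring ?S" "c \<in> lring ?S"
      using n(2) lring_mono[OF pS(1), of ?S] lring_mono[OF cS, of ?S] by (auto intro!: lring_mult)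
    ultimately have "mterm (- n) 1 * p dvd 1 \<or> c dvd 1" using f unfolding irreducible_in_def by blast
    moreover have "\<not> mterm (- n) 1 * p dvd 1" using pS(3) by (meson dvd_mult_right)
    ultimately obtain v where v: "1 = c * v" by (auto elim: dvdE)
    have "?f * v = p * (c * v)" by (simp only: c mult.assoc)
    then have "p = ?f * v" using v by simp
    then have "f dvd x \<longleftrightarrow> p dvd x" for x
      using dvd_iff[of x] p(2) by (metis dvd_trans dvd_triv_left)
    then show ?thesis using p2 fS unfolding prime_in_def by simp
  next
    case False
    have "f dvd x \<or> f dvd y" if xy: "x \<in> lring ?S" "y \<in> lring ?S" "f dvd x * y" for x y
    proof (rule ccontr)
      assume *: "\<not> (f dvd x \<or> f dvd y)"
      obtain A B where AB: "A * f + B * x \<in> lring S" "A * f + B * x \<noteq> 0"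
        using elimination_in[OF pd i f _ xy(1)] False * by blast
      let ?G = "A * f + B * x"
      have "f dvd ?G * y"
        unfolding distrib_right using xy(3) by (intro dvd_add) (simp_all add: mult.assoc mult.left_commute)
      then obtain t where t: "?G * y = f * t" by (rule dvdE)
      have GS: "?G \<in> lring ?S" by (rule lring_mono[OF AB(1)]) auto
      have tS: "t \<in> lring ?S"
        using lring_quotient[of f ?S t] fS t lring_mult[OF GS xy(2)] by simp
      obtain c1 c2 q1 t1 where 1: "c1 \<in> lring S" "q1 \<in> lring ?S" "f = c1 * q1" "y = q1 * t1"
        using cancel_common_factor[OF pd i AB fS(1) tS t] by blast
      have nz: "c1 \<noteq> 0" "q1 \<noteq> 0" using 1 fS by auto
      have "c1 \<in> lring ?S" by (rule lring_mono[OF 1(1)]) auto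
      then have "c1 dvd 1 \<or> q1 dvd 1" using f 1 unfolding irreducible_in_def by blast
      then show False
      proof
        assume "c1 dvd 1"
        then obtain v where v: "1 = c1 * v" by (rule dvdE)
        have "f * (v * t1) = (c1 * v) * (q1 * t1)" by (simp add: 1(3) ac_simps)
        then have "y = f * (v * t1)" using v 1(4) by simp
        then show False using * by auto
      next
        assume "q1 dvd 1"
        then have "width i q1 = 0" using dvd_one_iff_width[OF nz(2)] by blast
        moreover have "width i c1 = 0" by (rule width_lring[OF 1(1) nz(1) i])
        ultimately show False using False width_mult[OF nz, of i] 1(3) by simp
      qed
    qed
    then show ?thesis using fS unfolding prime_in_def by blast
  qed
qed

text \<open>An irreducible divisor exists by descent on \<open>total_width\<close> and is prime by
  the lemma before. Without variables every nonzero element is a unit.\<close>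

lemma has_prime_divisors: "has_prime_divisors (S :: 'd::finite set) TYPE('a::field)"
proof (induction S rule: finite_induct[OF finite])
  case 1
  have "x dvd 1" if "x \<in> lring {}" "x \<noteq> 0" for x :: "int ^ 'd \<Rightarrow>\<^sub>0 'a"
    using that width_lring[of x "{}"] by (simp add: dvd_one_iff_width)
  then show ?case unfolding has_prime_divisors_def by blast
next
  case (2 i S)
  then show ?case
    using irreducible_divisor_exists irreducible_in_imp_prime_in unfolding has_prime_divisors_def by blast
qed

lemma elimination:
  fixes f m :: "int ^ 'd::finite \<Rightarrow>\<^sub>0 'a::field"
  assumes "irreducible f" "width i f > 0" "\<not> f dvd m"
  obtains A B where "A * f + B * m \<noteq> 0" "width i (A * f + B * m) = 0"
proof -
  have *: "insert i (UNIV - {i}) = (UNIV :: 'd set)" by auto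
  have "irreducible_in UNIV f"
    using assms(1) unfolding irreducible_in_def irreducible_def by auto
  then obtain A B where AB: "A * f + B * m \<in> lring (UNIV - {i})" "A * f + B * m \<noteq> 0"
    using elimination_in[OF has_prime_divisors, of i "UNIV - {i}" f m] assms unfolding * by auto
  show ?thesis by (rule that[OF AB(2)]) (rule width_lring[OF AB], simp)
qed

section \<open>Configurations of points whose extremes are tied\<close>

text \<open>If \<open>K\<close> is the support of \<open>f\<close>, these weights form the tropical hypersurface of \<open>f\<close>.\<close>

definition ties :: "'a::real_inner set \<Rightarrow> 'a set" where
  "ties K = {w. \<exists>a\<in>K. \<exists>b\<in>K. a \<noteq> b \<and> (\<forall>k\<in>K. w \<bullet> k \<le> w \<bullet> a) \<and> w \<bullet> b = w \<bullet> a}"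

text \<open>The weights that see only a bounded part of the sequence along \<open>J\<close>. They
  form a subspace, which can only grow when \<open>J\<close> is thinned out.\<close>

definition bounded_directions :: "nat set \<Rightarrow> (nat \<Rightarrow> 'a::euclidean_space) \<Rightarrow> 'a set" where
  "bounded_directions J z = {w. \<exists>C. \<forall>j\<in>J. \<bar>w \<bullet> z j\<bar> \<le> C}"

lemma subspace_bounded_directions: "subspace (bounded_directions J z)"
  unfolding subspace_def
proof (intro conjI ballI allI)
  show "0 \<in> bounded_directions J z" by (auto simp: bounded_directions_def)
next
  fix v w assume "v \<in> bounded_directions J z" "w \<in> bounded_directions J z"
  then obtain C D where "\<forall>j\<in>J. \<bar>v \<bullet> z j\<bar> \<le> C" "\<forall>j\<in>J. \<bar>w \<bullet> z j\<bar> \<le> D"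
    by (auto simp: bounded_directions_def)
  then have "\<forall>j\<in>J. \<bar>(v + w) \<bullet> z j\<bar> \<le> C + D"
    unfolding inner_add_left by (meson abs_triangle_ineq add_mono order_trans)
  then show "v + w \<in> bounded_directions J z" by (auto simp: bounded_directions_def)
next
  fix c w assume "w \<in> bounded_directions J z"
  then obtain C where "\<forall>j\<in>J. \<bar>w \<bullet> z j\<bar> \<le> C" by (auto simp: bounded_directions_def)
  then have "\<forall>j\<in>J. \<bar>(c *\<^sub>R w) \<bullet> z j\<bar> \<le> \<bar>c\<bar> * C"
    by (auto simp: abs_mult intro: mult_left_mono)
  then show "c *\<^sub>R w \<in> bounded_directions J z" by (auto simp: bounded_directions_def)
qed

lemma bounded_directions_mono: "J' \<subseteq> J \<Longrightarrow> bounded_directions J z \<subseteq> bounded_directions J' z"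
  by (fastforce simp: bounded_directions_def)

text \<open>Along an infinite index set that maximizes the dimensions of all spaces of bounded directions,
  every other direction is unbounded along every infinite subset.\<close>

lemma stable_index_set:
  fixes z :: "'p \<Rightarrow> nat \<Rightarrow> 'a::euclidean_space"
  assumes "finite P" "infinite J"
  obtains J' where "J' \<subseteq> J" "infinite J'"
    "\<And>J'' p. p \<in> P \<Longrightarrow> J'' \<subseteq> J' \<Longrightarrow> infinite J'' \<Longrightarrow> bounded_directions J'' (z p) = bounded_directions J' (z p)"
proof -
  let ?h = "\<lambda>J. \<Sum>p\<in>P. dim (bounded_directions J (z p))"
  have bd: "\<forall>J'. J' \<subseteq> J \<and> infinite J' \<longrightarrow> ?h J' < Suc (card P * DIM('a))"
    using sum_bounded_above[of P "\<lambda>p. dim (bounded_directions _ (z p))" "DIM('a)"]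
    by (auto simp: dim_subset_UNIV less_Suc_eq_le)
  obtain J' where J': "J' \<subseteq> J" "infinite J'"
    and max: "\<forall>J''. J'' \<subseteq> J \<and> infinite J'' \<longrightarrow> ?h J'' \<le> ?h J'"
    using ex_has_greatest_nat[of "\<lambda>J'. J' \<subseteq> J \<and> infinite J'" J ?h, OF _ bd] assms(2) by auto
  have eq: "bounded_directions J'' (z p) = bounded_directions J' (z p)"
    if "p \<in> P" "J'' \<subseteq> J'" "infinite J''" for J'' p
  proof -
    have le: "dim (bounded_directions J' (z q)) \<le> dim (bounded_directions J'' (z q))" for q
      by (rule dim_subset[OF bounded_directions_mono[OF that(2)]])
    have "dim (bounded_directions J'' (z p)) \<le> dim (bounded_directions J' (z p))"
    proof (rule ccontr)
      assume "\<not> ?thesis"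
      then have "?h J' < ?h J''"
        using that(1) assms(1) le by (intro sum_strict_mono_ex1) (auto simp: not_le)
      moreover have "?h J'' \<le> ?h J'" using max that J' by auto
      ultimately show False by simp
    qed
    then show ?thesis
      using subspace_dim_equal[OF subspace_bounded_directions subspace_bounded_directions
        bounded_directions_mono[OF that(2)]] by auto
  qed
  show ?thesis by (rule that[OF J']) (rule eq)
qed

text \<open>On a stable index set unbounded means divergent: infinitely many exceptions would make
  \<open>w\<close> bounded along them, and hence along \<open>J'\<close>.\<close>

lemma finite_bounded_indices:
  assumes "\<And>J''. J'' \<subseteq> J' \<Longrightarrow> infinite J'' \<Longrightarrow> bounded_directions J'' z = bounded_directions J' z"
    and "w \<notin> bounded_directions J' z"
  shows "finite {j \<in> J'. \<bar>w \<bullet> z j\<bar> \<le> C}"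
proof (rule ccontr)
  assume "infinite {j \<in> J'. \<bar>w \<bullet> z j\<bar> \<le> C}"
  then have "bounded_directions {j \<in> J'. \<bar>w \<bullet> z j\<bar> \<le> C} z = bounded_directions J' z"
    using assms(1) by simp
  moreover have "w \<in> bounded_directions {j \<in> J'. \<bar>w \<bullet> z j\<bar> \<le> C} z"
    by (auto simp: bounded_directions_def)
  ultimately show False using assms(2) by simp
qed

lemma bounded_if_all_directions_bounded:
  fixes g :: "nat \<Rightarrow> 'a::euclidean_space"
  assumes "\<And>b. b \<in> Basis \<Longrightarrow> b \<in> bounded_directions J g"
  obtains K where "\<And>j. j \<in> J \<Longrightarrow> norm (g j) \<le> K"
proof -
  have "\<forall>b\<in>Basis. \<exists>C. \<forall>j\<in>J. \<bar>b \<bullet> g j\<bar> \<le> C"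
    using assms by (auto simp: bounded_directions_def)
  then obtain C where C: "\<And>b j. b \<in> Basis \<Longrightarrow> j \<in> J \<Longrightarrow> \<bar>b \<bullet> g j\<bar> \<le> C b" by metis
  have "norm (g j) \<le> (\<Sum>b\<in>Basis. C b)" if "j \<in> J" for j
  proof -
    have "norm (g j) \<le> (\<Sum>b\<in>Basis. \<bar>g j \<bullet> b\<bar>)" by (rule norm_le_l1)
    also have "\<dots> \<le> (\<Sum>b\<in>Basis. C b)" using C that by (intro sum_mono) (simp add: inner_commute)
    finally show ?thesis .
  qed
  then show ?thesis by (rule that)
qed

section \<open>Avoiding subspaces, normal cones and edges of polytopes\<close>

lemma open_not_covered_by_proper_subspaces:
  fixes U :: "'a::euclidean_space set"
  assumes "open U" "U \<noteq> {}" "finite P" "\<And>p. p \<in> P \<Longrightarrow> subspace (B p)" "\<And>p. p \<in> P \<Longrightarrow> B p \<noteq> UNIV"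
  shows "\<not> U \<subseteq> (\<Union>p\<in>P. B p)"
proof
  assume *: "U \<subseteq> (\<Union>p\<in>P. B p)"
  have "negligible (B p)" if "p \<in> P" for p
  proof (rule negligible_lowdim)
    have "dim (B p) \<noteq> DIM('a)"
      using assms(4,5)[OF that] subspace_dim_equal[of "B p" UNIV] by auto
    then show "dim (B p) < DIM('a)" using dim_subset_UNIV[of "B p"] by simp
  qed
  then have "negligible (\<Union>p\<in>P. B p)" using assms(3) by (intro negligible_Union) auto
  then show False using * open_not_negligible[OF assms(1,2)] negligible_subset by blast
qed

text \<open>A vertex lies outside the convex hull of the other points; the negative of a separating
  functional lies in the cone. Finiteness of \<open>K\<close> makes the cone open.\<close>

lemma vertex_has_open_normal_cone:
  fixes K :: "'a::euclidean_space set"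
  assumes "finite K" "a extreme_point_of (convex hull K)"
  shows "a \<in> K" "open {w. \<forall>b\<in>K - {a}. w \<bullet> b < w \<bullet> a}" "{w. \<forall>b\<in>K - {a}. w \<bullet> b < w \<bullet> a} \<noteq> {}"
proof -
  show "a \<in> K" using assms(2) by (rule extreme_point_of_convex_hull)
  have "w \<bullet> b < w \<bullet> a \<longleftrightarrow> (b - a) \<bullet> w < 0" for w b
    by (simp add: inner_diff_left inner_diff_right inner_commute)
  moreover have "open (\<Inter>b\<in>K - {a}. {w. (b - a) \<bullet> w < 0})"
    using assms(1) by (intro open_INT) (auto simp: open_halfspace_lt)
  ultimately show "open {w. \<forall>b\<in>K - {a}. w \<bullet> b < w \<bullet> a}" by (simp add: Collect_ball_eq)
  have "convex (convex hull K - {a})"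
    using assms(2) extreme_point_of_stillconvex[of "convex hull K" a] by simp
  then have "convex hull (K - {a}) \<subseteq> convex hull K - {a}"
    by (intro hull_minimal) (auto intro: hull_inc)
  then have "a \<notin> convex hull (K - {a})" by auto
  moreover have "closed (convex hull (K - {a}))"
    using assms(1) by (intro compact_imp_closed finite_imp_compact_convex_hull) auto
  ultimately obtain v \<beta> where v: "v \<bullet> a < \<beta>" "\<forall>y\<in>convex hull (K - {a}). \<beta> < v \<bullet> y"
    using separating_hyperplane_closed_point[OF convex_convex_hull] by blast
  have "(- v) \<bullet> b < (- v) \<bullet> a" if "b \<in> K - {a}" for b
    using v(1) bspec[OF v(2) hull_inc[OF that]] by simp
  then show "{w. \<forall>b\<in>K - {a}. w \<bullet> b < w \<bullet> a} \<noteq> {}" by blast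
qed

text \<open>Connectedness: without a tie the segment would split into two disjoint nonempty closed
  sets, one where \<open>a\<close> is maximal and one where another point is.\<close>

lemma segment_meets_ties:
  fixes K :: "'a::real_inner set"
  assumes K: "finite K" "a \<in> K" "b \<in> K" "a \<noteq> b"
    and v: "\<And>k. k \<in> K - {a} \<Longrightarrow> v \<bullet> k < v \<bullet> a" and w: "\<And>k. k \<in> K - {b} \<Longrightarrow> w \<bullet> k < w \<bullet> b"
  shows "\<exists>t\<in>{0..1}. (1 - t) *\<^sub>R v + t *\<^sub>R w \<in> ties K"
proof (rule ccontr)
  assume "\<not> ?thesis"
  then have nt: "(1 - t) *\<^sub>R v + t *\<^sub>R w \<notin> ties K" if "t \<in> {0..1}" for t using that by auto
  define g where "g t = (1 - t) *\<^sub>R v + t *\<^sub>R w" for t :: real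
  define F where "F k = (\<Inter>k'\<in>K. {t. g t \<bullet> k' \<le> g t \<bullet> k})" for k
  have cF: "closed (F k)" for k
    unfolding F_def g_def inner_add_left by (intro closed_INT ballI closed_Collect_le continuous_intros)
  have "closed (\<Union>k\<in>K - {a}. F k)" using K(1) cF by auto
  moreover have "{0..1} \<subseteq> F a \<union> (\<Union>k\<in>K - {a}. F k)"
  proof
    fix t :: real
    obtain k where k: "k \<in> K" "g t \<bullet> k = Max ((\<lambda>k. g t \<bullet> k) ` K)"
      using Max_image_attained[of K "\<lambda>k. g t \<bullet> k"] K by auto
    then have "t \<in> F k" unfolding F_def using K(1) by auto
    then show "t \<in> F a \<union> (\<Union>k\<in>K - {a}. F k)" using k(1) by (cases "k = a") auto
  qed
  moreover have "F a \<inter> (\<Union>k\<in>K - {a}. F k) \<inter> {0..1} = {}"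
  proof -
    have False if t: "t \<in> F a" "t \<in> F k" "k \<in> K" "k \<noteq> a" "t \<in> {0..1}" for t k
    proof -
      have "\<forall>k'\<in>K. g t \<bullet> k' \<le> g t \<bullet> a" using t(1) by (simp add: F_def)
      moreover have "g t \<bullet> a \<le> g t \<bullet> k" using t(2) K by (simp add: F_def)
      ultimately have "g t \<in> ties K"
        unfolding ties_def using t K by (intro CollectI bexI[of _ a] bexI[of _ k]) (auto intro: antisym)
      then show False using nt t by (simp add: g_def)
    qed
    then show ?thesis by blast
  qed
  moreover have "0 \<in> F a"
    using v by (auto simp: F_def g_def intro: less_imp_le)
  moreover have "1 \<in> F b"
    using w by (simp add: F_def g_def) (metis Diff_iff empty_iff insert_iff less_imp_le order_refl)
  ultimately show False
    using connected_closedD[OF connected_Icc[of 0 "1::real"], of "F a" "\<Union>k\<in>K - {a}. F k"] cF K by fastforce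
qed


text \<open>Descend through facets, each of dimension one less, until dimension one is
  reached.\<close>

lemma polytope_edge_exists:
  fixes P :: "'a::euclidean_space set"
  assumes "polytope P" "aff_dim P \<ge> 1"
  obtains e where "e edge_of P"
proof -
  have "\<exists>e. e edge_of P" if "polytope P" "aff_dim P \<ge> 1" for P :: "'a set"
    using that
  proof (induction "nat (aff_dim P)" arbitrary: P rule: less_induct)
    case less
    show ?case
    proof (cases "aff_dim P = 1")
      case True
      then show ?thesis using face_of_refl[OF polytope_imp_convex[OF less.prems(1)]] by (auto simp: edge_of_def)
    next
      case False
      obtain F where F: "F facet_of P" using polytope_facet_exists[OF less.prems(1)] less.prems(2) by auto
      then have "F face_of P" "aff_dim F = aff_dim P - 1" by (auto simp: facet_of_def)
      moreover have "polytope F" using less.prems(1) \<open>F face_of P\<close> by (rule face_of_polytope_polytope)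
      ultimately obtain e where "e edge_of F" using less.hyps[of F] less.prems False by auto
      then show ?thesis using \<open>F face_of P\<close> by (auto simp: edge_of_def intro: face_of_trans)
    qed
  qed
  then show ?thesis using assms that by blast
qed

text \<open>Faces of a polytope are exposed, here by \<open>w0\<close>. The strict inequalities
  between the edge and the points of \<open>K\<close> off it define an open set around
  \<open>w0\<close>, and any weight in it that is orthogonal to the edge is tied at \<open>a\<close>
  and \<open>b\<close>.\<close>

lemma edge_normal_cone:
  fixes K :: "'a::euclidean_space set"
  assumes K: "finite K" and e: "e edge_of (convex hull K)"
  obtains a b U where "a \<in> e" "b \<in> e" "a \<noteq> b" "open U" "U \<inter> {w. w \<bullet> (b - a) = 0} \<noteq> {}"
    "U \<inter> {w. w \<bullet> (b - a) = 0} \<subseteq> ties K"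
proof -
  have ef: "e face_of (convex hull K)" "aff_dim e = 1" using e by (auto simp: edge_of_def)
  have "polyhedron (convex hull K)"
    by (intro polytope_imp_polyhedron polytope_convex_hull K)
  then obtain w0 \<beta> where w0: "convex hull K \<subseteq> {x. w0 \<bullet> x \<le> \<beta>}" "e = convex hull K \<inter> {x. w0 \<bullet> x = \<beta>}"
    using ef(1) exposed_face_of_polyhedron unfolding exposed_face_of_def by metis
  obtain S' where S': "S' \<subseteq> K" "e = convex hull S'"
    using face_of_convex_hull_subset[OF finite_imp_compact[OF K] ef(1)] by blast
  have "aff_dim S' = 1" using ef(2) S'(2) by (simp add: aff_dim_convex_hull)
  then have "S' \<noteq> {}" "\<And>x. S' \<noteq> {x}" by auto
  then obtain a b where ab: "a \<in> S'" "b \<in> S'" "a \<noteq> b" by blast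
  have abe: "a \<in> e" "b \<in> e" using ab S' by (auto intro: hull_inc)
  have col: "\<exists>c. k - a = c *\<^sub>R (b - a)" if k: "k \<in> e" for k
  proof -
    obtain u where u: "\<forall>x\<in>e. \<forall>y\<in>e. \<exists>c. x - y = c *\<^sub>R u"
      using collinear_aff_dim[of e] ef(2) by (auto simp: collinear_def)
    obtain c d where "k - a = c *\<^sub>R u" "b - a = d *\<^sub>R u" using u k abe by metis
    then have "k - a = (c / d) *\<^sub>R (b - a)" using ab by auto
    then show ?thesis by blast
  qed
  define U where "U = (\<Inter>k\<in>K - e. {w. (k - a) \<bullet> w < 0})"
  have "open U" unfolding U_def using K by (intro open_INT) (auto simp: open_halfspace_lt)
  moreover have "w0 \<in> U \<inter> {w. w \<bullet> (b - a) = 0}"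
  proof -
    have wa: "w0 \<bullet> a = \<beta>" "w0 \<bullet> b = \<beta>" using abe w0(2) by auto
    moreover have "w0 \<bullet> k < \<beta>" if "k \<in> K - e" for k
    proof -
      have "k \<in> convex hull K" using that by (auto intro: hull_inc)
      then show ?thesis using w0 that by force
    qed
    ultimately show ?thesis by (simp add: U_def inner_diff_left inner_diff_right inner_commute)
  qed
  moreover have "U \<inter> {w. w \<bullet> (b - a) = 0} \<subseteq> ties K"
  proof
    fix w assume w: "w \<in> U \<inter> {w. w \<bullet> (b - a) = 0}"
    have "w \<bullet> k \<le> w \<bullet> a" if "k \<in> K" for k
    proof (cases "k \<in> e")
      case True
      then obtain c where "k - a = c *\<^sub>R (b - a)" using col by blast
      then have "w \<bullet> (k - a) = 0" using w by simp
      then show ?thesis by (simp add: inner_diff_right)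
    next
      case False
      then have "(k - a) \<bullet> w < 0" using w that by (auto simp: U_def)
      then show ?thesis by (simp add: inner_diff_left inner_diff_right inner_commute)
    qed
    moreover have "w \<bullet> b = w \<bullet> a" using w by (simp add: inner_diff_right)
    ultimately show "w \<in> ties K" using ab S'(1) unfolding ties_def by blast
  qed
  ultimately show ?thesis using that abe ab(3) by blast
qed

text \<open>A redrawing may collapse edges, so a single segment already qualifies.\<close>

lemma parallel_segment:
  fixes P :: "'a::euclidean_space set"
  assumes e: "e edge_of P" "a \<in> e" "b \<in> e" "a \<noteq> b" and c: "c \<noteq> 0"
  shows "parallel_redrawing P (closed_segment x (x + c *\<^sub>R (b - a)))"
proof -
  let ?y = "x + c *\<^sub>R (b - a)" and ?Q = "closed_segment x (x + c *\<^sub>R (b - a))"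
  have xy: "x \<noteq> ?y" using assms by simp
  have Q: "?Q = convex hull {x, ?y}" by (rule segment_convex_hull)
  have dQ: "aff_dim ?Q = 1" using xy by (simp add: Q aff_dim_convex_hull)
  have "?Q edge_of ?Q" by (simp add: edge_of_def face_of_refl dQ)
  moreover have "e' = ?Q" if "e' edge_of ?Q" for e'
    using that face_of_aff_dim_lt[of ?Q e'] dQ by (auto simp: edge_of_def)
  moreover have "affine_parallel (affine hull ?Q) (affine hull e)"
  proof -
    have "affine hull {a, b} = affine hull e"
      using e aff_dim_eq_full_gen[of "{a, b}" e] by (simp add: edge_of_def)
    then have "affine hull e = range (\<lambda>u. a + u *\<^sub>R (b - a))" by (simp add: affine_hull_2_alt)
    moreover have "affine hull ?Q = range (\<lambda>u. x + u *\<^sub>R (c *\<^sub>R (b - a)))"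
      unfolding Q by (simp add: affine_hull_2_alt)
    moreover have "range (\<lambda>u. a + u *\<^sub>R (b - a)) = (+) (a - x) ` range (\<lambda>u. x + u *\<^sub>R (c *\<^sub>R (b - a)))"
    proof safe
      fix u
      have "a + u *\<^sub>R (b - a) = (a - x) + (x + (u / c) *\<^sub>R (c *\<^sub>R (b - a)))" using c by simp
      then show "a + u *\<^sub>R (b - a) \<in> (+) (a - x) ` range (\<lambda>u. x + u *\<^sub>R (c *\<^sub>R (b - a)))" by blast
    next
      fix u
      have "(a - x) + (x + u *\<^sub>R (c *\<^sub>R (b - a))) = a + (u * c) *\<^sub>R (b - a)" by simp
      then show "(a - x) + (x + u *\<^sub>R (c *\<^sub>R (b - a))) \<in> range (\<lambda>u. a + u *\<^sub>R (b - a))" by blast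
    qed
    ultimately show ?thesis unfolding affine_parallel_def by metis
  qed
  moreover have "polytope ?Q" unfolding Q by (rule polytope_convex_hull) simp
  ultimately show ?thesis unfolding parallel_redrawing_def using e(1) by metis
qed


text \<open>The geometric argument sees only this much of a vanishing sum. In \<open>tied\<close>
  the bound \<open>C\<close> may vary with \<open>w\<close> but is uniform in
  \<open>j\<close>.\<close>

locale tied_configurations =
  fixes K :: "'a::euclidean_space set" and S :: "'s set" and J :: "nat set" and x :: "nat \<Rightarrow> 's \<Rightarrow> 'a"
  assumes K: "finite K" and S: "finite S" "S \<noteq> {}" and J: "infinite J"
    and tied: "\<And>w. w \<in> ties K \<Longrightarrow> \<exists>C. \<forall>j\<in>J. \<forall>s\<in>S. \<exists>t\<in>S. t \<noteq> s \<and> w \<bullet> x j s - C \<le> w \<bullet> x j t"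
    and apart: "\<And>s t C. s \<in> S \<Longrightarrow> t \<in> S \<Longrightarrow> s \<noteq> t \<Longrightarrow> finite {j \<in> J. norm (x j s - x j t) \<le> C}"
begin

definition pairs :: "('s \<times> 's) set" where
  "pairs = {p \<in> S \<times> S. fst p \<noteq> snd p}"

definition gap :: "'s \<times> 's \<Rightarrow> nat \<Rightarrow> 'a" where
  "gap p j = x j (fst p) - x j (snd p)"

lemma finite_pairs: "finite pairs"
  using S(1) by (simp add: pairs_def)

text \<open>If every direction were bounded, the gap would stay bounded in norm for infinitely many
  \<open>j\<close>, against \<open>apart\<close>.\<close>

lemma bounded_directions_gap_proper:
  assumes "p \<in> pairs" "J' \<subseteq> J" "infinite J'"
  shows "bounded_directions J' (gap p) \<noteq> UNIV"
proof
  assume "bounded_directions J' (gap p) = UNIV"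
  then obtain C where C: "\<And>j. j \<in> J' \<Longrightarrow> norm (gap p j) \<le> C"
    using bounded_if_all_directions_bounded[of J' "gap p"] by auto
  have "J' \<subseteq> {j \<in> J. norm (x j (fst p) - x j (snd p)) \<le> C}"
    using C assms(2) by (auto simp: gap_def)
  moreover have "finite {j \<in> J. norm (x j (fst p) - x j (snd p)) \<le> C}"
    using assms(1) by (intro apart) (auto simp: pairs_def)
  ultimately show False using assms(3) finite_subset by blast
qed

text \<open>A generic weight from the cone of a vertex separates its maximizer from all other points
  by margins that tend to infinity. If two vertices shared a maximizer, its margin at a tie weight
  between them, a convex combination of two large margins, would eventually exceed every
  \<open>C\<close>.\<close>

lemma card_vertices_le: "card {a. a extreme_point_of (convex hull K)} \<le> card S"
proof -
  let ?V = "{a. a extreme_point_of (convex hull K)}"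
  have VK: "?V \<subseteq> K" by (rule extreme_points_of_convex_hull)
  have fV: "finite ?V" by (rule finite_subset[OF VK K])
  obtain J' where J': "J' \<subseteq> J" "infinite J'"
    and stable: "\<And>J'' p. p \<in> pairs \<Longrightarrow> J'' \<subseteq> J' \<Longrightarrow> infinite J'' \<Longrightarrow>
      bounded_directions J'' (gap p) = bounded_directions J' (gap p)"
    using stable_index_set[OF finite_pairs J, of gap] by metis
  have "\<exists>w. (\<forall>b\<in>K - {a}. w \<bullet> b < w \<bullet> a) \<and> (\<forall>p\<in>pairs. w \<notin> bounded_directions J' (gap p))" if "a \<in> ?V" for a
  proof -
    have "\<not> {w. \<forall>b\<in>K - {a}. w \<bullet> b < w \<bullet> a} \<subseteq> (\<Union>p\<in>pairs. bounded_directions J' (gap p))"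
      using that vertex_has_open_normal_cone[OF K] finite_pairs bounded_directions_gap_proper[OF _ J']
      by (intro open_not_covered_by_proper_subspaces subspace_bounded_directions) auto
    then show ?thesis by blast
  qed
  then obtain w where w: "\<And>a b. a \<in> ?V \<Longrightarrow> b \<in> K - {a} \<Longrightarrow> w a \<bullet> b < w a \<bullet> a"
    "\<And>a p. a \<in> ?V \<Longrightarrow> p \<in> pairs \<Longrightarrow> w a \<notin> bounded_directions J' (gap p)"
    by metis
  have "\<exists>s. s \<in> S \<and> (\<forall>t\<in>S. w a \<bullet> x j t \<le> w a \<bullet> x j s)" for a j
  proof -
    obtain s where "s \<in> S" "w a \<bullet> x j s = Max ((\<lambda>t. w a \<bullet> x j t) ` S)"
      by (rule Max_image_attained[OF S])
    then show ?thesis using S(1) by (intro exI[of _ s]) auto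
  qed
  note ex = this
  define h where "h j a = (SOME s. s \<in> S \<and> (\<forall>t\<in>S. w a \<bullet> x j t \<le> w a \<bullet> x j s))" for j a
  have h: "h j a \<in> S" "t \<in> S \<Longrightarrow> w a \<bullet> x j t \<le> w a \<bullet> x j (h j a)" for j a t
    using someI_ex[OF ex[of a j]] by (auto simp: h_def)
  have "(\<lambda>j. restrict (h j) ?V) ` J' \<subseteq> ?V \<rightarrow>\<^sub>E S" using h by (simp add: image_subset_iff restrict_PiE_iff)
  then have "finite ((\<lambda>j. restrict (h j) ?V) ` J')"
    by (rule finite_subset) (intro finite_PiE fV S)
  \<comment> \<open>There are finitely many assignments of maximizers to vertices, so one of them
    recurs for infinitely many \<open>j\<close>.\<close>
  then obtain j0 where j0: "infinite {j \<in> J'. restrict (h j) ?V = restrict (h j0) ?V}"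
    using pigeonhole_infinite[OF J'(2)] by blast
  define J2 where "J2 = {j \<in> J'. restrict (h j) ?V = restrict (h j0) ?V}"
  have J2: "infinite J2" "J2 \<subseteq> J'" using j0 by (auto simp: J2_def)
  have hc: "h j a = h j0 a" if "j \<in> J2" "a \<in> ?V" for j a
  proof -
    have "restrict (h j) ?V = restrict (h j0) ?V" using that(1) by (simp add: J2_def)
    then have "restrict (h j) ?V a = restrict (h j0) ?V a" by (rule fun_cong)
    then show ?thesis using that(2) by (simp only: restrict_apply' )
  qed
  have far: "finite {j \<in> J2. w a \<bullet> x j (h j0 a) - w a \<bullet> x j t \<le> C}" if a: "a \<in> ?V" "t \<in> S" "t \<noteq> h j0 a" for a t C
  proof (rule finite_subset)
    let ?p = "(h j0 a, t)"
    have p: "?p \<in> pairs" using a h by (auto simp: pairs_def)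
    show "{j \<in> J2. w a \<bullet> x j (h j0 a) - w a \<bullet> x j t \<le> C} \<subseteq> {j \<in> J'. \<bar>w a \<bullet> gap ?p j\<bar> \<le> C}"
    proof
      fix j assume j: "j \<in> {j \<in> J2. w a \<bullet> x j (h j0 a) - w a \<bullet> x j t \<le> C}"
      then have "w a \<bullet> x j t \<le> w a \<bullet> x j (h j0 a)" using h(2)[OF a(2), of a j] hc[OF _ a(1), of j] by simp
      then show "j \<in> {j \<in> J'. \<bar>w a \<bullet> gap ?p j\<bar> \<le> C}"
        using j J2(2) by (auto simp: gap_def inner_diff_right)
    qed
    show "finite {j \<in> J'. \<bar>w a \<bullet> gap ?p j\<bar> \<le> C}"
      using stable[OF p] w(2)[OF a(1) p] by (rule finite_bounded_indices)
  qed
  have "inj_on (h j0) ?V"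
  proof (rule inj_onI, rule ccontr)
    fix a b assume ab: "a \<in> ?V" "b \<in> ?V" "h j0 a = h j0 b" "a \<noteq> b"
    let ?s = "h j0 a"
    obtain t where t: "t \<in> {0..1}" "(1 - t) *\<^sub>R w a + t *\<^sub>R w b \<in> ties K"
      using segment_meets_ties[OF K _ _ ab(4) w(1)[OF ab(1)] w(1)[OF ab(2)]] ab VK by blast
    obtain C where C: "\<forall>j\<in>J. \<forall>s\<in>S. \<exists>u\<in>S. u \<noteq> s \<and>
      ((1 - t) *\<^sub>R w a + t *\<^sub>R w b) \<bullet> x j s - C \<le> ((1 - t) *\<^sub>R w a + t *\<^sub>R w b) \<bullet> x j u"
      using tied[OF t(2)] by blast
    have "J2 \<subseteq> (\<Union>u\<in>S - {?s}. {j \<in> J2. w a \<bullet> x j ?s - w a \<bullet> x j u \<le> C} \<union> {j \<in> J2. w b \<bullet> x j ?s - w b \<bullet> x j u \<le> C})"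
    proof
      fix j assume j: "j \<in> J2"
      then have "j \<in> J" using J2 J' by auto
      then obtain u where u: "u \<in> S" "u \<noteq> ?s"
        "((1 - t) *\<^sub>R w a + t *\<^sub>R w b) \<bullet> x j ?s - C \<le> ((1 - t) *\<^sub>R w a + t *\<^sub>R w b) \<bullet> x j u"
        using C h(1) by blast
      let ?A = "w a \<bullet> x j ?s - w a \<bullet> x j u" and ?B = "w b \<bullet> x j ?s - w b \<bullet> x j u"
      \<comment> \<open>A convex combination is at least the smaller term, so one of the two margins
        is at most \<open>C\<close>.\<close>
      have "(1 - t) * ?A + t * ?B \<le> C" using u(3) by (simp add: inner_add_left algebra_simps)
      moreover have "(1 - t) * min ?A ?B + t * min ?A ?B \<le> (1 - t) * ?A + t * ?B"
        using t(1) by (intro add_mono mult_left_mono) auto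
      moreover have "(1 - t) * min ?A ?B + t * min ?A ?B = min ?A ?B" by (simp add: algebra_simps)
      ultimately have "min ?A ?B \<le> C" by linarith
      then show "j \<in> (\<Union>u\<in>S - {?s}. {j \<in> J2. w a \<bullet> x j ?s - w a \<bullet> x j u \<le> C} \<union> {j \<in> J2. w b \<bullet> x j ?s - w b \<bullet> x j u \<le> C})"
        using j u by (auto simp: min_le_iff_disj)
    qed
    moreover have "finite (\<Union>u\<in>S - {?s}. {j \<in> J2. w a \<bullet> x j ?s - w a \<bullet> x j u \<le> C} \<union> {j \<in> J2. w b \<bullet> x j ?s - w b \<bullet> x j u \<le> C})"
      using far[OF ab(1)] far[OF ab(2)] ab(3) S(1) by auto
    ultimately show False using J2(1) finite_subset by blast
  qed
  moreover have "h j0 ` ?V \<subseteq> S" using h by auto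
  ultimately show ?thesis using S(1) by (intro card_inj_on_le)
qed

text \<open>Every tie weight is bounded on some pair, but the pair may change with the weight.
  Finitely many proper subspaces cannot cover an open piece of the hyperplane orthogonal to the
  edge, so one pair serves the whole hyperplane, and the projection of its gap is bounded.\<close>

lemma pair_along_edge:
  assumes e: "e edge_of (convex hull K)"
  obtains a b s t J' C where "a \<in> e" "b \<in> e" "a \<noteq> b" "s \<in> S" "t \<in> S" "s \<noteq> t" "J' \<subseteq> J" "infinite J'"
    "\<forall>j\<in>J'. \<exists>c. c \<noteq> 0 \<and> norm (x j t - (x j s + c *\<^sub>R (b - a))) \<le> C"
proof -
  obtain a b U where ab: "a \<in> e" "b \<in> e" "a \<noteq> b" and U: "open U" "U \<inter> {w. w \<bullet> (b - a) = 0} \<noteq> {}"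
    "U \<inter> {w. w \<bullet> (b - a) = 0} \<subseteq> ties K"
    by (rule edge_normal_cone[OF K e])
  define u where "u = b - a"
  note U = U[folded u_def]
  \<comment> \<open>The orthogonal projection along the edge. Preimages under it turn the relatively
    open piece of the hyperplane into an open subset of the whole space.\<close>
  define \<pi> where "\<pi> y = y - ((y \<bullet> u) / (u \<bullet> u)) *\<^sub>R u" for y
  have uu: "u \<bullet> u \<noteq> 0" using ab by (simp add: u_def)
  have lin: "linear \<pi>" unfolding \<pi>_def
    by (rule linearI) (simp_all add: algebra_simps inner_add_left add_divide_distrib)
  have perp: "\<pi> y \<bullet> u = 0" for y using uu by (simp add: \<pi>_def inner_diff_left)
  have fixed: "\<pi> y = y" if "y \<bullet> u = 0" for y using that by (simp add: \<pi>_def)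
  have adj: "y \<bullet> \<pi> y' = \<pi> y \<bullet> y'" for y y'
    by (simp add: \<pi>_def inner_diff_left inner_diff_right inner_commute)
  obtain J' where J': "J' \<subseteq> J" "infinite J'"
    and stable: "\<And>J'' p. p \<in> pairs \<Longrightarrow> J'' \<subseteq> J' \<Longrightarrow> infinite J'' \<Longrightarrow>
      bounded_directions J'' (gap p) = bounded_directions J' (gap p)"
    using stable_index_set[OF finite_pairs J, of gap] by metis
  have cover: "\<exists>p\<in>pairs. w \<in> bounded_directions J' (gap p)" if wt: "w \<in> ties K" for w
  proof -
    obtain C where C: "\<forall>j\<in>J. \<forall>s\<in>S. \<exists>t\<in>S. t \<noteq> s \<and> w \<bullet> x j s - C \<le> w \<bullet> x j t"
      using tied[OF wt] by blast
    have "\<forall>j\<in>J'. \<exists>p\<in>pairs. \<bar>w \<bullet> gap p j\<bar> \<le> C"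
    proof
      fix j assume "j \<in> J'"
      obtain s where s: "s \<in> S" "w \<bullet> x j s = Max ((\<lambda>t. w \<bullet> x j t) ` S)"
        by (rule Max_image_attained[OF S])
      then obtain t where t: "t \<in> S" "t \<noteq> s" "w \<bullet> x j s - C \<le> w \<bullet> x j t"
        using C \<open>j \<in> J'\<close> J' by blast
      have "w \<bullet> x j t \<le> w \<bullet> x j s" unfolding s(2) using t S(1) by auto
      then have "\<bar>w \<bullet> gap (s, t) j\<bar> \<le> C" using t by (simp add: gap_def inner_diff_right)
      moreover have "(s, t) \<in> pairs" using s t by (auto simp: pairs_def)
      ultimately show "\<exists>p\<in>pairs. \<bar>w \<bullet> gap p j\<bar> \<le> C" by blast
    qed
    from pigeonhole_infinite_rel[OF J'(2) finite_pairs this]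
    obtain p where p: "p \<in> pairs" "infinite {j \<in> J'. \<bar>w \<bullet> gap p j\<bar> \<le> C}"
      by (elim bexE)
    have "w \<in> bounded_directions {j \<in> J'. \<bar>w \<bullet> gap p j\<bar> \<le> C} (gap p)"
      by (auto simp: bounded_directions_def)
    moreover have "bounded_directions {j \<in> J'. \<bar>w \<bullet> gap p j\<bar> \<le> C} (gap p) = bounded_directions J' (gap p)"
      by (rule stable[OF p(1) _ p(2)]) simp
    ultimately show ?thesis using p(1) by blast
  qed
  have "\<exists>p\<in>pairs. \<pi> -` bounded_directions J' (gap p) = UNIV"
  proof (rule ccontr)
    assume "\<not> ?thesis"
    then have "\<not> \<pi> -` U \<subseteq> (\<Union>p\<in>pairs. \<pi> -` bounded_directions J' (gap p))"
    proof (intro open_not_covered_by_proper_subspaces finite_pairs)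
      show "open (\<pi> -` U)"
        using U(1) lin by (intro open_vimage) (auto intro: linear_continuous_on simp: linear_linear)
      obtain y where "y \<in> U" "y \<bullet> u = 0" using U(2) by blast
      then have "y \<in> \<pi> -` U" by (simp add: fixed)
      then show "\<pi> -` U \<noteq> {}" by blast
      show "subspace (\<pi> -` bounded_directions J' (gap p))" for p
        by (rule linear_subspace_vimage[OF lin subspace_bounded_directions])
    qed auto
    then obtain y where "y \<in> \<pi> -` U" "y \<notin> (\<Union>p\<in>pairs. \<pi> -` bounded_directions J' (gap p))"
      unfolding subset_iff by blast
    then show False using cover[of "\<pi> y"] U(3) perp[of y] by blast
  qed
  then obtain p where p': "p \<in> pairs" "\<pi> -` bounded_directions J' (gap p) = UNIV" by blast
  then have p: "p \<in> pairs" "\<pi> y \<in> bounded_directions J' (gap p)" for y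
    unfolding vimage_def by blast+
  have st: "fst p \<in> S" "snd p \<in> S" "fst p \<noteq> snd p" using p by (auto simp: pairs_def)
  have "y \<in> bounded_directions J' (\<lambda>j. \<pi> (gap p j))" for y
    using p(2)[of y] by (simp add: bounded_directions_def adj)
  then obtain C where C: "\<And>j. j \<in> J' \<Longrightarrow> norm (\<pi> (gap p j)) \<le> C"
    using bounded_if_all_directions_bounded[of J' "\<lambda>j. \<pi> (gap p j)"] by auto
  \<comment> \<open>Small gaps are discarded to make \<open>c\<close> nonzero: for
    \<open>c = 0\<close> the gap would equal its projection, of norm at most
    \<open>C\<close>.\<close>
  define J2 where "J2 = {j \<in> J'. \<not> norm (gap p j) \<le> C}"
  have "finite {j \<in> J'. norm (gap p j) \<le> C}"
    using apart[OF st, of C] J'(1) by (rule_tac finite_subset) (auto simp: gap_def)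
  moreover have "J' = J2 \<union> {j \<in> J'. norm (gap p j) \<le> C}" by (auto simp: J2_def)
  ultimately have J2: "infinite J2" using J'(2) by (metis finite_Un)
  have "\<exists>c. c \<noteq> 0 \<and> norm (x j (fst p) - (x j (snd p) + c *\<^sub>R u)) \<le> C" if "j \<in> J2" for j
  proof -
    let ?c = "(gap p j \<bullet> u) / (u \<bullet> u)"
    have eq: "x j (fst p) - (x j (snd p) + ?c *\<^sub>R u) = \<pi> (gap p j)"
      by (simp add: \<pi>_def gap_def)
    have "norm (\<pi> (gap p j)) \<le> C" "\<not> norm (gap p j) \<le> C" using C that by (auto simp: J2_def)
    then have "?c \<noteq> 0" by (auto simp: \<pi>_def)
    then show ?thesis using eq C that by (intro exI[of _ ?c]) (auto simp: J2_def)
  qed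
  then show ?thesis
    using that[of a b "snd p" "fst p" J2 C] ab st J2 J'(1) by (auto simp: J2_def u_def)
qed

end

section \<open>Vanishing sums modulo an irreducible polynomial\<close>

lemma ties_keysE:
  assumes "w \<in> ties (real_point ` keys f)"
  obtains a b where "a \<in> keys f" "b \<in> keys f" "a \<noteq> b" "wt w a = top_wt w f" "wt w b = top_wt w f"
proof -
  obtain a b where ab: "a \<in> keys f" "b \<in> keys f" "a \<noteq> b" "\<forall>k\<in>keys f. wt w k \<le> wt w a" "wt w b = wt w a"
    using assms by (auto simp: ties_def wt_def)
  have "top_wt w f = wt w a" using ab by (intro top_wt_eqI) auto
  then show ?thesis using that[of a b] ab by simp
qed

text \<open>The polynomials free of the variable \<open>u\<^bsub>i\<^esub>\<close> meet the ideal \<open>(f, m)\<close>. If the perturbation is small,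
  a nonzero element \<open>G\<close> in the intersection has the same initial form as a multiple of \<open>f\<close>; but the
  initial form of \<open>f\<close> involves \<open>u\<^bsub>i\<^esub>\<close> and that of \<open>G\<close> does not.\<close>

lemma not_dvd_perturbation:
  fixes f m :: "int ^ 'd::finite \<Rightarrow>\<^sub>0 'a::field"
  assumes f: "irreducible f" and w: "w \<in> ties (real_point ` keys f)" and m: "\<not> f dvd m"
  shows "\<exists>C. \<forall>E. (\<forall>k\<in>keys E. wt w k \<le> - C) \<longrightarrow> \<not> f dvd m + E"
proof -
  obtain a b where ab: "a \<in> keys f" "b \<in> keys f" "a \<noteq> b" "wt w a = top_wt w f" "wt w b = top_wt w f"
    using w by (rule ties_keysE)
  \<comment> \<open>The variable to eliminate must be one in which the initial form of
    \<open>f\<close> has positive width.\<close>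
  obtain i where i: "a $ i \<noteq> b $ i" using ab(3) by (auto simp: vec_eq_iff)
  have f0: "f \<noteq> 0" using ab by auto
  have "a \<in> keys (init_form w f)" "b \<in> keys (init_form w f)" using ab by (auto simp: keys_init_form)
  then have wf: "width i (init_form w f) > 0"
    using i width_eq_0_iff[OF init_form_nonzero[OF f0], of i] by blast
  have "width i f > 0" using i ab width_eq_0_iff[OF f0, of i] by blast
  then obtain A B where G: "A * f + B * m \<noteq> 0" "width i (A * f + B * m) = 0"
    using elimination[OF f _ m] by blast
  define G where "G = A * f + B * m"
  note G = G[folded G_def]
  obtain D where D: "\<And>k. k \<in> keys B \<Longrightarrow> wt w k \<le> D"
    using wt_le_top by blast
  \<comment> \<open>Weights of \<open>B\<close> are at most \<open>D\<close>, so this bound on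
    \<open>E\<close> keeps \<open>B * E\<close> below the top weight of \<open>G\<close>; the
    summand 1 makes it strict.\<close>
  have "\<not> f dvd m + E" if E: "\<forall>k\<in>keys E. wt w k \<le> - (D - top_wt w G + 1)" for E
  proof
    assume "f dvd m + E"
    then have "f dvd A * f + B * (m + E)" by simp
    also have "A * f + B * (m + E) = G + B * E" by (simp add: G_def algebra_simps)
    finally obtain k where k: "G + B * E = f * k" by (rule dvdE)
    have BE: "wt w k < top_wt w G" if kBE: "k \<in> keys (B * E)" for k
    proof -
      obtain b e where "b \<in> keys B" "e \<in> keys E" "k = b + e" using kBE by (rule keys_timesE)
      then show ?thesis using D[of b] E by fastforce
    qed
    have same: "coef (G + B * E) k = coef G k" if "wt w k = top_wt w G" for k
      using BE[of k] that by (auto simp: lookup_add in_keys_iff)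
    obtain g where g: "g \<in> keys G" "wt w g = top_wt w G" by (rule top_wt_attained[OF G(1)])
    have top: "top_wt w (G + B * E) = top_wt w G"
    proof (rule top_wt_eqI)
      show "wt w k \<le> top_wt w G" if "k \<in> keys (G + B * E)" for k
        using that keys_add[of G "B * E"] BE[of k] wt_le_top[of k G w] by fastforce
      show "g \<in> keys (G + B * E)" using same[OF g(2)] g(1) by (simp add: in_keys_iff)
    qed (rule g)
    have init: "init_form w (G + B * E) = init_form w G"
      unfolding init_form_def top by (rule poly_mapping_eqI) (simp add: lookup_part same)
    have "k \<noteq> 0"
    proof
      assume "k = 0"
      then have "G + B * E = 0" using k by simp
      then have "coef G g = 0" using same[OF g(2)] by simp
      then show False using g by (simp add: in_keys_iff)
    qed
    then have "init_form w G = init_form w f * init_form w k"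
      using init_form_mult[OF f0, of k w] k init by simp
    then have "width i (init_form w G) = width i (init_form w f) + width i (init_form w k)"
      using f0 \<open>k \<noteq> 0\<close> by (simp add: width_mult init_form_nonzero)
    moreover have "width i (init_form w G) = 0"
      using G by (simp add: width_eq_0_iff init_form_nonzero keys_init_form)
    ultimately show False using wf by simp
  qed
  then show ?thesis by blast
qed

text \<open>Multiplying by the inverse of the monomial at \<open>n s\<close> turns the sum into
  \<open>m s + E\<close>. If all other points lay far below \<open>n s\<close> in the direction
  \<open>w\<close>, then \<open>E\<close> would be too low to create divisibility. The bound depends
  on \<open>m\<close> and \<open>w\<close>, not on the points.\<close>

lemma vanishing_sum_ties:
  fixes f :: "int ^ 'd::finite \<Rightarrow>\<^sub>0 'a::field" and m :: "'s \<Rightarrow> int ^ 'd \<Rightarrow>\<^sub>0 'a"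
  assumes f: "irreducible f" and S: "finite S" and m: "\<And>s. s \<in> S \<Longrightarrow> \<not> f dvd m s"
    and w: "w \<in> ties (real_point ` keys f)"
  shows "\<exists>C. \<forall>n. f dvd (\<Sum>s\<in>S. mterm (n s) 1 * m s) \<longrightarrow>
    (\<forall>s\<in>S. \<exists>t\<in>S. t \<noteq> s \<and> wt w (n s) - C \<le> wt w (n t))"
proof -
  have "\<forall>s\<in>S. \<exists>C. \<forall>E. (\<forall>k\<in>keys E. wt w k \<le> - C) \<longrightarrow> \<not> f dvd m s + E"
    using not_dvd_perturbation[OF f w m] by blast
  then obtain C where C: "\<And>s E. s \<in> S \<Longrightarrow> (\<forall>k\<in>keys E. wt w k \<le> - C s) \<Longrightarrow> \<not> f dvd m s + E"
    by metis
  \<comment> \<open>The absolute values give one constant that dominates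
    \<open>C s + top_wt w (m t)\<close> for all \<open>s\<close> and \<open>t\<close>.\<close>
  define D where "D = (\<Sum>s\<in>S. \<bar>C s\<bar>) + (\<Sum>s\<in>S. \<bar>top_wt w (m s)\<bar>)"
  have D: "C s + top_wt w (m t) \<le> D" if "s \<in> S" "t \<in> S" for s t
  proof -
    have "C s \<le> \<bar>C s\<bar>" "top_wt w (m t) \<le> \<bar>top_wt w (m t)\<bar>" by auto
    moreover have "\<bar>C s\<bar> \<le> (\<Sum>s\<in>S. \<bar>C s\<bar>)" "\<bar>top_wt w (m t)\<bar> \<le> (\<Sum>s\<in>S. \<bar>top_wt w (m s)\<bar>)"
      using that S by (auto intro!: member_le_sum)
    ultimately show ?thesis by (simp add: D_def)
  qed
  have "\<exists>t\<in>S. t \<noteq> s \<and> wt w (n s) - D \<le> wt w (n t)"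
    if dvd: "f dvd (\<Sum>s\<in>S. mterm (n s) 1 * m s)" and s: "s \<in> S" for n s
  proof (rule ccontr)
    assume "\<not> ?thesis"
    then have far: "wt w (n t) < wt w (n s) - D" if "t \<in> S" "t \<noteq> s" for t
      using that by force
    define E where "E = (\<Sum>t\<in>S - {s}. mterm (n t - n s) 1 * m t)"
    have "wt w k \<le> - C s" if "k \<in> keys E" for k
    proof -
      have "k \<in> (\<Union>t\<in>S - {s}. keys (mterm (n t - n s) 1 * m t))"
        using that keys_sum[of "\<lambda>t. mterm (n t - n s) 1 * m t" "S - {s}"] unfolding E_def by blast
      then obtain t where t: "t \<in> S" "t \<noteq> s" "k \<in> keys (mterm (n t - n s) 1 * m t)" by blast
      from t(3) obtain b where b: "b \<in> keys (m t)" "k = (n t - n s) + b"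
        by (auto elim!: keys_timesE split: if_splits)
      have "wt w b \<le> top_wt w (m t)" by (rule wt_le_top[OF b(1)])
      then show ?thesis using far[OF t(1,2)] D[OF s t(1)] b(2) by simp
    qed
    then have "\<not> f dvd m s + E" using C[OF s] by blast
    moreover have "m s + E = mterm (- n s) 1 * (\<Sum>s\<in>S. mterm (n s) 1 * m s)"
    proof -
      have "mterm (- n s) 1 * (mterm (n t) 1 * m t) = mterm (n t - n s) 1 * m t" for t
        by (simp add: mult.assoc[symmetric] mult_single)
      then have "mterm (- n s) 1 * (\<Sum>s\<in>S. mterm (n s) 1 * m s) = (\<Sum>t\<in>S. mterm (n t - n s) 1 * m t)"
        by (simp add: sum_distrib_left)
      also have "\<dots> = m s + E" unfolding E_def using S s by (subst sum.remove[of S s]) auto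
      finally show ?thesis by simp
    qed
    ultimately show False using dvd by simp
  qed
  then show ?thesis by blast
qed

locale vanishing_sums =
  fixes f :: "int ^ 'd::finite \<Rightarrow>\<^sub>0 'a::field" and r :: nat and n :: "nat \<Rightarrow> nat \<Rightarrow> int ^ 'd"
    and m :: "nat \<Rightarrow> int ^ 'd \<Rightarrow>\<^sub>0 'a" and J :: "nat set"
  assumes irr: "irreducible f" and apart: "moving_apart r n"
    and nontrivial: "\<exists>s<r. \<not> f dvd m s"
    and J: "infinite J" "\<And>j. j \<in> J \<Longrightarrow> f dvd (\<Sum>s<r. mterm (n j s) 1 * m s)"
begin

definition active :: "nat set" where
  "active = {s. s < r \<and> \<not> f dvd m s}"

sublocale tied_configurations "real_point ` keys f" active J "\<lambda>j s. real_point (n j s)"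
proof
  show "finite active" "active \<noteq> {}" using nontrivial by (auto simp: active_def)
  show "\<exists>C. \<forall>j\<in>J. \<forall>s\<in>active. \<exists>t\<in>active. t \<noteq> s \<and>
      w \<bullet> real_point (n j s) - C \<le> w \<bullet> real_point (n j t)" if w: "w \<in> ties (real_point ` keys f)" for w
  proof -
    have "f dvd (\<Sum>s\<in>active. mterm (n j s) 1 * m s)" if "j \<in> J" for j
    proof -
      have "(\<Sum>s\<in>active. mterm (n j s) 1 * m s) =
          (\<Sum>s<r. mterm (n j s) 1 * m s) - (\<Sum>s\<in>{..<r} - active. mterm (n j s) 1 * m s)"
        by (subst sum.subset_diff[of active "{..<r}"]) (auto simp: active_def)
      moreover have "f dvd (\<Sum>s\<in>{..<r} - active. mterm (n j s) 1 * m s)"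
        by (intro dvd_sum) (auto simp: active_def)
      ultimately show ?thesis
        using J(2)[OF that] by (simp only: dvd_diff)
    qed
    moreover have "finite active" "\<And>s. s \<in> active \<Longrightarrow> \<not> f dvd m s" by (auto simp: active_def)
    from vanishing_sum_ties[where m = m, OF irr this w]
    obtain C where "\<And>n. f dvd (\<Sum>s\<in>active. mterm (n s) 1 * m s) \<Longrightarrow>
      (\<forall>s\<in>active. \<exists>t\<in>active. t \<noteq> s \<and> wt w (n s) - C \<le> wt w (n t))" by blast
    ultimately show ?thesis unfolding wt_def by blast
  qed
  show "finite {j \<in> J. norm (real_point (n j s) - real_point (n j t)) \<le> C}"
    if "s \<in> active" "t \<in> active" "s \<noteq> t" for s t C
  proof -
    have "filterlim (\<lambda>j. real_point (n j s - n j t)) at_infinity sequentially"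
      using apart that by (auto simp: moving_apart_def active_def)
    then have "\<forall>\<^sub>F j in sequentially. \<bar>C\<bar> + 1 \<le> norm (real_point (n j s - n j t))"
      by (subst (asm) filterlim_at_infinity[of 0]) auto
    then obtain N where "\<And>j. j \<ge> N \<Longrightarrow> C < norm (real_point (n j s) - real_point (n j t))"
      unfolding eventually_sequentially real_point_diff by fastforce
    then have "{j \<in> J. norm (real_point (n j s) - real_point (n j t)) \<le> C} \<subseteq> {..<N}"
      by (auto simp: not_less[symmetric])
    then show ?thesis using finite_subset by blast
  qed
qed (use J in auto)

lemma card_vertices_newton_le: "card (vertices (convex hull (real_point ` keys f))) \<le> r"
proof -
  have "card active \<le> card {..<r}" by (intro card_mono) (auto simp: active_def)
  then show ?thesis using card_vertices_le by (simp add: vertices_def)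
qed

lemma two_keys: "\<exists>a\<in>keys f. \<exists>b\<in>keys f. a \<noteq> b"
proof (rule ccontr)
  assume *: "\<not> ?thesis"
  have "f \<noteq> 0" using irr by auto
  then obtain a where a: "a \<in> keys f" using keys_ne by blast
  have "width i f = 0" for i using * by (subst width_eq_0_iff[OF \<open>f \<noteq> 0\<close>]) metis
  then have "f dvd 1" using dvd_one_iff_width[OF \<open>f \<noteq> 0\<close>] by blast
  then show False using irr by (simp add: irreducible_def)
qed

lemma contains_parallel_redrawing_newton: "contains_parallel_redrawing r n (convex hull (real_point ` keys f))"
proof -
  let ?P = "convex hull (real_point ` keys f)" and ?x = "\<lambda>j s. real_point (n j s)"
  obtain k l where kl: "k \<in> keys f" "l \<in> keys f" "k \<noteq> l" using two_keys by blast
  have "aff_dim {real_point k, real_point l} \<le> aff_dim ?P"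
    using kl by (intro aff_dim_subset) (auto intro: hull_inc)
  then have "aff_dim ?P \<ge> 1" using kl by simp
  moreover have "polytope ?P" by (intro polytope_convex_hull) simp
  ultimately obtain e where e: "e edge_of ?P" using polytope_edge_exists by blast
  obtain a b s t J' C where *: "a \<in> e" "b \<in> e" "a \<noteq> b" "s \<in> active" "t \<in> active" "s \<noteq> t" "J' \<subseteq> J" "infinite J'"
    "\<forall>j\<in>J'. \<exists>c. c \<noteq> 0 \<and> norm (?x j t - (?x j s + c *\<^sub>R (b - a))) \<le> C"
    by (rule pair_along_edge[OF e])
  have "\<exists>p :: nat \<Rightarrow> real ^ 'd. (\<forall>u<r. dist (p u) (?x j u) \<le> C) \<and> (\<exists>Q. parallel_redrawing ?P Q \<and> vertices Q \<subseteq> p ` {..<r})"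
    if "j \<in> J'" for j
  proof -
    from bspec[OF *(9) that] obtain c where c: "c \<noteq> 0" "norm (?x j t - (?x j s + c *\<^sub>R (b - a))) \<le> C"
      by (elim exE conjE)
    let ?y = "?x j s + c *\<^sub>R (b - a)" and ?Q = "closed_segment (?x j s) (?x j s + c *\<^sub>R (b - a))"
    \<comment> \<open>A single point is moved: the one with index \<open>t\<close>, by at most
      \<open>C\<close>, onto the line through the point with index \<open>s\<close> parallel to the
      edge.\<close>
    define p where "p = (?x j)(t := ?y)"
    have "C \<ge> 0" using c(2) norm_ge_zero order_trans by blast
    then have "\<forall>u<r. dist (p u) (?x j u) \<le> C" using c(2) by (auto simp: p_def dist_norm norm_minus_commute)
    moreover have "parallel_redrawing ?P ?Q" by (rule parallel_segment[OF e *(1-3) c(1)])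
    moreover have "vertices ?Q = p ` {s, t}"
      using *(6) by (auto simp: vertices_def extreme_point_of_segment p_def)
    moreover have "{s, t} \<subseteq> {..<r}" using *(4,5) by (auto simp: active_def)
    ultimately show ?thesis by (intro exI[of _ p] conjI exI[of _ ?Q]) (auto intro: image_mono)
  qed
  then show ?thesis unfolding contains_parallel_redrawing_def using *(8) by blast
qed

end

section \<open>Mixing in terms of characters\<close>

abbreviation unity_roots :: "nat \<Rightarrow> complex set" where
  "unity_roots p \<equiv> {z. z ^ p = 1}"

lemma finite_unity_roots: "p > 0 \<Longrightarrow> finite (unity_roots p)"
  by (metis card_roots_unity_eq card_ge_0_finite)

lemma norm_unity_root: "p > 0 \<Longrightarrow> z ^ p = 1 \<Longrightarrow> norm (z :: complex) = 1"
  by (metis norm_one norm_power norm_ge_zero power_eq_1_iff zero_less_iff_neq_zero)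

text \<open>Here \<open>e x\<close> is evaluation of characters at the class of \<open>x\<close>.
  The index \<open>x\<close> runs through the ring itself, so sums of representatives need no
  passage to the quotient.\<close>

locale character_family = prob_space \<mu> for \<mu> :: "'x measure" +
  fixes p :: nat and e :: "'g::ab_group_add \<Rightarrow> 'x \<Rightarrow> complex"
  assumes p: "p > 0"
    and e_add: "\<And>x y \<phi>. \<phi> \<in> space \<mu> \<Longrightarrow> e (x + y) \<phi> = e x \<phi> * e y \<phi>"
    and e_root: "\<And>x \<phi>. \<phi> \<in> space \<mu> \<Longrightarrow> e x \<phi> ^ p = 1"
    and sets_eq: "sets \<mu> = sigma_sets (space \<mu>) {{\<phi> \<in> space \<mu>. e x \<phi> = \<zeta>} | x \<zeta>. True}"
begin

definition level :: "'g \<Rightarrow> complex \<Rightarrow> 'x set" where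
  "level x \<zeta> = {\<phi> \<in> space \<mu>. e x \<phi> = \<zeta>}"

lemma level_sets [measurable]: "level x \<zeta> \<in> sets \<mu>"
  unfolding sets_eq level_def by (intro sigma_sets.Basic) blast

lemma e_zero: "\<phi> \<in> space \<mu> \<Longrightarrow> e 0 \<phi> = 1"
  using e_add[of \<phi> 0 0] e_root[of \<phi> 0] p by (auto simp: power_0_left)

lemma e_sum: "finite S \<Longrightarrow> \<phi> \<in> space \<mu> \<Longrightarrow> e (\<Sum>s\<in>S. y s) \<phi> = (\<Prod>s\<in>S. e (y s) \<phi>)"
  by (induction S rule: finite_induct) (simp_all add: e_zero e_add)

lemma e_decomp: "\<phi> \<in> space \<mu> \<Longrightarrow> e x \<phi> = (\<Sum>\<zeta>\<in>unity_roots p. \<zeta> * of_real (indicator (level x \<zeta>) \<phi>))"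
proof -
  assume \<phi>: "\<phi> \<in> space \<mu>"
  have "(\<Sum>\<zeta>\<in>unity_roots p. \<zeta> * of_real (indicator (level x \<zeta>) \<phi>)) =
      (\<Sum>\<zeta>\<in>unity_roots p. if \<zeta> = e x \<phi> then \<zeta> else 0)"
    using \<phi> by (intro sum.cong) (auto simp: level_def indicator_def)
  also have "\<dots> = e x \<phi>" using e_root[OF \<phi>, of x] finite_unity_roots[OF p] by simp
  finally show ?thesis by simp
qed

lemma e_measurable [measurable]: "e x \<in> borel_measurable \<mu>"
proof (subst measurable_cong)
  show "e x \<phi> = (\<Sum>\<zeta>\<in>unity_roots p. \<zeta> * of_real (indicator (level x \<zeta>) \<phi>))" if "\<phi> \<in> space \<mu>" for \<phi>
    by (rule e_decomp[OF that])
qed measurable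

lemma e_integrable: "integrable \<mu> (e x)"
  by (rule integrable_const_bound[of _ 1])
    (auto intro!: AE_I2 simp: norm_unity_root[OF p e_root])

lemma integral_indicator_complex:
  "A \<in> sets \<mu> \<Longrightarrow> (\<integral>\<phi>. complex_of_real (indicator A \<phi>) \<partial>\<mu>) = of_real (measure \<mu> A)"
  unfolding integral_complex_of_real by (simp add: Int_absorb2 sets.sets_into_space)

lemma integral_e_levels: "(\<integral>\<phi>. e x \<phi> \<partial>\<mu>) = (\<Sum>\<zeta>\<in>unity_roots p. \<zeta> * of_real (measure \<mu> (level x \<zeta>)))"
proof -
  have "(\<integral>\<phi>. e x \<phi> \<partial>\<mu>) = (\<integral>\<phi>. (\<Sum>\<zeta>\<in>unity_roots p. \<zeta> * of_real (indicator (level x \<zeta>) \<phi>)) \<partial>\<mu>)"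
    by (intro Bochner_Integration.integral_cong refl e_decomp)
  also have "\<dots> = (\<Sum>\<zeta>\<in>unity_roots p. \<zeta> * of_real (measure \<mu> (level x \<zeta>)))"
    by (subst Bochner_Integration.integral_sum)
      (auto intro!: integrable_mult_right integrable_of_real integrable_real_indicator simp: less_top[symmetric])
  finally show ?thesis .
qed

text \<open>Multiplication by \<open>\<omega>\<close> permutes the roots of unity and preserves the
  masses of the levels, so the integral equals \<open>\<omega>\<close> times itself.\<close>

lemma integral_e_eq_0:
  assumes \<omega>: "\<omega> ^ p = 1" "\<omega> \<noteq> 1" and inv: "\<And>\<zeta>. measure \<mu> (level x (\<omega> * \<zeta>)) = measure \<mu> (level x \<zeta>)"
  shows "(\<integral>\<phi>. e x \<phi> \<partial>\<mu>) = 0"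
proof -
  have \<omega>0: "\<omega> \<noteq> 0" using \<omega> p by (auto simp: power_0_left)
  have "bij_betw (\<lambda>\<zeta>. \<omega> * \<zeta>) (unity_roots p) (unity_roots p)"
    by (rule bij_betw_byWitness[where f' = "\<lambda>\<zeta>. \<zeta> / \<omega>"])
      (use \<omega> \<omega>0 in \<open>auto simp: power_mult_distrib power_divide\<close>)
  then have "(\<Sum>\<zeta>\<in>unity_roots p. \<zeta> * complex_of_real (measure \<mu> (level x \<zeta>))) =
      (\<Sum>\<zeta>\<in>unity_roots p. (\<omega> * \<zeta>) * of_real (measure \<mu> (level x (\<omega> * \<zeta>))))"
    by (rule sum.reindex_bij_betw[symmetric])
  also have "\<dots> = \<omega> * (\<Sum>\<zeta>\<in>unity_roots p. \<zeta> * of_real (measure \<mu> (level x \<zeta>)))"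
    by (simp add: inv sum_distrib_left mult.assoc)
  finally have "(\<integral>\<phi>. e x \<phi> \<partial>\<mu>) = \<omega> * (\<integral>\<phi>. e x \<phi> \<partial>\<mu>)" by (simp only: integral_e_levels)
  then show ?thesis using \<omega>(2) by simp
qed

end

locale character_measure = character_family \<mu> p e
  for \<mu> :: "'x measure" and p :: nat and e :: "'g::ab_group_add \<Rightarrow> 'x \<Rightarrow> complex" +
  fixes I :: "'g set"
  assumes e_triv: "\<And>x \<phi>. x \<in> I \<Longrightarrow> \<phi> \<in> space \<mu> \<Longrightarrow> e x \<phi> = 1"
    and e_int: "\<And>x. x \<notin> I \<Longrightarrow> (\<integral>\<phi>. e x \<phi> \<partial>\<mu>) = 0"
begin

lemma integral_e: "(\<integral>\<phi>. e x \<phi> \<partial>\<mu>) = (if x \<in> I then 1 else 0)"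
proof (cases "x \<in> I")
  case True
  have "(\<integral>\<phi>. e x \<phi> \<partial>\<mu>) = (\<integral>\<phi>. 1 \<partial>\<mu>)"
    by (intro Bochner_Integration.integral_cong) (auto simp: e_triv[OF True])
  then show ?thesis using True by (simp add: prob_space)
qed (simp add: e_int)

section \<open>Trigonometric polynomials and approximation of measurable sets\<close>

definition trig :: "('x \<Rightarrow> complex) \<Rightarrow> bool" where
  "trig F \<longleftrightarrow> (\<exists>V c. finite V \<and> (\<forall>\<phi>\<in>space \<mu>. F \<phi> = (\<Sum>x\<in>V. c x * e x \<phi>)))"

text \<open>The given expansion may list a character several times, as sums and products do; equal
  ones are collected.\<close>

lemma trigI:
  assumes "finite P" "\<And>\<phi>. \<phi> \<in> space \<mu> \<Longrightarrow> F \<phi> = (\<Sum>q\<in>P. c q * e (x q) \<phi>)"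
  shows "trig F"
proof -
  have "F \<phi> = (\<Sum>y\<in>x ` P. (\<Sum>q\<in>{q \<in> P. x q = y}. c q) * e y \<phi>)" if "\<phi> \<in> space \<mu>" for \<phi>
  proof -
    have "F \<phi> = (\<Sum>y\<in>x ` P. \<Sum>q\<in>{q \<in> P. x q = y}. c q * e (x q) \<phi>)"
      unfolding assms(2)[OF that] by (rule sum.image_gen[OF assms(1)])
    also have "\<dots> = (\<Sum>y\<in>x ` P. (\<Sum>q\<in>{q \<in> P. x q = y}. c q) * e y \<phi>)"
      unfolding sum_distrib_right by (intro sum.cong) auto
    finally show ?thesis .
  qed
  then show ?thesis unfolding trig_def using assms(1) by (intro exI[of _ "x ` P"] exI) auto
qed

lemma trig_const: "trig (\<lambda>_. a)"
  by (rule trigI[of "{()}" _ "\<lambda>_. a" "\<lambda>_. 0"]) (auto simp: e_zero)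

lemma trig_diff:
  assumes "trig F" "trig G"
  shows "trig (\<lambda>\<phi>. F \<phi> - G \<phi>)"
proof -
  obtain V c W d where V: "finite V" "finite W"
    "\<And>\<phi>. \<phi> \<in> space \<mu> \<Longrightarrow> F \<phi> = (\<Sum>x\<in>V. c x * e x \<phi>)" "\<And>\<phi>. \<phi> \<in> space \<mu> \<Longrightarrow> G \<phi> = (\<Sum>x\<in>W. d x * e x \<phi>)"
    using assms unfolding trig_def by metis
  show ?thesis
    by (rule trigI[of "V <+> W" _ "case_sum c (\<lambda>x. - d x)" "case_sum id id"])
      (auto simp: V sum.Plus sum_negf)
qed

lemma trig_mult:
  assumes "trig F" "trig G"
  shows "trig (\<lambda>\<phi>. F \<phi> * G \<phi>)"
proof -
  obtain V c W d where V: "finite V" "finite W"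
    "\<And>\<phi>. \<phi> \<in> space \<mu> \<Longrightarrow> F \<phi> = (\<Sum>x\<in>V. c x * e x \<phi>)" "\<And>\<phi>. \<phi> \<in> space \<mu> \<Longrightarrow> G \<phi> = (\<Sum>x\<in>W. d x * e x \<phi>)"
    using assms unfolding trig_def by metis
  show ?thesis
    by (rule trigI[of "V \<times> W" _ "\<lambda>(x, y). c x * d y" "\<lambda>(x, y). x + y"])
      (auto simp: V sum_product sum.cartesian_product e_add split_def intro!: sum.cong)
qed

definition trig_sets :: "'x set set" where
  "trig_sets = {A. A \<subseteq> space \<mu> \<and> trig (\<lambda>\<phi>. of_real (indicator A \<phi>))}"

lemma trig_cong: "trig F \<Longrightarrow> (\<And>\<phi>. \<phi> \<in> space \<mu> \<Longrightarrow> F \<phi> = G \<phi>) \<Longrightarrow> trig G"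
  unfolding trig_def by simp

lemma trig_sets_Diff_space: "A \<in> trig_sets \<Longrightarrow> space \<mu> - A \<in> trig_sets"
  using trig_cong[OF trig_diff[OF trig_const[of 1], of "\<lambda>\<phi>. of_real (indicator A \<phi>)"]]
  by (auto simp: trig_sets_def indicator_def)

lemma trig_sets_Int: "A \<in> trig_sets \<Longrightarrow> B \<in> trig_sets \<Longrightarrow> A \<inter> B \<in> trig_sets"
  using trig_mult[of "\<lambda>\<phi>. of_real (indicator A \<phi>)" "\<lambda>\<phi>. of_real (indicator B \<phi>)"]
  by (auto simp: trig_sets_def indicator_inter_arith)

lemma trig_sets_space: "space \<mu> \<in> trig_sets"
  using trig_cong[OF trig_const[of 1]] by (auto simp: trig_sets_def indicator_def)

lemma trig_sets_empty: "{} \<in> trig_sets"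
  using trig_sets_Diff_space[OF trig_sets_space] by simp

lemma trig_sets_Un: "A \<in> trig_sets \<Longrightarrow> B \<in> trig_sets \<Longrightarrow> A \<union> B \<in> trig_sets"
proof -
  assume "A \<in> trig_sets" "B \<in> trig_sets"
  moreover from this have "A \<union> B = space \<mu> - ((space \<mu> - A) \<inter> (space \<mu> - B))"
    by (auto simp: trig_sets_def)
  ultimately show ?thesis by (metis trig_sets_Diff_space trig_sets_Int)
qed

text \<open>Finite Fourier inversion: the mean of the powers \<open>(z / \<zeta>) ^ k\<close> for
  \<open>k < p\<close> is 1 if \<open>z = \<zeta>\<close> and 0 for any other root of unity
  \<open>z\<close>.\<close>

lemma level_trig: "level x \<zeta> \<in> trig_sets"
proof (cases "\<zeta> ^ p = 1")
  case False
  then have "level x \<zeta> = {}" using e_root by (auto simp: level_def)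
  then show ?thesis by (simp add: trig_sets_empty)
next
  case True
  define kx where "kx k = (((+) x) ^^ k) 0" for k
  have ek: "e (kx k) \<phi> = e x \<phi> ^ k" if "\<phi> \<in> space \<mu>" for k \<phi>
    by (induction k) (simp_all add: kx_def e_zero e_add that)
  have z0: "\<zeta> \<noteq> 0" using True p by (auto simp: power_0_left)
  have "trig (\<lambda>\<phi>. of_real (indicator (level x \<zeta>) \<phi>))"
  proof (rule trigI[of "{..<p}" _ "\<lambda>k. 1 / (of_nat p * \<zeta> ^ k)" kx])
    fix \<phi> assume \<phi>: "\<phi> \<in> space \<mu>"
    have "(\<Sum>k<p. 1 / (of_nat p * \<zeta> ^ k) * e (kx k) \<phi>) = (\<Sum>k<p. (e x \<phi> / \<zeta>) ^ k) / of_nat p"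
      unfolding sum_divide_distrib by (intro sum.cong) (auto simp: ek[OF \<phi>] power_divide)
    also have "\<dots> = of_real (indicator (level x \<zeta>) \<phi>)"
    proof (cases "e x \<phi> = \<zeta>")
      case True
      then show ?thesis using \<phi> p z0 by (simp add: level_def)
    next
      case False
      then have "e x \<phi> / \<zeta> \<noteq> 1" using z0 by simp
      moreover have "(e x \<phi> / \<zeta>) ^ p = 1" using e_root[OF \<phi>, of x] True by (simp add: power_divide)
      ultimately have "(\<Sum>k<p. (e x \<phi> / \<zeta>) ^ k) = 0" by (simp add: geometric_sum)
      then show ?thesis using False by (simp add: level_def)
    qed
    finally show "complex_of_real (indicator (level x \<zeta>) \<phi>) = (\<Sum>k<p. 1 / (of_nat p * \<zeta> ^ k) * e (kx k) \<phi>)" by simp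
  qed simp
  then show ?thesis by (auto simp: trig_sets_def level_def)
qed

lemma trig_measurable: "trig F \<Longrightarrow> F \<in> borel_measurable \<mu>"
proof -
  assume "trig F"
  then obtain V c where V: "\<And>\<phi>. \<phi> \<in> space \<mu> \<Longrightarrow> F \<phi> = (\<Sum>x\<in>V. c x * e x \<phi>)"
    unfolding trig_def by metis
  show ?thesis by (subst measurable_cong[OF V]) measurable
qed

lemma trig_sets_measurable: "A \<in> trig_sets \<Longrightarrow> A \<in> sets \<mu>"
proof -
  assume A: "A \<in> trig_sets"
  then have "(\<lambda>\<phi>. complex_of_real (indicator A \<phi>)) \<in> borel_measurable \<mu>"
    by (auto simp: trig_sets_def intro: trig_measurable)
  then have "(\<lambda>\<phi>. complex_of_real (indicator A \<phi>)) -` {1} \<inter> space \<mu> \<in> sets \<mu>"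
    by (rule measurable_sets) simp
  moreover have "(\<lambda>\<phi>. complex_of_real (indicator A \<phi>)) -` {1} \<inter> space \<mu> = A"
    using A by (auto simp: trig_sets_def indicator_def split: if_splits)
  ultimately show ?thesis by simp
qed

lemma sets_eq_trig: "sets \<mu> = sigma_sets (space \<mu>) trig_sets"
proof
  have "{{\<phi> \<in> space \<mu>. e x \<phi> = \<zeta>} | x \<zeta>. True} \<subseteq> trig_sets"
    using level_trig by (auto simp: level_def)
  then show "sets \<mu> \<subseteq> sigma_sets (space \<mu>) trig_sets"
    unfolding sets_eq by (rule sigma_sets_mono')
  show "sigma_sets (space \<mu>) trig_sets \<subseteq> sets \<mu>"
    using trig_sets_measurable by (intro sets.sigma_sets_subset) auto
qed

lemma measure_trig:
  assumes "A \<in> sets \<mu>" "finite V" "\<And>\<phi>. \<phi> \<in> space \<mu> \<Longrightarrow> of_real (indicator A \<phi>) = (\<Sum>x\<in>V. c x * e x \<phi>)"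
  shows "of_real (measure \<mu> A) = (\<Sum>x\<in>V. if x \<in> I then c x else 0)"
proof -
  have "complex_of_real (measure \<mu> A) = (\<integral>\<phi>. of_real (indicator A \<phi>) \<partial>\<mu>)"
    by (rule integral_indicator_complex[OF assms(1), symmetric])
  also have "\<dots> = (\<integral>\<phi>. (\<Sum>x\<in>V. c x * e x \<phi>) \<partial>\<mu>)"
    by (intro Bochner_Integration.integral_cong refl assms(3))
  also have "\<dots> = (\<Sum>x\<in>V. c x * (\<integral>\<phi>. e x \<phi> \<partial>\<mu>))"
    by (simp add: e_integrable)
  also have "\<dots> = (\<Sum>x\<in>V. if x \<in> I then c x else 0)"
    by (intro sum.cong) (auto simp: integral_e)
  finally show ?thesis .
qed

lemma abs_measure_diff_le:
  assumes "A \<in> sets \<mu>" "B \<in> sets \<mu>"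
  shows "\<bar>measure \<mu> A - measure \<mu> B\<bar> \<le> measure \<mu> (sym_diff A B)"
proof -
  have "measure \<mu> A \<le> measure \<mu> (B \<union> sym_diff A B)" "measure \<mu> B \<le> measure \<mu> (A \<union> sym_diff A B)"
    using assms by (auto intro!: finite_measure_mono)
  moreover have "measure \<mu> (B \<union> sym_diff A B) \<le> measure \<mu> B + measure \<mu> (sym_diff A B)"
    "measure \<mu> (A \<union> sym_diff A B) \<le> measure \<mu> A + measure \<mu> (sym_diff A B)"
    using assms by (auto intro!: measure_Un_le)
  ultimately show ?thesis by linarith
qed

text \<open>The approximable sets form a sigma-algebra: complements keep the symmetric difference,
  and a countable union is truncated to a finite one.\<close>

lemma trig_approximation:
  assumes "A \<in> sets \<mu>" "\<epsilon> > 0"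
  shows "\<exists>B\<in>trig_sets. measure \<mu> (sym_diff A B) < \<epsilon>"
proof -
  have "A \<in> sigma_sets (space \<mu>) trig_sets" using assms(1) sets_eq_trig by simp
  then show ?thesis using assms(2)
  proof (induction arbitrary: \<epsilon> rule: sigma_sets.induct)
    case (Basic A)
    then show ?case by (intro bexI[of _ A]) auto
  next
    case Empty
    then show ?case using trig_sets_empty by (intro bexI[of _ "{}"]) auto
  next
    case (Compl A)
    then obtain B where B: "B \<in> trig_sets" "measure \<mu> (sym_diff A B) < \<epsilon>" by blast
    have "A \<subseteq> space \<mu>" "B \<subseteq> space \<mu>"
      using Compl.hyps B sets.sets_into_space unfolding sets_eq_trig[symmetric] by (auto simp: trig_sets_def)
    then have "sym_diff (space \<mu> - A) (space \<mu> - B) = sym_diff A B" by auto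
    then show ?case using B trig_sets_Diff_space by metis
  next
    case (Union A)
    have Am: "A i \<in> sets \<mu>" for i using Union.hyps by (simp add: sets_eq_trig)
    define S where "S N = (\<Union>i<N. A i)" for N :: nat
    have "(\<lambda>N. measure \<mu> (S N)) \<longlonglongrightarrow> measure \<mu> (\<Union>N. S N)"
    proof (rule finite_Lim_measure_incseq)
      show "incseq S" unfolding S_def incseq_def by (intro allI impI UN_mono) auto
    qed (use Am in \<open>auto simp: S_def\<close>)
    moreover have "(\<Union>N. S N) = (\<Union>i. A i)" by (auto simp: S_def)
    ultimately have "(\<lambda>N. measure \<mu> (S N)) \<longlonglongrightarrow> measure \<mu> (\<Union>i. A i)" by simp
    then have "\<forall>\<^sub>F N in sequentially. dist (measure \<mu> (S N)) (measure \<mu> (\<Union>i. A i)) < \<epsilon> / 2"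
      using Union.prems by (intro tendstoD) auto
    then obtain N where N: "\<bar>measure \<mu> (S N) - measure \<mu> (\<Union>i. A i)\<bar> < \<epsilon> / 2"
      by (auto simp: eventually_sequentially dist_real_def)
    \<comment> \<open>Half of \<open>\<epsilon>\<close> pays for the truncation, the other half for
      \<open>N\<close> sets; \<open>N + 1\<close> avoids division by zero.\<close>
    have "\<forall>i. \<exists>B\<in>trig_sets. measure \<mu> (sym_diff (A i) B) < \<epsilon> / (2 * (real N + 1))"
      using Union.IH[of "\<epsilon> / (2 * (real N + 1))"] Union.prems by simp
    then obtain B where B: "\<And>i. B i \<in> trig_sets" "\<And>i. measure \<mu> (sym_diff (A i) (B i)) < \<epsilon> / (2 * (real N + 1))"
      by metis
    have Bm: "B i \<in> sets \<mu>" for i using B(1) by (rule trig_sets_measurable)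
    have BU: "(\<Union>i<k. B i) \<in> trig_sets" for k :: nat
      by (induction k) (auto simp: lessThan_Suc trig_sets_empty intro: trig_sets_Un B)
    have "measure \<mu> (sym_diff (\<Union>i. A i) (\<Union>i<N. B i)) \<le> measure \<mu> (((\<Union>i. A i) - S N) \<union> (\<Union>i<N. sym_diff (A i) (B i)))"
      using Am Bm by (intro finite_measure_mono) (auto simp: S_def)
    also have "\<dots> \<le> measure \<mu> ((\<Union>i. A i) - S N) + measure \<mu> (\<Union>i<N. sym_diff (A i) (B i))"
      using Am Bm by (intro measure_Un_le) (auto simp: S_def)
    also have "measure \<mu> ((\<Union>i. A i) - S N) = measure \<mu> (\<Union>i. A i) - measure \<mu> (S N)"
      using Am by (intro finite_measure_Diff) (auto simp: S_def)
    also have "measure \<mu> (\<Union>i<N. sym_diff (A i) (B i)) \<le> (\<Sum>i<N. measure \<mu> (sym_diff (A i) (B i)))"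
      using Am Bm by (intro finite_measure_subadditive_finite) auto
    also have "\<dots> \<le> (\<Sum>i<N. \<epsilon> / (2 * (real N + 1)))"
      using B(2) by (intro sum_mono less_imp_le)
    also have "\<dots> \<le> \<epsilon> / 2" using Union.prems by (simp add: field_simps)
    finally have "measure \<mu> (sym_diff (\<Union>i. A i) (\<Union>i<N. B i)) < \<epsilon>" using N by linarith
    then show ?case using BU by blast
  qed
qed

text \<open>If one level carried all the mass, the integral of the character would be a root of
  unity and not 0.\<close>

lemma two_levels:
  assumes "x \<notin> I"
  obtains \<zeta> \<xi> where "\<zeta> \<noteq> \<xi>" "measure \<mu> (level x \<zeta>) > 0" "measure \<mu> (level x \<xi>) > 0"
proof -
  have int: "(\<Sum>\<zeta>\<in>unity_roots p. \<zeta> * of_real (measure \<mu> (level x \<zeta>))) = (0 :: complex)"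
    using e_int[OF assms] by (simp only: integral_e_levels)
  have one: "(\<Sum>\<zeta>\<in>unity_roots p. measure \<mu> (level x \<zeta>)) = 1"
  proof -
    have "measure \<mu> (\<Union>\<zeta>\<in>unity_roots p. level x \<zeta>) = (\<Sum>\<zeta>\<in>unity_roots p. measure \<mu> (level x \<zeta>))"
      using finite_unity_roots[OF p] by (intro finite_measure_finite_Union) (auto simp: disjoint_family_on_def level_def)
    moreover have "(\<Union>\<zeta>\<in>unity_roots p. level x \<zeta>) = space \<mu>" using e_root by (auto simp: level_def)
    ultimately show ?thesis by (simp add: prob_space)
  qed
  then obtain \<zeta> where \<zeta>: "\<zeta> \<in> unity_roots p" "measure \<mu> (level x \<zeta>) \<noteq> 0"
    by (metis (no_types, lifting) sum.neutral zero_neq_one)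
  have "\<exists>\<xi>\<in>unity_roots p - {\<zeta>}. measure \<mu> (level x \<xi>) \<noteq> 0"
  proof (rule ccontr)
    assume "\<not> ?thesis"
    then have "(\<Sum>\<zeta>\<in>unity_roots p. \<zeta> * of_real (measure \<mu> (level x \<zeta>))) =
        (\<Sum>\<xi>\<in>{\<zeta>}. \<xi> * complex_of_real (measure \<mu> (level x \<xi>)))"
      using \<zeta>(1) finite_unity_roots[OF p] by (intro sum.mono_neutral_right) auto
    then have "\<zeta> = 0" using int \<zeta>(2) by simp
    then show False using \<zeta>(1) p by (auto simp: power_0_left)
  qed
  then obtain \<xi> where "\<xi> \<noteq> \<zeta>" "measure \<mu> (level x \<xi>) \<noteq> 0" by blast
  then show ?thesis using that[of \<zeta> \<xi>] \<zeta>(2) by (simp add: zero_less_measure_iff)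
qed

end

section \<open>The dual action, and mixing as absence of relations\<close>

locale character_action = character_measure \<mu> p e I
  for \<mu> :: "'x measure" and p :: nat and e :: "'g::ab_group_add \<Rightarrow> 'x \<Rightarrow> complex" and I :: "'g set" +
  fixes T :: "'n \<Rightarrow> 'x \<Rightarrow> 'x" and act :: "'n \<Rightarrow> 'g \<Rightarrow> 'g"
  assumes T_space: "\<And>n \<phi>. \<phi> \<in> space \<mu> \<Longrightarrow> T n \<phi> \<in> space \<mu>"
    and e_T: "\<And>n x \<phi>. \<phi> \<in> space \<mu> \<Longrightarrow> e x (T n \<phi>) = e (act n x) \<phi>"
    and act_I: "\<And>n x. act n x \<in> I \<longleftrightarrow> x \<in> I"
begin

lemma T_measurable [measurable]: "T n \<in> measurable \<mu> \<mu>"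
proof (rule measurable_sigma_sets[OF sets_eq])
  show "T n \<in> space \<mu> \<rightarrow> space \<mu>" using T_space by auto
  fix A assume "A \<in> {{\<phi> \<in> space \<mu>. e x \<phi> = \<zeta>} | x \<zeta>. True}"
  then obtain x \<zeta> where "A = {\<phi> \<in> space \<mu>. e x \<phi> = \<zeta>}" by blast
  then have "T n -` A \<inter> space \<mu> = level (act n x) \<zeta>" by (auto simp: level_def T_space e_T)
  then show "T n -` A \<inter> space \<mu> \<in> sets \<mu>" by simp
qed auto

text \<open>The family \<open>trig_sets\<close> is a generator closed under intersection. On it the
  measure depends on which characters lie in \<open>I\<close>, and \<open>act\<close> preserves
  membership in \<open>I\<close>.\<close>

lemma measure_T:
  assumes "A \<in> sets \<mu>"
  shows "measure \<mu> (T n -` A \<inter> space \<mu>) = measure \<mu> A"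
proof -
  have "distr \<mu> \<mu> (T n) = \<mu>"
  proof (rule measure_eqI_generator_eq[where E = trig_sets and \<Omega> = "space \<mu>" and A = "\<lambda>_. space \<mu>"])
    show "Int_stable trig_sets" by (auto simp: Int_stable_def trig_sets_Int)
    show "trig_sets \<subseteq> Pow (space \<mu>)" by (auto simp: trig_sets_def)
    fix B assume B: "B \<in> trig_sets"
    then obtain V c where V: "finite V" "\<And>\<phi>. \<phi> \<in> space \<mu> \<Longrightarrow> complex_of_real (indicator B \<phi>) = (\<Sum>x\<in>V. c x * e x \<phi>)"
      unfolding trig_sets_def trig_def by blast
    have Bm: "B \<in> sets \<mu>" using B by (rule trig_sets_measurable)
    have TB: "T n -` B \<inter> space \<mu> \<in> sets \<mu>" using T_measurable Bm by (rule measurable_sets)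
    have "complex_of_real (measure \<mu> (T n -` B \<inter> space \<mu>)) = (\<integral>\<phi>. of_real (indicator (T n -` B \<inter> space \<mu>) \<phi>) \<partial>\<mu>)"
      by (rule integral_indicator_complex[OF TB, symmetric])
    also have "\<dots> = (\<integral>\<phi>. (\<Sum>x\<in>V. c x * e (act n x) \<phi>) \<partial>\<mu>)"
    proof (intro Bochner_Integration.integral_cong refl)
      fix \<phi> assume \<phi>: "\<phi> \<in> space \<mu>"
      have "complex_of_real (indicator (T n -` B \<inter> space \<mu>) \<phi>) = of_real (indicator B (T n \<phi>))"
        using \<phi> by (simp add: indicator_def)
      also have "\<dots> = (\<Sum>x\<in>V. c x * e (act n x) \<phi>)" using V(2)[OF T_space[OF \<phi>]] by (simp add: e_T[OF \<phi>])
      finally show "complex_of_real (indicator (T n -` B \<inter> space \<mu>) \<phi>) = (\<Sum>x\<in>V. c x * e (act n x) \<phi>)" .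
    qed
    also have "\<dots> = (\<Sum>x\<in>V. c x * (\<integral>\<phi>. e (act n x) \<phi> \<partial>\<mu>))" by (simp add: e_integrable)
    also have "\<dots> = (\<Sum>x\<in>V. if x \<in> I then c x else 0)" by (intro sum.cong) (auto simp: integral_e act_I)
    also have "\<dots> = of_real (measure \<mu> B)" by (rule measure_trig[OF Bm V, symmetric])
    finally have "measure \<mu> (T n -` B \<inter> space \<mu>) = measure \<mu> B" by (simp only: of_real_eq_iff)
    then show "emeasure (distr \<mu> \<mu> (T n)) B = emeasure \<mu> B"
      using Bm by (simp add: emeasure_distr emeasure_eq_measure)
  qed (auto simp: sets_eq_trig[symmetric] trig_sets_space emeasure_space_1 emeasure_distr T_space)
  then have "measure (distr \<mu> \<mu> (T n)) A = measure \<mu> A" by simp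
  then show ?thesis using assms by (simp add: measure_distr)
qed

lemma joint_event_measurable:
  fixes r :: nat
  assumes "\<And>s. s < r \<Longrightarrow> A s \<in> sets \<mu>"
  shows "{\<phi> \<in> space \<mu>. \<forall>s<r. T (n s) \<phi> \<in> A s} \<in> sets \<mu>"
proof (cases "r = 0")
  case False
  have "{\<phi> \<in> space \<mu>. \<forall>s\<in>{..<r}. T (n s) \<phi> \<in> A s} \<in> sets \<mu>"
  proof (rule sets.sets_Collect_finite_All')
    show "{\<phi> \<in> space \<mu>. T (n s) \<phi> \<in> A s} \<in> sets \<mu>" if "s \<in> {..<r}" for s
    proof -
      have "A s \<in> sets \<mu>" using that by (intro assms) simp
      then have "T (n s) -` A s \<inter> space \<mu> \<in> sets \<mu>" by (rule measurable_sets[OF T_measurable])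
      moreover have "T (n s) -` A s \<inter> space \<mu> = {\<phi> \<in> space \<mu>. T (n s) \<phi> \<in> A s}" by blast
      ultimately show ?thesis by (simp only:)
    qed
  qed (use False in auto)
  then show ?thesis by (simp only: Ball_def lessThan_iff)
qed simp

text \<open>Expanding the indicators of sets in \<open>trig_sets\<close> into characters shows that they are exactly independent
  for large \<open>j\<close>.\<close>

lemma eventually_independent:
  assumes ev: "\<And>y :: nat \<Rightarrow> 'g. (\<exists>s<r. y s \<notin> I) \<Longrightarrow> \<forall>\<^sub>F j in sequentially. (\<Sum>s<r. act (n j s) (y s)) \<notin> I"
    and B: "\<And>s. s < r \<Longrightarrow> B s \<in> trig_sets"
  shows "\<forall>\<^sub>F j in sequentially. measure \<mu> {\<phi> \<in> space \<mu>. \<forall>s<r. T (n j s) \<phi> \<in> B s} = (\<Prod>s<r. measure \<mu> (B s))"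
proof -
  have "\<forall>s. \<exists>V c. s < r \<longrightarrow> finite V \<and> (\<forall>\<phi>\<in>space \<mu>. complex_of_real (indicator (B s) \<phi>) = (\<Sum>x\<in>V. c x * e x \<phi>))"
    using B unfolding trig_sets_def trig_def by blast
  then obtain V c where V: "\<And>s. s < r \<Longrightarrow> finite (V s)"
    "\<And>s \<phi>. s < r \<Longrightarrow> \<phi> \<in> space \<mu> \<Longrightarrow> complex_of_real (indicator (B s) \<phi>) = (\<Sum>x\<in>V s. c s x * e x \<phi>)"
    by metis
  \<comment> \<open>Multiplying out the expansions gives one term for each choice of a character per
    factor. These choices are finite in number, so one threshold for \<open>j\<close> serves them
    all.\<close>
  define G where "G = PiE {..<r} V"
  have fG: "finite G" unfolding G_def using V by (intro finite_PiE) auto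
  have "\<forall>\<^sub>F j in sequentially. (\<exists>s<r. g s \<notin> I) \<longrightarrow> (\<Sum>s<r. act (n j s) (g s)) \<notin> I" for g
    using ev[of g] by (cases "\<exists>s<r. g s \<notin> I") auto
  then have "\<forall>\<^sub>F j in sequentially. \<forall>g\<in>G. (\<exists>s<r. g s \<notin> I) \<longrightarrow> (\<Sum>s<r. act (n j s) (g s)) \<notin> I"
    using fG by (simp add: eventually_ball_finite)
  then show ?thesis
  proof (rule eventually_mono)
    fix j assume j: "\<forall>g\<in>G. (\<exists>s<r. g s \<notin> I) \<longrightarrow> (\<Sum>s<r. act (n j s) (g s)) \<notin> I"
    let ?E = "{\<phi> \<in> space \<mu>. \<forall>s<r. T (n j s) \<phi> \<in> B s}"
    have Bm: "B s \<in> sets \<mu>" if "s < r" for s using B[OF that] by (rule trig_sets_measurable)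
    have E: "?E \<in> sets \<mu>" by (rule joint_event_measurable[OF Bm])
    \<comment> \<open>Both sides are 1 if all \<open>g s\<close> lie in \<open>I\<close> and 0
      otherwise; this is where independence arises.\<close>
    have split: "(\<integral>\<phi>. (\<Prod>s<r. e (g s) (T (n j s) \<phi>)) \<partial>\<mu>) = (\<Prod>s<r. if g s \<in> I then 1 else 0)" if g: "g \<in> G" for g
    proof -
      have eq: "(\<Prod>s<r. e (g s) (T (n j s) \<phi>)) = e (\<Sum>s<r. act (n j s) (g s)) \<phi>" if "\<phi> \<in> space \<mu>" for \<phi>
        using that by (simp add: e_T e_sum)
      show ?thesis
      proof (cases "\<exists>s<r. g s \<notin> I")
        case True
        then have "(\<Sum>s<r. act (n j s) (g s)) \<notin> I" using j g by blast
        then have "(\<integral>\<phi>. (\<Prod>s<r. e (g s) (T (n j s) \<phi>)) \<partial>\<mu>) = 0"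
          using e_int by (subst Bochner_Integration.integral_cong[OF refl eq]) auto
        moreover have "(\<Prod>s<r. if g s \<in> I then 1 else 0 :: complex) = 0" using True by (intro prod_zero) auto
        ultimately show ?thesis by simp
      next
        case False
        then have "(\<integral>\<phi>. (\<Prod>s<r. e (g s) (T (n j s) \<phi>)) \<partial>\<mu>) = (\<integral>\<phi>. 1 \<partial>\<mu>)"
          by (intro Bochner_Integration.integral_cong refl) (auto simp: e_triv T_space intro!: prod.neutral)
        then show ?thesis using False by (simp add: prob_space)
      qed
    qed
    have int: "integrable \<mu> (\<lambda>\<phi>. \<Prod>s<r. e (g s) (T (n j s) \<phi>))" for g
      by (rule integrable_const_bound[of _ 1])
        (auto intro!: AE_I2 prod_le_1 simp: prod_norm[symmetric] norm_unity_root[OF p e_root] T_space)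
    have "complex_of_real (measure \<mu> ?E) = (\<integral>\<phi>. of_real (indicator ?E \<phi>) \<partial>\<mu>)"
      by (rule integral_indicator_complex[OF E, symmetric])
    also have "\<dots> = (\<integral>\<phi>. (\<Sum>g\<in>G. (\<Prod>s<r. c s (g s)) * (\<Prod>s<r. e (g s) (T (n j s) \<phi>))) \<partial>\<mu>)"
    proof (intro Bochner_Integration.integral_cong refl)
      fix \<phi> assume \<phi>: "\<phi> \<in> space \<mu>"
      have "complex_of_real (indicator ?E \<phi>) = (\<Prod>s<r. of_real (indicator (B s) (T (n j s) \<phi>)))"
      proof (cases "\<forall>s<r. T (n j s) \<phi> \<in> B s")
        case False
        then obtain s where "s < r" "T (n j s) \<phi> \<notin> B s" by blast
        then have "(\<Prod>s<r. complex_of_real (indicator (B s) (T (n j s) \<phi>))) = 0"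
          by (intro prod_zero bexI[of _ s]) auto
        then show ?thesis using False by simp
      qed (use \<phi> in simp)
      also have "\<dots> = (\<Prod>s<r. \<Sum>x\<in>V s. c s x * e x (T (n j s) \<phi>))"
        using V(2) T_space[OF \<phi>] by (intro prod.cong) auto
      also have "\<dots> = (\<Sum>g\<in>G. (\<Prod>s<r. c s (g s) * e (g s) (T (n j s) \<phi>)))"
        unfolding G_def using V(1) by (intro prod_sum_PiE) auto
      finally show "complex_of_real (indicator ?E \<phi>) = (\<Sum>g\<in>G. (\<Prod>s<r. c s (g s)) * (\<Prod>s<r. e (g s) (T (n j s) \<phi>)))"
        by (simp add: prod.distrib)
    qed
    also have "\<dots> = (\<Sum>g\<in>G. (\<Prod>s<r. c s (g s)) * (\<integral>\<phi>. (\<Prod>s<r. e (g s) (T (n j s) \<phi>)) \<partial>\<mu>))"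
      using int by simp
    also have "\<dots> = (\<Sum>g\<in>G. (\<Prod>s<r. if g s \<in> I then c s (g s) else 0))"
      by (intro sum.cong refl, subst split) (auto simp: prod.distrib[symmetric] intro!: prod.cong)
    also have "\<dots> = (\<Prod>s<r. \<Sum>x\<in>V s. if x \<in> I then c s x else 0)"
      unfolding G_def using V(1) by (intro prod_sum_PiE[symmetric]) auto
    also have "\<dots> = (\<Prod>s<r. of_real (measure \<mu> (B s)))"
      using V Bm by (intro prod.cong refl measure_trig[symmetric]) auto
    finally show "measure \<mu> ?E = (\<Prod>s<r. measure \<mu> (B s))" by (simp only: of_real_prod[symmetric] of_real_eq_iff)
  qed
qed

text \<open>Replacing each \<open>A s\<close> by a nearby set from \<open>trig_sets\<close> costs at
  most \<open>r * \<delta>\<close>, uniformly in \<open>j\<close> because the action preserves the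
  measure.\<close>

lemma mixing_if_no_relations:
  assumes ev: "\<And>y :: nat \<Rightarrow> 'g. (\<exists>s<r. y s \<notin> I) \<Longrightarrow> \<forall>\<^sub>F j in sequentially. (\<Sum>s<r. act (n j s) (y s)) \<notin> I"
    and A: "\<And>s. s < r \<Longrightarrow> A s \<in> sets \<mu>"
  shows "(\<lambda>j. measure \<mu> {\<phi> \<in> space \<mu>. \<forall>s<r. T (n j s) \<phi> \<in> A s}) \<longlonglongrightarrow> (\<Prod>s<r. measure \<mu> (A s))"
proof (rule LIMSEQ_I)
  fix \<epsilon> :: real assume \<epsilon>: "\<epsilon> > 0"
  \<comment> \<open>Two errors of \<open>r * \<delta>\<close> have to stay below
    \<open>\<epsilon>\<close>; the summand 1 makes this strict and covers
    \<open>r = 0\<close>.\<close>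
  define \<delta> where "\<delta> = \<epsilon> / (2 * real r + 1)"
  have \<delta>: "\<delta> > 0" using \<epsilon> by (simp add: \<delta>_def)
  have "\<forall>s. \<exists>B. s < r \<longrightarrow> B \<in> trig_sets \<and> measure \<mu> (sym_diff (A s) B) < \<delta>"
    using trig_approximation[OF A \<delta>] by blast
  then obtain B where B: "\<And>s. s < r \<Longrightarrow> B s \<in> trig_sets" "\<And>s. s < r \<Longrightarrow> measure \<mu> (sym_diff (A s) (B s)) < \<delta>"
    by metis
  have Bm: "B s \<in> sets \<mu>" if "s < r" for s using B(1)[OF that] by (rule trig_sets_measurable)
  let ?E = "\<lambda>C j. {\<phi> \<in> space \<mu>. \<forall>s<r. T (n j s) \<phi> \<in> C s}"
  have E: "?E C j \<in> sets \<mu>" if "\<And>s. s < r \<Longrightarrow> C s \<in> sets \<mu>" for C j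
    by (rule joint_event_measurable[OF that])
  have close: "\<bar>measure \<mu> (?E A j) - measure \<mu> (?E B j)\<bar> \<le> real r * \<delta>" for j
  proof -
    have "\<bar>measure \<mu> (?E A j) - measure \<mu> (?E B j)\<bar> \<le> measure \<mu> (sym_diff (?E A j) (?E B j))"
      by (intro abs_measure_diff_le E A Bm)
    also have "\<dots> \<le> measure \<mu> (\<Union>s\<in>{..<r}. T (n j s) -` sym_diff (A s) (B s) \<inter> space \<mu>)"
      using A Bm T_measurable by (intro finite_measure_mono sets.finite_UN) (auto intro: measurable_sets)
    also have "\<dots> \<le> (\<Sum>s<r. measure \<mu> (T (n j s) -` sym_diff (A s) (B s) \<inter> space \<mu>))"
      using A Bm T_measurable by (intro finite_measure_subadditive_finite) (auto intro: measurable_sets)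
    also have "\<dots> = (\<Sum>s<r. measure \<mu> (sym_diff (A s) (B s)))"
      using A Bm by (intro sum.cong refl measure_T) auto
    also have "\<dots> \<le> (\<Sum>s<r. \<delta>)" using B(2) by (intro sum_mono) (auto intro: less_imp_le)
    finally show ?thesis by simp
  qed
  have closep: "\<bar>(\<Prod>s<r. measure \<mu> (A s)) - (\<Prod>s<r. measure \<mu> (B s))\<bar> \<le> real r * \<delta>"
  proof -
    have "\<bar>(\<Prod>s<r. measure \<mu> (A s)) - (\<Prod>s<r. measure \<mu> (B s))\<bar> \<le> (\<Sum>s<r. \<bar>measure \<mu> (A s) - measure \<mu> (B s)\<bar>)"
      using norm_prod_diff[of "{..<r}" "\<lambda>s. measure \<mu> (A s)" "\<lambda>s. measure \<mu> (B s)"] by simp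
    also have "\<dots> \<le> (\<Sum>s<r. \<delta>)"
      using abs_measure_diff_le[OF A Bm] B(2) by (intro sum_mono) (force intro: order_trans less_imp_le)
    finally show ?thesis by simp
  qed
  obtain N where N: "\<And>j. j \<ge> N \<Longrightarrow> measure \<mu> (?E B j) = (\<Prod>s<r. measure \<mu> (B s))"
    using eventually_independent[where B = B, OF ev B(1)] by (auto simp: eventually_sequentially)
  have "norm (measure \<mu> (?E A j) - (\<Prod>s<r. measure \<mu> (A s))) < \<epsilon>" if "j \<ge> N" for j
  proof -
    have "\<bar>measure \<mu> (?E A j) - (\<Prod>s<r. measure \<mu> (A s))\<bar> \<le> real r * \<delta> + real r * \<delta>"
      using close[of j] closep N[OF that] by linarith
    also have "\<dots> < (2 * real r + 1) * \<delta>" using \<delta> by (simp add: algebra_simps)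
    also have "\<dots> = \<epsilon>" by (simp add: \<delta>_def)
    finally show ?thesis by simp
  qed
  then show "\<exists>N. \<forall>j\<ge>N. norm (measure \<mu> (?E A j) - (\<Prod>s<r. measure \<mu> (A s))) < \<epsilon>" by blast
qed

text \<open>A relation forces the values of the characters \<open>y s\<close> along the orbit to have product \<open>1\<close>.
  Level sets of positive measure whose values have another product are therefore never met simultaneously.\<close>

lemma relation_obstructs_mixing:
  assumes F: "finite F" "F \<noteq> {}" "\<And>s. s \<in> F \<Longrightarrow> y s \<notin> I"
  obtains A where "\<And>s. s \<in> F \<Longrightarrow> A s \<in> sets \<mu>" "(\<Prod>s\<in>F. measure \<mu> (A s)) > 0"
    "\<And>n. (\<Sum>s\<in>F. act (n s) (y s)) \<in> I \<Longrightarrow> {\<phi> \<in> space \<mu>. \<forall>s\<in>F. T (n s) \<phi> \<in> A s} = {}"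
proof -
  obtain s0 where s0: "s0 \<in> F" using F(2) by blast
  have "\<forall>s. \<exists>\<zeta> \<xi>. s \<in> F \<longrightarrow> \<zeta> \<noteq> \<xi> \<and> measure \<mu> (level (y s) \<zeta>) > 0 \<and> measure \<mu> (level (y s) \<xi>) > 0"
    using two_levels F(3) by metis
  then obtain \<zeta> \<xi> where zx: "\<And>s. s \<in> F \<Longrightarrow> \<zeta> s \<noteq> \<xi> s" "\<And>s. s \<in> F \<Longrightarrow> measure \<mu> (level (y s) (\<zeta> s)) > 0"
    "\<And>s. s \<in> F \<Longrightarrow> measure \<mu> (level (y s) (\<xi> s)) > 0"
    by metis
  have "\<exists>\<eta>. (\<forall>s\<in>F. measure \<mu> (level (y s) (\<eta> s)) > 0) \<and> (\<Prod>s\<in>F. \<eta> s) \<noteq> 1"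
  proof (cases "(\<Prod>s\<in>F. \<zeta> s) = 1")
    case False
    then show ?thesis using zx by blast
  next
    case True
    \<comment> \<open>If the chosen values happen to have product 1, changing one of them to the
      second available value changes the product.\<close>
    let ?\<eta> = "\<zeta>(s0 := \<xi> s0)"
    have "(\<Prod>s\<in>F. ?\<eta> s) = \<xi> s0 * (\<Prod>s\<in>F - {s0}. \<zeta> s)"
      using F(1) s0 by (subst prod.remove[of F s0]) auto
    moreover have "1 = \<zeta> s0 * (\<Prod>s\<in>F - {s0}. \<zeta> s)"
      using True F(1) s0 by (subst (asm) prod.remove[of F s0]) auto
    moreover have "\<zeta> s0 \<noteq> \<xi> s0" using zx s0 by blast
    ultimately have "(\<Prod>s\<in>F. ?\<eta> s) \<noteq> 1" by (metis mult_cancel_right mult_zero_right zero_neq_one)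
    then show ?thesis using zx s0 by (intro exI[of _ ?\<eta>]) auto
  qed
  then obtain \<eta> where \<eta>: "\<And>s. s \<in> F \<Longrightarrow> measure \<mu> (level (y s) (\<eta> s)) > 0" "(\<Prod>s\<in>F. \<eta> s) \<noteq> 1" by blast
  show ?thesis
  proof (rule that[of "\<lambda>s. level (y s) (\<eta> s)"])
    show "(\<Prod>s\<in>F. measure \<mu> (level (y s) (\<eta> s))) > 0" using \<eta>(1) by (intro prod_pos) auto
    fix n assume n: "(\<Sum>s\<in>F. act (n s) (y s)) \<in> I"
    show "{\<phi> \<in> space \<mu>. \<forall>s\<in>F. T (n s) \<phi> \<in> level (y s) (\<eta> s)} = {}"
    proof (rule equals0I)
      fix \<phi> assume "\<phi> \<in> {\<phi> \<in> space \<mu>. \<forall>s\<in>F. T (n s) \<phi> \<in> level (y s) (\<eta> s)}"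
      then have \<phi>: "\<phi> \<in> space \<mu>" "\<And>s. s \<in> F \<Longrightarrow> e (y s) (T (n s) \<phi>) = \<eta> s" by (auto simp: level_def)
      have "1 = e (\<Sum>s\<in>F. act (n s) (y s)) \<phi>" using e_triv[OF n \<phi>(1)] by simp
      also have "\<dots> = (\<Prod>s\<in>F. \<eta> s)" using \<phi> F(1) by (simp add: e_sum e_T[symmetric])
      finally show False using \<eta>(2) by simp
    qed
  qed simp
qed

end

section \<open>The dual of the quotient ring\<close>

lemma cring_laurent_ring: "cring (laurent_ring :: ('d::finite, 'p::prime_card) laurent ring)"
proof (intro cringI abelian_groupI comm_monoidI)
  fix x :: "('d, 'p) laurent"
  show "\<exists>y\<in>carrier laurent_ring. y \<oplus>\<^bsub>laurent_ring\<^esub> x = \<zero>\<^bsub>laurent_ring\<^esub>"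
    by (rule bexI[of _ "- x"]) (auto simp: laurent_ring_def)
qed (auto simp: laurent_ring_def algebra_simps)

abbreviation (input) proj :: "('d::finite, 'p::prime_card) laurent \<Rightarrow> ('d, 'p) laurent \<Rightarrow> ('d, 'p) laurent set" where
  "proj f x \<equiv> PIdl\<^bsub>laurent_ring\<^esub> f +>\<^bsub>laurent_ring\<^esub> x"

lemma ideal_laurent: "ideal (PIdl\<^bsub>laurent_ring\<^esub> f) (laurent_ring :: ('d::finite, 'p::prime_card) laurent ring)"
  by (rule cring.cgenideal_ideal[OF cring_laurent_ring]) (simp add: laurent_ring_def)

lemma proj_eq: "proj f x = {y. f dvd y - x}"
proof (intro equalityI subsetI)
  fix y assume "y \<in> proj f x"
  then obtain c where "y = c * f + x"
    by (auto simp: a_r_coset_def r_coset_def cgenideal_def laurent_ring_def)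
  then show "y \<in> {y. f dvd y - x}" by simp
next
  fix y assume "y \<in> {y. f dvd y - x}"
  then obtain c where "y - x = f * c" by (auto elim: dvdE)
  then have "y = c * f + x" by (simp add: algebra_simps)
  then show "y \<in> proj f x"
    by (auto simp: a_r_coset_def r_coset_def cgenideal_def laurent_ring_def)
qed

lemma proj_eq_iff: "proj f x = proj f y \<longleftrightarrow> f dvd x - y"
proof
  assume "proj f x = proj f y"
  moreover have "x \<in> proj f x" by (simp add: proj_eq)
  ultimately have "x \<in> proj f y" by blast
  then show "f dvd x - y" by (simp add: proj_eq)
next
  assume *: "f dvd x - y"
  have "f dvd z - x \<longleftrightarrow> f dvd z - y" for z
  proof
    assume "f dvd z - x"
    from dvd_add[OF this *] show "f dvd z - y" by simp
  next
    assume "f dvd z - y"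
    from dvd_diff[OF this *] show "f dvd z - x" by simp
  qed
  then show "proj f x = proj f y" by (simp add: proj_eq)
qed

lemma carrier_quotient_ring: "carrier (quotient_ring f) = range (proj f)"
  by (auto simp: quotient_ring_def FactRing_def A_RCOSETS_def' laurent_ring_def)

lemma proj_hom: "(\<lambda>x. proj f x) \<in> Ring.ring_hom laurent_ring (quotient_ring f)"
  unfolding quotient_ring_def by (rule ideal.rcos_ring_hom[OF ideal_laurent])

lemma proj_add: "proj f x \<oplus>\<^bsub>quotient_ring f\<^esub> proj f y = proj f (x + y)"
  using Ring.ring_hom_add[OF proj_hom, of x y f] by (simp add: laurent_ring_def)

lemma proj_mult: "proj f x \<otimes>\<^bsub>quotient_ring f\<^esub> proj f y = proj f (x * y)"
  using Ring.ring_hom_mult[OF proj_hom, of x y f] by (simp add: laurent_ring_def)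

lemma dual_group_iff:
  "\<phi> \<in> dual_group (quotient_ring f) \<longleftrightarrow> \<phi> \<in> extensional (range (proj f)) \<and>
    (\<forall>x. norm (\<phi> (proj f x)) = 1) \<and> (\<forall>x y. \<phi> (proj f (x + y)) = \<phi> (proj f x) * \<phi> (proj f y))"
proof -
  have "\<phi> \<in> hom (add_monoid (quotient_ring f)) circle_group \<longleftrightarrow>
    (\<forall>x. norm (\<phi> (proj f x)) = 1) \<and> (\<forall>x y. \<phi> (proj f (x + y)) = \<phi> (proj f x) * \<phi> (proj f y))"
    by (auto simp: hom_def circle_group_def carrier_quotient_ring proj_add[symmetric] Pi_iff)
  then show ?thesis by (auto simp: dual_group_def carrier_quotient_ring)
qed

section \<open>Values of characters, and enough characters to separate classes\<close>

lemma laurent_of_nat_card: "(of_nat CARD('p) :: ('d::finite, 'p::prime_card) laurent) = 0"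
  by (metis of_nat_card_eq_0 single_of_nat single_zero)

lemma character_zero: "\<phi> \<in> dual_group (quotient_ring f) \<Longrightarrow> \<phi> (proj f 0) = 1"
  unfolding dual_group_iff by (metis add_0 mult_cancel_right2 norm_zero zero_neq_one)

lemma character_of_nat:
  "\<phi> \<in> dual_group (quotient_ring f) \<Longrightarrow> \<phi> (proj f (of_nat k * x)) = \<phi> (proj f x) ^ k"
  by (induction k) (auto simp: character_zero distrib_right dual_group_iff)

lemma character_root:
  fixes f :: "('d::finite, 'p::prime_card) laurent"
  assumes "\<phi> \<in> dual_group (quotient_ring f)"
  shows "\<phi> (proj f x) ^ CARD('p) = 1"
  using character_of_nat[OF assms, of "CARD('p)" x] character_zero[OF assms]
  by (simp add: laurent_of_nat_card)

lemma character_trivial: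
  "f dvd x \<Longrightarrow> \<phi> \<in> dual_group (quotient_ring f) \<Longrightarrow> \<phi> (proj f x) = 1"
  using proj_eq_iff[of f x 0] character_zero[of \<phi> f] by simp

text \<open>The ideal is a subspace over the prime field. A basis of it stays independent when
  \<open>x\<close> is added, so the values 0 on the basis and 1 at \<open>x\<close> extend
  linearly.\<close>

lemma separating_functional:
  fixes f x :: "('d::finite, 'p::prime_card) laurent"
  assumes "\<not> f dvd x"
  obtains L :: "('d, 'p) laurent \<Rightarrow> 'p mod_ring"
  where "\<And>y z. L (y + z) = L y + L z" "\<And>y. f dvd y \<Longrightarrow> L y = 0" "L x = 1"
proof -
  let ?s = "\<lambda>(c :: 'p mod_ring) (y :: ('d, 'p) laurent). mterm 0 c * y"
  interpret vector_space_pair ?s "(*) :: 'p mod_ring \<Rightarrow> 'p mod_ring \<Rightarrow> 'p mod_ring"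
    by unfold_locales (auto simp: algebra_simps single_add mult_single)
  let ?W = "{y. f dvd y}"
  obtain B where B: "B \<subseteq> ?W" "vs1.independent B" "?W \<subseteq> vs1.span B"
    by (rule vs1.maximal_independent_subset)
  have "vs1.subspace ?W" by (rule vs1.subspaceI) auto
  then have "vs1.span B \<subseteq> ?W" using B(1) by (rule vs1.span_minimal[rotated])
  then have x: "x \<notin> vs1.span B" using assms by auto
  then have "x \<notin> B" using vs1.span_base by blast
  have "vs1.independent (insert x B)" using x B(2) by (rule vs1.independent_insertI)
  then obtain L where L: "Vector_Spaces.linear ?s (*) L" "\<forall>y\<in>insert x B. L y = (if y = x then 1 else 0)"
    using linear_independent_extend[of "insert x B" "\<lambda>y. if y = x then 1 else 0"] by blast
  show ?thesis
  proof (rule that[of L])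
    show "L (y + z) = L y + L z" for y z
      using L(1) by (simp add: Vector_Spaces.linear_def module_hom_def module_hom_axioms_def)
    show "L y = 0" if "f dvd y" for y
    proof (rule linear_eq_0_on_span[OF L(1)])
      show "y \<in> vs1.span B" using B(3) that by auto
      show "L b = 0" if "b \<in> B" for b using L(2) that \<open>x \<notin> B\<close> by auto
    qed
    show "L x = 1" using L(2) by simp
  qed
qed

text \<open>The standard character \<open>exp (2 pi i a / p)\<close>, additive because the
  exponential does not see reduction modulo \<open>p\<close>.\<close>

lemma prime_field_character:
  obtains g :: "'p::prime_card mod_ring \<Rightarrow> complex"
  where "\<And>a b. g (a + b) = g a * g b" "\<And>a. norm (g a) = 1" "g 1 \<noteq> 1"
proof -
  let ?p = "CARD('p)"
  have p: "?p > 1" using prime_card[where 'a = 'p] prime_gt_1_nat by blast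
  define g :: "'p mod_ring \<Rightarrow> complex" where "g a = cis (2 * pi * of_int (to_int_mod_ring a) / of_nat ?p)" for a
  have red: "cis (2 * pi * of_int (k mod int ?p) / of_nat ?p) = cis (2 * pi * of_int k / of_nat ?p)" for k
  proof -
    have "2 * pi * of_int k / of_nat ?p = 2 * pi * of_int (k mod int ?p) / of_nat ?p + 2 * pi * of_int (k div int ?p)"
    proof -
      have "real_of_int k = of_int (k mod int ?p) + of_nat ?p * of_int (k div int ?p)"
        by (metis mod_mult_div_eq of_int_add of_int_mult of_int_of_nat_eq)
      then show ?thesis using p by (simp add: field_simps)
    qed
    then show ?thesis by (simp add: cis_mult[symmetric])
  qed
  show ?thesis
  proof (rule that[of g])
    show "g (a + b) = g a * g b" for a b
      by (simp add: g_def to_int_mod_ring_add red cis_mult add_divide_distrib[symmetric] distrib_left[symmetric])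
    show "norm (g a) = 1" for a by (simp add: g_def)
    have "to_int_mod_ring (1 :: 'p mod_ring) = 1" by simp
    then have g1: "g 1 = cis (2 * pi * real 1 / real ?p)" by (simp add: g_def)
    have "inj_on (\<lambda>k. cis (2 * pi * real k / real ?p)) {..<?p}"
      using Complex.bij_betw_roots_unity[of ?p] p by (auto simp: bij_betw_def)
    then have "cis (2 * pi * real 1 / real ?p) \<noteq> cis (2 * pi * real 0 / real ?p)"
      using p by (auto dest: inj_onD[where x = 1 and y = 0])
    then show "g 1 \<noteq> 1" using g1 by simp
  qed
qed

text \<open>A linear functional to the prime field that vanishes on the ideal but not at \<open>x\<close>, composed with
  an embedding of the prime field into the circle.\<close>

lemma separating_character:
  fixes f x :: "('d::finite, 'p::prime_card) laurent"
  assumes "\<not> f dvd x"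
  obtains \<psi> where "\<psi> \<in> dual_group (quotient_ring f)" "\<psi> (proj f x) \<noteq> 1"
proof -
  obtain L :: "('d, 'p) laurent \<Rightarrow> 'p mod_ring" where L: "\<And>y z. L (y + z) = L y + L z" "\<And>y. f dvd y \<Longrightarrow> L y = 0" "L x = 1"
    using separating_functional[OF assms] by metis
  obtain g :: "'p mod_ring \<Rightarrow> complex" where g: "\<And>a b. g (a + b) = g a * g b" "\<And>a. norm (g a) = 1" "g 1 \<noteq> 1"
    using prime_field_character by metis
  \<comment> \<open>The chosen representative does not matter, since \<open>L\<close> vanishes on
    the ideal.\<close>
  define \<psi> where "\<psi> = (\<lambda>m\<in>range (proj f). g (L (SOME y. proj f y = m)))"
  have \<psi>: "\<psi> (proj f y) = g (L y)" for y
  proof -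
    have "proj f (SOME z. proj f z = proj f y) = proj f y" by (rule someI[of _ y]) simp
    then have "f dvd (SOME z. proj f z = proj f y) - y" by (simp only: proj_eq_iff)
    then have "L ((SOME z. proj f z = proj f y) - y) = 0" by (rule L)
    then have "L (SOME z. proj f z = proj f y) = L y"
      using L(1)[of "(SOME z. proj f z = proj f y) - y" y] by simp
    then show ?thesis by (simp add: \<psi>_def)
  qed
  show ?thesis
  proof (rule that)
    show "\<psi> \<in> dual_group (quotient_ring f)"
      unfolding dual_group_iff by (auto simp: \<psi> L g) (simp add: \<psi>_def)
    show "\<psi> (proj f x) \<noteq> 1" by (simp add: \<psi> L g)
  qed
qed

section \<open>The Borel sets of the dual group are generated by cylinders\<close>

lemma countable_laurent: "countable (UNIV :: ('d::finite, 'p::prime_card) laurent set)"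
proof (rule countable_image_inj_on)
  let ?graph = "\<lambda>x :: ('d, 'p) laurent. (\<lambda>k. (k, coef x k)) ` keys x"
  show "countable (range ?graph)"
    by (rule countable_subset[OF _ countable_Collect_finite]) auto
  show "inj ?graph"
  proof (rule injI, rule poly_mapping_eqI)
    fix x y :: "('d, 'p) laurent" and k
    assume "?graph x = ?graph y"
    then have "(k, c) \<in> ?graph x \<longleftrightarrow> (k, c) \<in> ?graph y" for c by simp
    then have "k \<in> keys x \<and> coef x k = c \<longleftrightarrow> k \<in> keys y \<and> coef y k = c" for c by auto
    then show "coef x k = coef y k" by (metis in_keys_iff)
  qed
qed

lemma dual_group_ext:
  assumes "\<phi> \<in> dual_group (quotient_ring f)" "\<psi> \<in> dual_group (quotient_ring f)"
    and "\<And>x. \<phi> (proj f x) = \<psi> (proj f x)"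
  shows "\<phi> = \<psi>"
  using assms by (intro extensionalityI[of _ "range (proj f)"]) (auto simp: dual_group_iff)

text \<open>Countably many cylinder sets form a base of the topology of the dual group.\<close>

lemma open_in_dual_group_generated:
  fixes f :: "('d::finite, 'p::prime_card) laurent"
  assumes "open U"
  defines "X \<equiv> dual_group (quotient_ring f)"
  shows "U \<inter> X \<in> sigma_sets X {{\<phi> \<in> X. \<phi> (proj f x) = \<zeta>} | x \<zeta>. True}"
proof -
  let ?A = "{{\<phi> \<in> X. \<phi> (proj f x) = \<zeta>} | x \<zeta>. True}"
  \<comment> \<open>Values are \<open>p\<close>-th roots of unity, so these countably many cylinders
    include all nonempty ones.\<close>
  define A0 where "A0 = (\<lambda>(x, \<zeta>). {\<phi> \<in> X. \<phi> (proj f x) = \<zeta>}) ` (UNIV \<times> unity_roots CARD('p))"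
  define \<C> where "\<C> = (\<lambda>F. X \<inter> \<Inter>F) ` {F. F \<subseteq> A0 \<and> finite F}"
  have "countable A0"
    unfolding A0_def by (intro countable_image countable_SIGMA countable_laurent countable_finite finite_unity_roots) simp
  then have "countable \<C>"
    unfolding \<C>_def by (intro countable_image) (simp add: conj_commute countable_Collect_finite_subset)
  have AP: "?A \<subseteq> Pow X" by auto
  interpret S: sigma_algebra X "sigma_sets X ?A" by (rule sigma_algebra_sigma_sets[OF AP])
  have "C \<in> sigma_sets X ?A" if C: "C \<in> \<C>" for C
  proof -
    obtain F where F: "F \<subseteq> A0" "finite F" "C = X \<inter> \<Inter>F" using C by (auto simp: \<C>_def)
    have "A0 \<subseteq> ?A" by (auto simp: A0_def)
    with F(1) have "F \<subseteq> sigma_sets X ?A" using sigma_sets.Basic[of _ ?A X] by blast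
    then have "X \<inter> \<Inter>F \<in> sigma_sets X ?A"
    proof (cases "F = {}")
      case False
      then have "\<Inter>F \<in> sigma_sets X ?A" using \<open>F \<subseteq> sigma_sets X ?A\<close> F(2) S.finite_INT[of F "\<lambda>x. x"] by auto
      then show ?thesis by (intro S.Int S.top)
    next
      case True
      then have "X \<inter> \<Inter>F = X" by simp
      then show ?thesis using S.top by (simp only:)
    qed
    then show ?thesis using F by simp
  qed
  then have "\<Union>{C \<in> \<C>. C \<subseteq> U} \<in> sigma_sets X ?A"
    using \<open>countable \<C>\<close> by (intro S.countable_Union) (auto intro: countable_subset)
  moreover have "U \<inter> X = \<Union>{C \<in> \<C>. C \<subseteq> U}"
  proof (intro equalityI subsetI)
    fix \<phi> assume \<phi>: "\<phi> \<in> U \<inter> X"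
    have "openin (product_topology (\<lambda>i. euclidean) UNIV) U" using assms(1) by (simp add: open_fun_def)
    from product_topology_open_contains_basis[OF this, of \<phi>] \<phi>
    obtain V where V: "\<phi> \<in> (\<Pi>\<^sub>E i\<in>UNIV. V i)" "finite {i. V i \<noteq> UNIV}" "(\<Pi>\<^sub>E i\<in>UNIV. V i) \<subseteq> U" by auto
    define N where "N = {i \<in> range (proj f). V i \<noteq> UNIV}"
    have N: "finite N" unfolding N_def using V(2) by (rule rev_finite_subset) auto
    define F where "F = (\<lambda>i. {\<phi>' \<in> X. \<phi>' i = \<phi> i}) ` N"
    have "F \<subseteq> A0"
    proof
      fix D assume "D \<in> F"
      then obtain x where x: "D = {\<phi>' \<in> X. \<phi>' (proj f x) = \<phi> (proj f x)}" by (auto simp: F_def N_def)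
      have "\<phi> (proj f x) \<in> unity_roots CARD('p)" using character_root \<phi> by (auto simp: X_def)
      then show "D \<in> A0" using x by (auto simp: A0_def intro!: image_eqI[of _ _ "(x, \<phi> (proj f x))"])
    qed
    then have "X \<inter> \<Inter>F \<in> \<C>" using N by (auto simp: \<C>_def F_def)
    moreover have "X \<inter> \<Inter>F \<subseteq> U"
    proof
      fix \<phi>' assume \<phi>': "\<phi>' \<in> X \<inter> \<Inter>F"
      have "\<phi>' i \<in> V i" for i
      proof (cases "i \<in> range (proj f)")
        case True
        then show ?thesis using \<phi>' V(1) by (cases "V i = UNIV") (auto simp: F_def N_def PiE_def Pi_iff)
      next
        case False
        \<comment> \<open>Outside the carrier all characters take the same default value, so such
          coordinates impose no condition.\<close>
        then have "\<phi>' i = undefined" "\<phi> i = undefined"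
          using \<phi> \<phi>' by (auto simp: X_def dual_group_iff extensional_def)
        then show ?thesis using V(1) by (metis PiE_mem UNIV_I)
      qed
      then show "\<phi>' \<in> U" using V(3) by auto
    qed
    moreover have "\<phi> \<in> X \<inter> \<Inter>F" using \<phi> by (auto simp: F_def)
    ultimately show "\<phi> \<in> \<Union>{C \<in> \<C>. C \<subseteq> U}" by blast
  qed (auto simp: \<C>_def)
  ultimately show ?thesis by simp
qed

lemma sets_dual_group:
  fixes f :: "('d::finite, 'p::prime_card) laurent"
  defines "X \<equiv> dual_group (quotient_ring f)"
  shows "sets (restrict_space borel X) = sigma_sets X {{\<phi> \<in> X. \<phi> (proj f x) = \<zeta>} | x \<zeta>. True}"
proof
  let ?A = "{{\<phi> \<in> X. \<phi> (proj f x) = \<zeta>} | x \<zeta>. True}"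
  have AP: "?A \<subseteq> Pow X" by auto
  have "(\<lambda>\<phi>. \<phi>) \<in> borel_measurable (sigma X ?A)"
  proof (rule borel_measurableI)
    fix U :: "(('d, 'p) laurent set \<Rightarrow> complex) set" assume "open U"
    then show "(\<lambda>\<phi>. \<phi>) -` U \<inter> space (sigma X ?A) \<in> sets (sigma X ?A)"
      using open_in_dual_group_generated[of U f] AP by (simp add: X_def)
  qed
  from measurable_sets[OF this] have "B \<inter> X \<in> sigma_sets X ?A" if "B \<in> sets borel" for B
    using that unfolding sets_measure_of[OF AP] space_measure_of[OF AP] vimage_ident .
  then show "sets (restrict_space borel X) \<subseteq> sigma_sets X ?A"
    by (auto simp: sets_restrict_space Int_commute)
  have "?A \<subseteq> sets (restrict_space borel X)"
  proof
    fix D assume "D \<in> ?A"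
    then obtain x \<zeta> where D: "D = {\<phi> \<in> X. \<phi> (proj f x) = \<zeta>}" by blast
    have "(\<lambda>\<phi> :: ('d, 'p) laurent set \<Rightarrow> complex. \<phi> (proj f x)) \<in> borel_measurable borel"
      by (intro borel_measurable_continuous_onI continuous_on_product_coordinates)
    then have "(\<lambda>\<phi> :: ('d, 'p) laurent set \<Rightarrow> complex. \<phi> (proj f x)) -` {\<zeta>} \<in> sets borel"
      using measurable_sets[of "\<lambda>\<phi> :: ('d, 'p) laurent set \<Rightarrow> complex. \<phi> (proj f x)" borel borel "{\<zeta>}"] by simp
    moreover have "D = X \<inter> (\<lambda>\<phi>. \<phi> (proj f x)) -` {\<zeta>}" using D by auto
    ultimately show "D \<in> sets (restrict_space borel X)" by (auto simp: sets_restrict_space)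
  qed
  moreover have "space (restrict_space borel X) = X" by (simp add: space_restrict_space)
  ultimately show "sigma_sets X ?A \<subseteq> sets (restrict_space borel X)"
    using sets.sigma_sets_subset[of ?A "restrict_space borel X"] by simp
qed

section \<open>Haar measure in terms of characters\<close>

lemma character_family_haar:
  fixes f :: "('d::finite, 'p::prime_card) laurent"
  assumes "haar_probability (quotient_ring f) \<mu>"
  shows "space \<mu> = dual_group (quotient_ring f)" "character_family \<mu> CARD('p) (\<lambda>x \<phi>. \<phi> (proj f x))"
proof -
  have s: "sets \<mu> = sets (restrict_space borel (dual_group (quotient_ring f)))"
    using assms by (simp add: haar_probability_def)
  from sets_eq_imp_space_eq[OF this] show sp: "space \<mu> = dual_group (quotient_ring f)"
    by (simp add: space_restrict_space)
  show "character_family \<mu> CARD('p) (\<lambda>x \<phi>. \<phi> (proj f x))"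
  proof (intro character_family.intro character_family_axioms.intro)
    show "prob_space \<mu>" using assms by (simp add: haar_probability_def)
    show "sets \<mu> = sigma_sets (space \<mu>) {{\<phi> \<in> space \<mu>. \<phi> (proj f x) = \<zeta>} | x \<zeta>. True}"
      unfolding s sp by (rule sets_dual_group)
  qed (simp_all add: sp character_root dual_group_iff)
qed

text \<open>Translation by \<open>\<psi>\<close> multiplies the values at \<open>x\<close> by
  \<open>\<psi> (proj f x)\<close>, and translation by the pointwise inverse undoes it.\<close>

lemma char_mult_image_level:
  fixes f :: "('d::finite, 'p::prime_card) laurent"
  defines "X \<equiv> dual_group (quotient_ring f)"
  assumes \<psi>: "\<psi> \<in> X"
  shows "char_mult (quotient_ring f) \<psi> ` {\<phi> \<in> X. \<phi> (proj f x) = \<zeta>} = {\<phi> \<in> X. \<phi> (proj f x) = \<psi> (proj f x) * \<zeta>}"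
proof -
  have cm: "char_mult (quotient_ring f) \<psi> \<phi> (proj f y) = \<psi> (proj f y) * \<phi> (proj f y)" for \<phi> \<psi> y
    by (simp add: char_mult_def carrier_quotient_ring)
  \<comment> \<open>Stated for any \<open>\<theta>\<close> that is multiplicative on classes, since
    the pointwise inverse used below need not be extensional.\<close>
  have cX: "char_mult (quotient_ring f) \<theta> \<phi> \<in> X"
    if "\<And>y. norm (\<theta> (proj f y)) = 1" "\<And>y z. \<theta> (proj f (y + z)) = \<theta> (proj f y) * \<theta> (proj f z)" "\<phi> \<in> X" for \<theta> \<phi>
    using that unfolding X_def dual_group_iff
    by (auto simp: cm norm_mult) (simp add: char_mult_def carrier_quotient_ring)
  have \<psi>1: "norm (\<psi> (proj f y)) = 1" "\<psi> (proj f (y + z)) = \<psi> (proj f y) * \<psi> (proj f z)" for y z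
    using \<psi> by (auto simp: X_def dual_group_iff)
  have \<psi>0: "\<psi> (proj f y) \<noteq> 0" for y using \<psi>1(1)[of y] by auto
  show ?thesis
  proof (intro equalityI subsetI)
    fix \<phi> assume "\<phi> \<in> char_mult (quotient_ring f) \<psi> ` {\<phi> \<in> X. \<phi> (proj f x) = \<zeta>}"
    then show "\<phi> \<in> {\<phi> \<in> X. \<phi> (proj f x) = \<psi> (proj f x) * \<zeta>}" using cX[of \<psi>] \<psi>1 by (auto simp: cm)
  next
    fix \<phi> assume \<phi>: "\<phi> \<in> {\<phi> \<in> X. \<phi> (proj f x) = \<psi> (proj f x) * \<zeta>}"
    let ?\<phi> = "char_mult (quotient_ring f) (\<lambda>m. inverse (\<psi> m)) \<phi>"
    have \<phi>': "?\<phi> \<in> X" using \<phi> by (intro cX) (auto simp: \<psi>1 norm_inverse)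
    have "\<phi> = char_mult (quotient_ring f) \<psi> ?\<phi>"
    proof (rule dual_group_ext[of _ f])
      show "char_mult (quotient_ring f) \<psi> ?\<phi> \<in> dual_group (quotient_ring f)"
        using cX[OF \<psi>1 \<phi>'] by (simp add: X_def)
    qed (use \<phi> \<psi>0 in \<open>auto simp: X_def cm\<close>)
    moreover have "?\<phi> (proj f x) = \<zeta>" using \<phi> \<psi>0[of x] by (simp add: cm)
    ultimately show "\<phi> \<in> char_mult (quotient_ring f) \<psi> ` {\<phi> \<in> X. \<phi> (proj f x) = \<zeta>}" using \<phi>' by blast
  qed
qed

text \<open>Translation by a character that is nontrivial at \<open>x\<close> rotates the levels of
  \<open>x\<close> by a root of unity other than 1.\<close>

lemma haar_orthogonality:
  fixes f :: "('d::finite, 'p::prime_card) laurent"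
  assumes haar: "haar_probability (quotient_ring f) \<mu>" and x: "\<not> f dvd x"
  shows "(\<integral>\<phi>. \<phi> (proj f x) \<partial>\<mu>) = 0"
proof -
  interpret character_family \<mu> "CARD('p)" "\<lambda>x \<phi>. \<phi> (proj f x)" by (rule character_family_haar(2)[OF haar])
  have sp: "space \<mu> = dual_group (quotient_ring f)" by (rule character_family_haar(1)[OF haar])
  obtain \<psi> where \<psi>: "\<psi> \<in> dual_group (quotient_ring f)" "\<psi> (proj f x) \<noteq> 1"
    by (rule separating_character[OF x])
  show ?thesis
  proof (rule integral_e_eq_0)
    show "\<psi> (proj f x) ^ CARD('p) = 1" by (rule character_root[OF \<psi>(1)])
    fix \<zeta>
    have "char_mult (quotient_ring f) \<psi> ` level x \<zeta> = level x (\<psi> (proj f x) * \<zeta>)"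
      using char_mult_image_level[OF \<psi>(1)] by (simp add: level_def sp)
    moreover have "emeasure \<mu> (char_mult (quotient_ring f) \<psi> ` level x \<zeta>) = emeasure \<mu> (level x \<zeta>)"
      using haar \<psi>(1) level_sets unfolding haar_probability_def by blast
    ultimately show "measure \<mu> (level x (\<psi> (proj f x) * \<zeta>)) = measure \<mu> (level x \<zeta>)"
      by (simp add: measure_def)
  qed (rule \<psi>)
qed

lemma alg_action_proj: "alg_action f n \<phi> (proj f x) = \<phi> (proj f (mterm n 1 * x))"
  by (simp add: alg_action_def carrier_quotient_ring monomial_class_def proj_mult)

lemma character_action_haar:
  fixes f :: "('d::finite, 'p::prime_card) laurent"
  assumes haar: "haar_probability (quotient_ring f) \<mu>"
  shows "character_action \<mu> CARD('p) (\<lambda>x \<phi>. \<phi> (proj f x)) {x. f dvd x} (alg_action f) (\<lambda>n x. mterm n 1 * x)"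
proof (intro character_action.intro character_measure.intro character_measure_axioms.intro character_action_axioms.intro)
  have sp: "space \<mu> = dual_group (quotient_ring f)" by (rule character_family_haar(1)[OF haar])
  show "character_family \<mu> CARD('p) (\<lambda>x \<phi>. \<phi> (proj f x))" by (rule character_family_haar(2)[OF haar])
  show "\<phi> (proj f x) = 1" if "x \<in> {x. f dvd x}" "\<phi> \<in> space \<mu>" for x \<phi>
    using that by (simp add: sp character_trivial)
  show "(\<integral>\<phi>. \<phi> (proj f x) \<partial>\<mu>) = 0" if "x \<notin> {x. f dvd x}" for x
    using that by (intro haar_orthogonality[OF haar]) simp
  show "alg_action f n \<phi> \<in> space \<mu>" if "\<phi> \<in> space \<mu>" for n \<phi>
    using that unfolding sp dual_group_iff
    by (auto simp: alg_action_proj distrib_left) (simp add: alg_action_def carrier_quotient_ring)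
  show "alg_action f n \<phi> (proj f x) = \<phi> (proj f (mterm n 1 * x))" for n x \<phi>
    by (rule alg_action_proj)
  show "mterm n 1 * x \<in> {x. f dvd x} \<longleftrightarrow> x \<in> {x. f dvd x}" for n x
    by (simp add: dvd_single_times_iff)
qed

section \<open>Order of mixing\<close>

text \<open>Contraposition of \<open>mixing_if_no_relations\<close>. The representatives
  \<open>m\<close> are fixed, and a relation that is not eventually absent holds for infinitely many
  \<open>j\<close>.\<close>

lemma non_mixing_vanishing_sums:
  fixes f :: "('d::finite, 'p::prime_card) laurent"
  assumes f: "Factorial_Ring.irreducible f" and haar: "haar_probability (quotient_ring f) \<mu>"
    and nm: "non_mixing_sequence \<mu> (alg_action f) r n"
  obtains m J where "vanishing_sums f r n m J"
proof -
  interpret character_action \<mu> "CARD('p)" "\<lambda>x \<phi>. \<phi> (proj f x)" "{x. f dvd x}" "alg_action f" "\<lambda>n x. mterm n 1 * x"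
    by (rule character_action_haar[OF haar])
  have "\<exists>m. (\<exists>s<r. \<not> f dvd m s) \<and> \<not> (\<forall>\<^sub>F j in sequentially. \<not> f dvd (\<Sum>s<r. mterm (n j s) 1 * m s))"
  proof (rule ccontr)
    assume "\<not> ?thesis"
    then have "mixing_sequence \<mu> (alg_action f) r n"
      unfolding mixing_sequence_def by (intro allI impI mixing_if_no_relations) auto
    then show False using nm by (simp add: non_mixing_sequence_def)
  qed
  then obtain m where m: "\<exists>s<r. \<not> f dvd m s"
    "\<not> (\<forall>\<^sub>F j in sequentially. \<not> f dvd (\<Sum>s<r. mterm (n j s) 1 * m s))" by blast
  have "infinite {j. f dvd (\<Sum>s<r. mterm (n j s) 1 * m s)}"
    using m(2) by (simp add: cofinite_eq_sequentially[symmetric] eventually_cofinite)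
  then have "vanishing_sums f r n m {j. f dvd (\<Sum>s<r. mterm (n j s) 1 * m s)}"
    using f nm m(1) by unfold_locales (auto simp: non_mixing_sequence_def)
  then show ?thesis by (rule that)
qed

lemma moving_apart_multiples:
  assumes "inj_on g {..<r}"
  shows "moving_apart r (\<lambda>j s. int j *s g s)"
  unfolding moving_apart_def
proof (intro allI impI)
  fix s t assume st: "s < r" "t < r" "s \<noteq> t"
  then have "g s \<noteq> g t" using assms by (auto dest: inj_onD)
  then have nz: "real_point (g s - g t) \<noteq> 0" using real_point_eq_iff[of "g s - g t" 0] by simp
  have "real_point (int j *s g s - int j *s g t) = real j *\<^sub>R real_point (g s - g t)" for j
    by (simp add: real_point_def vec_eq_iff algebra_simps)
  moreover have "filterlim (\<lambda>j. norm (real_point (g s - g t)) * real j) at_top sequentially"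
    by (rule filterlim_tendsto_pos_mult_at_top[OF tendsto_const _ filterlim_real_sequentially]) (use nz in simp)
  then have "filterlim (\<lambda>j. norm (real j *\<^sub>R real_point (g s - g t))) at_top sequentially"
    by (simp add: mult.commute)
  ultimately show "filterlim (\<lambda>j. real_point (int j *s g s - int j *s g t)) at_infinity sequentially"
    by (simp add: filterlim_norm_at_top_imp_at_infinity)
qed

text \<open>The dilates of a shape, with its points enumerated, are a sequence that moves
  apart.\<close>

lemma r_mixing_imp_mixing_shape:
  assumes r: "r_mixing \<mu> T r" and F: "finite F" "card F = r"
  shows "mixing_shape \<mu> T F"
proof -
  obtain g where g: "bij_betw g {0..<card F} F" using ex_bij_betw_nat_finite[OF F(1)] by blast
  then have g: "bij_betw g {..<r} F" by (simp add: F atLeast0LessThan)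
  have "mixing_sequence \<mu> T r (\<lambda>j s. int j *s g s)"
    using r moving_apart_multiples g by (auto simp: r_mixing_def bij_betw_def)
  then have lim: "(\<lambda>j. measure \<mu> {x \<in> space \<mu>. \<forall>s<r. T (int j *s g s) x \<in> A (g s)})
      \<longlonglongrightarrow> (\<Prod>s<r. measure \<mu> (A (g s)))" if "\<forall>m\<in>F. A m \<in> sets \<mu>" for A
    using that g by (auto simp: mixing_sequence_def bij_betw_def)
  have all: "(\<forall>s<r. P (g s)) \<longleftrightarrow> (\<forall>m\<in>F. P m)" for P
    using g by (auto simp: bij_betw_def)
  show ?thesis
    unfolding mixing_shape_def
  proof (intro allI impI)
    fix A assume "\<forall>m\<in>F. A m \<in> sets \<mu>"
    from lim[OF this] show "(\<lambda>k. measure \<mu> {x \<in> space \<mu>. \<forall>m\<in>F. T (int k *s m) x \<in> A m}) \<longlonglongrightarrow> (\<Prod>m\<in>F. measure \<mu> (A m))"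
      unfolding all[of "\<lambda>m. T (int _ *s m) _ \<in> A m"] prod.reindex_bij_betw[OF g, of "\<lambda>m. measure \<mu> (A m)"] .
  qed
qed

lemma mixing_order_le_shape_mixing_order: "mixing_order \<mu> T \<le> shape_mixing_order \<mu> T"
  unfolding mixing_order_def shape_mixing_order_def
  by (intro Sup_subset_mono) (use r_mixing_imp_mixing_shape in blast)

section \<open>The Frobenius map and the upper bound\<close>

lemma single_power: "mterm k c ^ m = mterm (int m *s k) (c ^ m)" for c :: "'a::comm_ring_1"
proof (induction m)
  case 0
  then show ?case by (simp add: vec_eq_iff)
next
  case (Suc m)
  have "k + int m *s k = int (Suc m) *s k" by (simp add: vec_eq_iff algebra_simps)
  then show ?case using Suc by (simp add: mult_single del: of_nat_Suc)
qed

lemma CHAR_laurent: "CHAR(('d::finite, 'p::prime_card) laurent) = CARD('p)"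
proof (rule CHAR_eqI[OF laurent_of_nat_card])
  fix k assume "of_nat k = (0 :: ('d, 'p) laurent)"
  then have "coef (of_nat k :: ('d, 'p) laurent) 0 = 0" by simp
  then have "of_nat k = (0 :: 'p mod_ring)" by (simp add: lookup_of_nat)
  then show "CARD('p) dvd k" by (simp add: of_nat_eq_0_iff_char_dvd)
qed

text \<open>In characteristic \<open>p\<close> the power map is additive, and it fixes the
  coefficients. Monomial and constant are kept apart to match the relations in
  \<open>relation_obstructs_mixing\<close>.\<close>

lemma frobenius_expansion:
  fixes f :: "('d::finite, 'p::prime_card) laurent"
  shows "f ^ (CARD('p) ^ i) = (\<Sum>k\<in>keys f. mterm (int (CARD('p) ^ i) *s k) 1 * mterm 0 (coef f k))"
proof -
  have "f ^ (CARD('p) ^ i) = (\<Sum>k\<in>keys f. mterm k (coef f k)) ^ (CARD('p) ^ i)"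
    using poly_mapping_sum_singles[of f] by simp
  also have "\<dots> = (\<Sum>k\<in>keys f. mterm k (coef f k) ^ (CARD('p) ^ i))"
    by (rule freshmans_dream_sum'[where n = i]) (simp_all add: CHAR_laurent prime_card)
  also have "\<dots> = (\<Sum>k\<in>keys f. mterm (int (CARD('p) ^ i) *s k) 1 * mterm 0 (coef f k))"
    by (intro sum.cong refl)
      (simp add: single_power mult_single finite_field_power_card_power_eq_same del: of_nat_power)
  finally show ?thesis .
qed

lemma infinite_lattice: "infinite (UNIV :: (int ^ 'd::finite) set)"
proof
  assume "finite (UNIV :: (int ^ 'd) set)"
  then have "finite (range (\<lambda>a :: int. (\<chi> i. a) :: int ^ 'd))" by (rule rev_finite_subset) simp
  moreover have "inj (\<lambda>a :: int. (\<chi> i. a) :: int ^ 'd)" by (rule injI) (simp add: vec_eq_iff)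
  ultimately show False using finite_imageD infinite_UNIV_int by blast
qed

text \<open>A limit along all dilations would persist along those by powers of \<open>p\<close>,
  where the event is empty. Supersets are included because every cardinality from that of the
  support on needs a bad shape.\<close>

lemma support_not_mixing_shape:
  fixes f :: "('d::finite, 'p::prime_card) laurent"
  assumes f: "Factorial_Ring.irreducible f" and haar: "haar_probability (quotient_ring f) \<mu>"
    and F: "finite F" "keys f \<subseteq> F"
  shows "\<not> mixing_shape \<mu> (alg_action f) F"
proof
  assume mix: "mixing_shape \<mu> (alg_action f) F"
  let ?p = "CARD('p)"
  interpret character_action \<mu> ?p "\<lambda>x \<phi>. \<phi> (proj f x)" "{x. f dvd x}" "alg_action f" "\<lambda>n x. mterm n 1 * x"
    by (rule character_action_haar[OF haar])
  have f0: "f \<noteq> 0" "\<not> f dvd 1" using f by (auto simp: Factorial_Ring.irreducible_def)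
  have nI: "mterm 0 (coef f k) \<notin> {x. f dvd x}" if "k \<in> keys f" for k
  proof
    assume "mterm 0 (coef f k) \<in> {x. f dvd x}"
    moreover have "mterm 0 (coef f k) dvd (1 :: ('d, 'p) laurent)"
      using that by (intro single_dvd_one) (simp add: in_keys_iff)
    ultimately show False using f0(2) dvd_trans by blast
  qed
  obtain A where A: "\<And>k. k \<in> keys f \<Longrightarrow> A k \<in> sets \<mu>" "(\<Prod>k\<in>keys f. measure \<mu> (A k)) > 0"
    "\<And>n. (\<Sum>k\<in>keys f. mterm (n k) 1 * mterm 0 (coef f k)) \<in> {x. f dvd x} \<Longrightarrow>
      {\<phi> \<in> space \<mu>. \<forall>k\<in>keys f. alg_action f (n k) \<phi> \<in> A k} = {}"
    by (rule relation_obstructs_mixing[OF finite_keys keys_ne[OF f0(1)] nI]) blast+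
  \<comment> \<open>Points of \<open>F\<close> outside the support get the whole space, which
    changes neither the event nor the product.\<close>
  define A' where "A' k = (if k \<in> keys f then A k else space \<mu>)" for k
  have "(\<lambda>k. measure \<mu> {\<phi> \<in> space \<mu>. \<forall>m\<in>F. alg_action f (int k *s m) \<phi> \<in> A' m}) \<longlonglongrightarrow> (\<Prod>m\<in>F. measure \<mu> (A' m))"
    using mix A(1) by (auto simp: mixing_shape_def A'_def)
  moreover have "(\<Prod>m\<in>F. measure \<mu> (A' m)) = (\<Prod>k\<in>keys f. measure \<mu> (A k))"
    using F by (intro prod.mono_neutral_cong_right) (auto simp: A'_def prob_space)
  moreover have "strict_mono (\<lambda>i. ?p ^ i)"
    using prime_gt_1_nat[OF prime_card[where 'a = 'p]] by (auto simp: strict_mono_def)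
  ultimately have "((\<lambda>k. measure \<mu> {\<phi> \<in> space \<mu>. \<forall>m\<in>F. alg_action f (int k *s m) \<phi> \<in> A' m}) \<circ> (\<lambda>i. ?p ^ i))
      \<longlonglongrightarrow> (\<Prod>k\<in>keys f. measure \<mu> (A k))"
    by (intro LIMSEQ_subseq_LIMSEQ) auto
  moreover have "measure \<mu> {\<phi> \<in> space \<mu>. \<forall>m\<in>F. alg_action f (int (?p ^ i) *s m) \<phi> \<in> A' m} = 0" for i
  proof -
    have "f dvd f ^ (?p ^ i)" by (rule dvd_power) simp
    then have "{\<phi> \<in> space \<mu>. \<forall>k\<in>keys f. alg_action f (int (?p ^ i) *s k) \<phi> \<in> A k} = {}"
      by (intro A(3)) (simp add: frobenius_expansion del: of_nat_power)
    then have "{\<phi> \<in> space \<mu>. \<forall>m\<in>F. alg_action f (int (?p ^ i) *s m) \<phi> \<in> A' m} = {}"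
      using F(2) by (fastforce simp: A'_def)
    then show ?thesis by (simp only: measure_empty)
  qed
  ultimately have "(\<lambda>i. 0) \<longlonglongrightarrow> (\<Prod>k\<in>keys f. measure \<mu> (A k))" by (simp add: o_def)
  then show False using A(2) LIMSEQ_unique[OF tendsto_const] by fastforce
qed

theorem theorem4:
  fixes f :: "('d::finite, 'p::prime_card) laurent"
    and \<mu> :: "(('d, 'p) laurent set \<Rightarrow> complex) measure"
  assumes "Factorial_Ring.irreducible f"
    and "haar_probability (quotient_ring f) \<mu>"
  shows "(\<forall>(r::nat) (n :: nat \<Rightarrow> nat \<Rightarrow> int ^ 'd).
            non_mixing_sequence \<mu> (alg_action f) r n \<longrightarrow>
              contains_parallel_redrawing r n (newton_polyhedron f)) \<and>
         enat (card (vertices (newton_polyhedron f)) - 1) \<le> mixing_order \<mu> (alg_action f) \<and>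
         mixing_order \<mu> (alg_action f) \<le> shape_mixing_order \<mu> (alg_action f) \<and>
         shape_mixing_order \<mu> (alg_action f) \<le> enat (card (Poly_Mapping.keys f) - 1)"
proof (intro conjI allI impI)
  fix r n assume "non_mixing_sequence \<mu> (alg_action f) r n"
  then obtain m J where "vanishing_sums f r n m J"
    using non_mixing_vanishing_sums[OF assms] by blast
  then show "contains_parallel_redrawing r n (newton_polyhedron f)"
    unfolding newton_polyhedron_def by (rule vanishing_sums.contains_parallel_redrawing_newton)
next
  let ?r = "card (vertices (newton_polyhedron f)) - 1"
  have "mixing_sequence \<mu> (alg_action f) ?r n" if "moving_apart ?r n" for n
  proof (rule ccontr)
    assume "\<not> ?thesis"
    then have "non_mixing_sequence \<mu> (alg_action f) ?r n"
      using that by (simp add: non_mixing_sequence_def)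
    then obtain m J where v: "vanishing_sums f ?r n m J"
      using non_mixing_vanishing_sums[OF assms] by blast
    have "card (vertices (newton_polyhedron f)) \<le> ?r"
      using vanishing_sums.card_vertices_newton_le[OF v] by (simp add: newton_polyhedron_def)
    \<comment> \<open>Subtraction is truncated, so the inequality just shown is absurd only for a
      positive number of vertices; a nontrivial relation has at least one term.\<close>
    moreover have "?r > 0" using vanishing_sums.nontrivial[OF v] by auto
    ultimately show False by simp
  qed
  then show "enat ?r \<le> mixing_order \<mu> (alg_action f)"
    unfolding mixing_order_def r_mixing_def by (intro Sup_upper) blast
next
  show "mixing_order \<mu> (alg_action f) \<le> shape_mixing_order \<mu> (alg_action f)"
    by (rule mixing_order_le_shape_mixing_order)
next
  show "shape_mixing_order \<mu> (alg_action f) \<le> enat (card (keys f) - 1)"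
    unfolding shape_mixing_order_def
  proof (rule Sup_least, clarify)
    fix r assume shapes: "\<forall>F. finite F \<and> card F = r \<longrightarrow> mixing_shape \<mu> (alg_action f) F"
    have "r < card (keys f)"
    proof (rule ccontr)
      assume "\<not> ?thesis"
      then have le: "card (keys f) \<le> r" by simp
      obtain B where B: "finite B" "card B = r - card (keys f)" "keys f \<inter> B = {}"
        using finite_arbitrarily_large_disj[OF infinite_lattice, of "keys f"] by auto
      have "card (keys f \<union> B) = r" using B le by (simp add: card_Un_disjoint)
      then show False
        using shapes support_not_mixing_shape[OF assms, of "keys f \<union> B"] B(1) by auto
    qed
    then show "enat r \<le> enat (card (keys f) - 1)" by simp
  qed
qed

end
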